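(* Let $\alpha>0$ and let $V$ be a potential on $\mathbb{R}^n$ which is negative, homogeneous of degree $-\alpha$, and smooth away from $0$ (so that $U=-V:\mathbb{R}^n\to(0,\infty]$ has the origin as its only collision point). If the JM-Marchal lemma holds for $V$ at energy $0$, then the Marchal lemma holds for $V$.
   Context: Setting. Configuration space is a Euclidean vector space $\mathbb{R}^n$ with a potential $V=-U$, where $U:\mathbb{R}^n\to(0,\infty]$ is continuous. A collision point is a point $p\in\mathbb{R}^n$ with $U(p)=\infty$. Homogeneous of degree $-\alpha$ means $V(\lambda q)=\lambda^{-\alpha}V(q)$ for $\lambda>0$, $q\neq 0$. The Lagrangian is $L(q,\dot q)=\frac12|\dot q|^2+U(q)$, and the action of an absolutely continuous path $c$ is $A(c)=\int_c L\,dt\in[0,\infty]$. An interior collision point of a path is a collision point along the path which is not one of the path's endpoints. Fixed endpoint, fixed time action minimization problem: given $q_0,q_1\in\mathbb{R}^n$ and $T>0$, minimize $\int_c L\,dt$ over all (absolutely continuous) paths $c$ joining $q_0$ to $q_1$ in time $T$. A minimizer is understood to have finite action. The Marchal lemma holds for $V$ if, for every choice of $q_0,q_1\in\mathbb{R}^n$ and $T>0$, every minimizer of the fixed endpoint, fixed time action minimization problem has no interior collision points. Zero-energy Jacobi-Maupertuis (JM) length. The JM length at energy $0$ of an absolutely continuous curve $c$ in $\mathbb{R}^n$ is $\ell(c)=\int_c\sqrt{2U(q)}\,|dq|\in[0,\infty]$. A curve $c$ joining $p$ to $q$ is a minimizing JM geodesic for energy $0$ if $\ell(c)<\infty$ and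 $\ell(c)\le\ell(\sigma)$ for every absolutely continuous curve $\sigma$ joining $p$ to $q$. The JM-Marchal lemma holds for $V$ at energy $0$ if no minimizing JM geodesic for energy $0$ has an interior collision point. *)

theory Defs
  imports "HOL-Analysis.Analysis"
begin

section \<open>Potentials with values in the extended reals\<close>

text \<open>A potential \<open>V = - U\<close> with \<open>U\<close> taking values in \<open>(0, \<infinity>]\<close> is modelled as a function
  into \<^typ>\<open>ereal\<close> which is negative everywhere; continuity refers to the order topology of
  \<^typ>\<open>ereal\<close>, so \<open>U\<close> tends to infinity at the collision points.\<close>

definition potential :: "('a::euclidean_space \<Rightarrow> ereal) \<Rightarrow> bool" where
  "potential V \<longleftrightarrow> continuous_on UNIV V \<and> (\<forall>q. V q < 0)"

definition neg_potential :: "('a::euclidean_space \<Rightarrow> ereal) \<Rightarrow> 'a \<Rightarrow> ennreal" where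
  "neg_potential V q = e2ennreal (- V q)"

definition collision_point :: "('a::euclidean_space \<Rightarrow> ereal) \<Rightarrow> 'a \<Rightarrow> bool" where
  "collision_point V p \<longleftrightarrow> neg_potential V p = \<infinity>"

definition homogeneous_of_degree :: "real \<Rightarrow> ('a::euclidean_space \<Rightarrow> ereal) \<Rightarrow> bool" where
  "homogeneous_of_degree d V \<longleftrightarrow>
     (\<forall>r q. r > 0 \<and> q \<noteq> 0 \<longrightarrow> V (r *\<^sub>R q) = ereal (r powr d) * V q)"

text \<open>For open \<open>S\<close>, \<open>k_times_differentiable_on S f k\<close> says that \<open>f\<close> is of class \<open>C\<^sup>k\<close> on \<open>S\<close>.\<close>

primrec k_times_differentiable_on ::
    "'a::euclidean_space set \<Rightarrow> ('a \<Rightarrow> 'b::real_normed_vector) \<Rightarrow> nat \<Rightarrow> bool" where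
  "k_times_differentiable_on S f 0 \<longleftrightarrow> continuous_on S f"
| "k_times_differentiable_on S f (Suc k) \<longleftrightarrow>
     (\<forall>x\<in>S. f differentiable (at x)) \<and>
     (\<forall>v. k_times_differentiable_on S (\<lambda>x. frechet_derivative f (at x) v) k)"

definition smooth_on :: "'a::euclidean_space set \<Rightarrow> ('a \<Rightarrow> 'b::real_normed_vector) \<Rightarrow> bool" where
  "smooth_on S f \<longleftrightarrow> (\<forall>k. k_times_differentiable_on S f k)"

definition smooth_away_from_0 :: "('a::euclidean_space \<Rightarrow> ereal) \<Rightarrow> bool" where
  "smooth_away_from_0 V \<longleftrightarrow>
     (\<forall>q. q \<noteq> 0 \<longrightarrow> \<bar>V q\<bar> \<noteq> \<infinity>) \<and> smooth_on (- {0}) (\<lambda>q. real_of_ereal (V q))"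


section \<open>Absolutely continuous paths\<close>

text \<open>The usual \<open>\<epsilon>\<close>-\<open>\<delta>\<close> definition. A division \<open>D\<close> is a finite family of compact intervals
  with pairwise disjoint interiors, so \<open>Inf k\<close> and \<open>Sup k\<close> are the end points of \<open>k\<close>.\<close>

definition absolutely_continuous_path ::
    "real \<Rightarrow> real \<Rightarrow> (real \<Rightarrow> 'a::euclidean_space) \<Rightarrow> bool" where
  "absolutely_continuous_path a b c \<longleftrightarrow>
     (\<forall>\<epsilon>>0. \<exists>\<delta>>0. \<forall>D. D division_of \<Union>D \<and> \<Union>D \<subseteq> {a..b} \<and> (\<Sum>k\<in>D. Sup k - Inf k) < \<delta>
        \<longrightarrow> (\<Sum>k\<in>D. norm (c (Sup k) - c (Inf k))) < \<epsilon>)"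

text \<open>Only meaningful almost everywhere, which is where absolutely continuous paths are
  differentiable; it is used under Lebesgue integrals only.\<close>

definition velocity :: "real \<Rightarrow> real \<Rightarrow> (real \<Rightarrow> 'a::euclidean_space) \<Rightarrow> real \<Rightarrow> 'a" where
  "velocity a b c t = vector_derivative c (at t within {a..b})"

text \<open>Being an endpoint is a property of the point \<open>p\<close>, not of the time at which it is visited. If
  times were used instead, a path resting at a collision point (e.g. a constant path, which has JM
  length \<open>0\<close>) would always be a minimizing JM geodesic with an interior collision.\<close>

definition interior_collision_point ::
    "('a::euclidean_space \<Rightarrow> ereal) \<Rightarrow> real \<Rightarrow> real \<Rightarrow> (real \<Rightarrow> 'a) \<Rightarrow> 'a \<Rightarrow> bool" where
  "interior_collision_point V a b c p \<longleftrightarrow>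
     collision_point V p \<and> p \<in> c ` {a..b} \<and> p \<noteq> c a \<and> p \<noteq> c b"


section \<open>The fixed endpoint, fixed time action minimization problem\<close>

definition lagrangian :: "('a::euclidean_space \<Rightarrow> ereal) \<Rightarrow> 'a \<Rightarrow> 'a \<Rightarrow> ennreal" where
  "lagrangian V q v = ennreal ((norm v)\<^sup>2 / 2) + neg_potential V q"

definition action ::
    "('a::euclidean_space \<Rightarrow> ereal) \<Rightarrow> real \<Rightarrow> real \<Rightarrow> (real \<Rightarrow> 'a) \<Rightarrow> ennreal" where
  "action V a b c = (\<integral>\<^sup>+t\<in>{a..b}. lagrangian V (c t) (velocity a b c t) \<partial>lebesgue)"

definition joins_in_time ::
    "(real \<Rightarrow> 'a::euclidean_space) \<Rightarrow> 'a \<Rightarrow> 'a \<Rightarrow> real \<Rightarrow> bool" where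
  "joins_in_time c q0 q1 T \<longleftrightarrow> absolutely_continuous_path 0 T c \<and> c 0 = q0 \<and> c T = q1"

definition action_minimizer ::
    "('a::euclidean_space \<Rightarrow> ereal) \<Rightarrow> 'a \<Rightarrow> 'a \<Rightarrow> real \<Rightarrow> (real \<Rightarrow> 'a) \<Rightarrow> bool" where
  "action_minimizer V q0 q1 T c \<longleftrightarrow>
     joins_in_time c q0 q1 T \<and> action V 0 T c < \<infinity> \<and>
     (\<forall>\<sigma>. joins_in_time \<sigma> q0 q1 T \<longrightarrow> action V 0 T c \<le> action V 0 T \<sigma>)"

definition marchal_lemma_holds :: "('a::euclidean_space \<Rightarrow> ereal) \<Rightarrow> bool" where
  "marchal_lemma_holds V \<longleftrightarrow>
     (\<forall>q0 q1 T c. T > 0 \<and> action_minimizer V q0 q1 T c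
        \<longrightarrow> \<not> (\<exists>p. interior_collision_point V 0 T c p))"


section \<open>Jacobi-Maupertuis geodesics at energy zero\<close>

definition ennreal_sqrt :: "ennreal \<Rightarrow> ennreal" where
  "ennreal_sqrt x = (if x = \<infinity> then \<infinity> else ennreal (sqrt (enn2real x)))"

text \<open>The convention \<open>\<infinity> * 0 = 0\<close> in \<^typ>\<open>ennreal\<close> is the right one here: an absolutely continuous
  path has velocity \<open>0\<close> at almost every time at which it visits a given point.\<close>

definition jm_length ::
    "('a::euclidean_space \<Rightarrow> ereal) \<Rightarrow> real \<Rightarrow> real \<Rightarrow> (real \<Rightarrow> 'a) \<Rightarrow> ennreal" where
  "jm_length V a b c =
     (\<integral>\<^sup>+t\<in>{a..b}. ennreal_sqrt (2 * neg_potential V (c t)) * ennreal (norm (velocity a b c t))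
        \<partial>lebesgue)"

text \<open>Competing curves may be parametrized by any compact interval.\<close>

definition minimizing_jm_geodesic ::
    "('a::euclidean_space \<Rightarrow> ereal) \<Rightarrow> real \<Rightarrow> real \<Rightarrow> (real \<Rightarrow> 'a) \<Rightarrow> bool" where
  "minimizing_jm_geodesic V a b c \<longleftrightarrow>
     a < b \<and> absolutely_continuous_path a b c \<and> jm_length V a b c < \<infinity> \<and>
     (\<forall>a' b' \<sigma>. a' < b' \<and> absolutely_continuous_path a' b' \<sigma> \<and> \<sigma> a' = c a \<and> \<sigma> b' = c b
        \<longrightarrow> jm_length V a b c \<le> jm_length V a' b' \<sigma>)"

definition jm_marchal_lemma_holds :: "('a::euclidean_space \<Rightarrow> ereal) \<Rightarrow> bool" where
  "jm_marchal_lemma_holds V \<longleftrightarrow>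
     (\<forall>a b c. minimizing_jm_geodesic V a b c
        \<longrightarrow> \<not> (\<exists>p. interior_collision_point V a b c p))"

end

theory Submission
  imports Defs "HOL-Complex_Analysis.Great_Picard"
begin

text \<open>By the arithmetic-geometric mean inequality the action of a path is at least its zero-energy
  length, with equality for zero-energy parametrizations. Let \<open>d\<close> be the distance defined by this
  length; it is homogeneous of degree \<open>\<beta> = 1 - \<alpha> / 2\<close>. If \<open>\<beta> \<le> 0\<close>, no path of finite action reaches
  the origin. If \<open>\<beta> > 0\<close>, minimizing geodesics exist by the Arzela-Ascoli theorem, so the JM-Marchal
  lemma gives \<open>d p q < d p 0 + d 0 q\<close> for nonzero \<open>p\<close>, \<open>q\<close> (otherwise two geodesics could be
  concatenated at the origin). By compactness and scaling, the defect is at least \<open>\<delta> r\<^sup>\<beta>\<close> if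
  \<open>|p| = |q| = r\<close>.

  Now let an action minimizer pass through the origin, and let \<open>p\<close>, \<open>q\<close> be the nearby points where it
  enters and leaves the ball of radius \<open>r\<close>. Replacing the part between them by a zero-energy geodesic
  from \<open>p\<close> to \<open>q\<close> saves at least \<open>\<delta> r\<^sup>\<beta>\<close> of action. The total time is corrected by an affine time change
  of the remaining path, which costs at most a constant times the change of duration. As \<open>U\<close> is
  large near the origin, both durations are \<open>o(r\<^sup>\<beta>)\<close>, and for small \<open>r\<close> the action has
  decreased.\<close>

section \<open>Differentiability of monotone functions\<close>

text \<open>Absolute continuity is given by the \<epsilon>-\<delta> condition on divisions, whereas
  action and length are integrals of the velocity. The link is bounded variation: it makes each
  coordinate of a path a difference of continuous nondecreasing functions, whose derivatives come
  from Vitali coverings.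

  Limits of curves are taken in terms of the distance: a Lipschitz bound with respect to
  \<open>d\<close> survives pointwise limits because \<open>d\<close> is continuous, and
  \<open>speed_bound\<close> turns it back into a bound on the length.

  The JM-Marchal lemma enters twice. Besides the strict triangle inequality it shows that geodesics
  between nonzero points avoid the origin. U is then finite and continuous along them, so the
  zero-energy time change has a positive continuous derivative.

  The action B of the removed piece is not bounded in advance by a power of r. The cost of the time
  correction is therefore estimated by a small multiple of L + B, where L is the distance between
  the ends of that piece, and the part coming from the excess B - L is absorbed.\<close>

lemma Vitali_covering_theorem_intervals:
  fixes S :: "real set" and K :: "(real \<times> real) set"
  assumes K: "\<And>u v. (u, v) \<in> K \<Longrightarrow> u < v"
    and S: "\<And>x d. x \<in> S \<Longrightarrow> 0 < d \<Longrightarrow> \<exists>u v. (u, v) \<in> K \<and> u \<le> x \<and> x \<le> v \<and> v - u < d"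
  obtains C where "countable C" "C \<subseteq> K" "disjoint_family_on (\<lambda>i. {fst i..snd i}) C"
    "negligible (S - (\<Union>i\<in>C. {fst i..snd i}))"
proof -
  have cb: "cball ((fst i + snd i) / 2) ((snd i - fst i) / 2) = {fst i..snd i}" for i :: "real \<times> real"
    by (simp add: cball_eq_atLeastAtMost field_simps)
  obtain C where C: "countable C" "C \<subseteq> K"
     "pairwise (\<lambda>i j. disjnt (cball ((fst i + snd i) / 2) ((snd i - fst i) / 2))
                              (cball ((fst j + snd j) / 2) ((snd j - fst j) / 2))) C"
     "negligible (S - (\<Union>i\<in>C. cball ((fst i + snd i) / 2) ((snd i - fst i) / 2)))"
  proof (rule Vitali_covering_theorem_cballs[of K "\<lambda>i. (snd i - fst i) / 2" S "\<lambda>i. (fst i + snd i) / 2"])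
    show "0 < (snd i - fst i) / 2" if "i \<in> K" for i
      using K that by (cases i) auto
    show "\<exists>i. i \<in> K \<and> x \<in> cball ((fst i + snd i) / 2) ((snd i - fst i) / 2) \<and> (snd i - fst i) / 2 < d"
      if x: "x \<in> S" "0 < d" for x d
    proof -
      obtain u v where "(u, v) \<in> K" "u \<le> x" "x \<le> v" "v - u < d"
        using S[OF x] by blast
      then show ?thesis
        unfolding cb using \<open>0 < d\<close> K[of u v] by (intro exI[of _ "(u, v)"]) auto
    qed
  qed blast
  show thesis
    by (rule that[of C]) (use C in \<open>auto simp: cb disjoint_family_on_def pairwise_def disjnt_def\<close>)
qed

text \<open>The sets to be covered are cut out by difference quotients and come without a proof of
  measurability; outer measure applies to them all the same.\<close>

lemma outer_measure_of_lebesgue_le: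
  assumes "negligible (A - B)" "B \<subseteq> C" "C \<in> sets lebesgue"
  shows "outer_measure_of lebesgue A \<le> emeasure lebesgue C"
proof -
  have N: "A - B \<in> null_sets lebesgue"
    using assms(1) by (simp add: negligible_iff_null_sets)
  have "outer_measure_of lebesgue A \<le> outer_measure_of lebesgue (C \<union> (A - B))"
    by (rule outer_measure_of_mono) (use assms in auto)
  also have "\<dots> = emeasure lebesgue (C \<union> (A - B))"
    by (rule outer_measure_of_eq) (use assms N in auto)
  also have "\<dots> = emeasure lebesgue C"
    by (rule emeasure_Un_null_set) (use assms N in auto)
  finally show ?thesis .
qed

lemma negligible_if_outer_measure_zero:
  assumes "outer_measure_of lebesgue E = 0"
  shows "negligible E"
proof -
  obtain H where "H \<in> sets lebesgue" "E \<subseteq> H" "outer_measure_of lebesgue E = emeasure lebesgue H"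
    using outer_measure_of_attain[of E lebesgue] by auto
  then have "H \<in> null_sets lebesgue"
    using assms by auto
  then show ?thesis
    using \<open>E \<subseteq> H\<close> negligible_iff_null_sets negligible_subset by blast
qed

text \<open>Reduces to bounded sets, where outer measures and the growth of a monotone function are
  finite.\<close>

lemma negligible_if_cballs:
  fixes S :: "'a::euclidean_space set"
  assumes "\<And>N. N > 0 \<Longrightarrow> negligible (S \<inter> cball 0 N)"
  shows "negligible S"
proof (subst negligible_on_intervals, intro allI)
  fix a b
  obtain N where "N > 0" "cbox a b \<subseteq> ball (0::'a) N"
    using bounded_subset_ballD[OF bounded_cbox] by blast
  moreover have "ball (0::'a) N \<subseteq> cball 0 N"
    by (rule ball_subset_cball)
  ultimately show "negligible (S \<inter> cbox a b)"
    by (intro negligible_subset[OF assms[of N]]) auto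
qed

section \<open>Lebesgue's theorem for continuous nondecreasing functions\<close>

locale continuous_mono =
  fixes f :: "real \<Rightarrow> real"
  assumes mono: "mono f" and cont: "continuous_on UNIV f"
begin

text \<open>The Lebesgue-Stieltjes measure adds up the growth of f over countably many disjoint
  intervals.\<close>

abbreviation "\<mu> \<equiv> interval_measure f"

lemma emeasure_Icc: "u \<le> v \<Longrightarrow> emeasure \<mu> {u..v} = ennreal (f v - f u)"
  by (rule emeasure_interval_measure_Icc) (simp_all add: monoD[OF mono] cont)

text \<open>Together with \<open>rate_above\<close> this replaces the Dini derivatives. As x may lie
  anywhere in the interval, quotients from the left and from the right are treated alike, and the
  intervals in question form a Vitali cover of the points concerned.\<close>

definition rate_below :: "real \<Rightarrow> real \<Rightarrow> bool" where
  "rate_below p x \<longleftrightarrow> (\<forall>d>0. \<exists>u v. u < v \<and> u \<le> x \<and> x \<le> v \<and> v - u < d \<and> f v - f u \<le> p * (v - u))"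

definition rate_above :: "real \<Rightarrow> real \<Rightarrow> bool" where
  "rate_above q x \<longleftrightarrow> (\<forall>d>0. \<exists>u v. u < v \<and> u \<le> x \<and> x \<le> v \<and> v - u < d \<and> q * (v - u) \<le> f v - f u)"

lemma covering_in_open:
  fixes E :: "real set"
  assumes P: "\<And>x d :: real. x \<in> E \<Longrightarrow> 0 < d \<Longrightarrow> \<exists>u v. u < v \<and> u \<le> x \<and> x \<le> v \<and> v - u < d \<and> P u v"
    and "open G" "E \<subseteq> G"
  obtains C where "countable C" "\<And>i. i \<in> C \<Longrightarrow> fst i < snd i \<and> {fst i..snd i} \<subseteq> G \<and> P (fst i) (snd i)"
    "disjoint_family_on (\<lambda>i. {fst i..snd i}) C" "negligible (E - (\<Union>i\<in>C. {fst i..snd i}))"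
proof -
  define K where "K = {(u, v). u < v \<and> {u..v} \<subseteq> G \<and> P u v}"
  have *: "\<exists>u v. (u, v) \<in> K \<and> u \<le> x \<and> x \<le> v \<and> v - u < d" if x: "x \<in> E" and "0 < d" for x d
  proof -
    obtain e where e: "e > 0" "ball x e \<subseteq> G"
      using \<open>open G\<close> \<open>E \<subseteq> G\<close> x openE by blast
    \<comment> \<open>A length below \<open>e\<close> as well keeps the interval inside the open
      set.\<close>
    obtain u v where uv: "u < v" "u \<le> x" "x \<le> v" "v - u < min d e" "P u v"
      using P[OF x, of "min d e"] \<open>0 < d\<close> \<open>0 < e\<close> by auto
    then have "{u..v} \<subseteq> ball x e"
      by (auto simp: dist_real_def)
    with e uv show ?thesis
      unfolding K_def by auto
  qed
  show thesis
  proof (rule Vitali_covering_theorem_intervals[of K E])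
    show "u < v" if "(u, v) \<in> K" for u v
      using that by (auto simp: K_def)
    show "\<exists>u v. (u, v) \<in> K \<and> u \<le> x \<and> x \<le> v \<and> v - u < d" if "x \<in> E" "0 < d" for x d
      using * that by blast
    fix C assume C: "countable C" "C \<subseteq> K" "disjoint_family_on (\<lambda>i. {fst i..snd i}) C"
      "negligible (E - (\<Union>i\<in>C. {fst i..snd i}))"
    have "fst i < snd i \<and> {fst i..snd i} \<subseteq> G \<and> P (fst i) (snd i)" if "i \<in> C" for i
      using subsetD[OF C(2) that] by (simp add: K_def case_prod_beta)
    with C show thesis
      by (intro that[of C])
  qed
qed

text \<open>A disjoint Vitali cover by intervals of slope at least q inside G misses only a null set
  of E. On each of its intervals q times the length is at most the Stieltjes measure, and both sides
  are countably additive.\<close>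

lemma emeasure_rate_above:
  assumes E: "\<And>x. x \<in> E \<Longrightarrow> rate_above q x" and G: "open G" "E \<subseteq> G" and "q \<ge> 0"
  shows "ennreal q * outer_measure_of lebesgue E \<le> emeasure \<mu> G"
proof -
  obtain C where C: "countable C"
      "\<And>i. i \<in> C \<Longrightarrow> fst i < snd i \<and> {fst i..snd i} \<subseteq> G \<and> q * (snd i - fst i) \<le> f (snd i) - f (fst i)"
      "disjoint_family_on (\<lambda>i. {fst i..snd i}) C" "negligible (E - (\<Union>i\<in>C. {fst i..snd i}))"
    by (rule covering_in_open[OF _ G, of "\<lambda>u v. q * (v - u) \<le> f v - f u"])
      (use E in \<open>auto simp: rate_above_def\<close>)
  let ?U = "\<Union>i\<in>C. {fst i..snd i}"
  have [measurable]: "?U \<in> sets borel"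
    by (intro sets.countable_UN' C) auto
  have "ennreal q * outer_measure_of lebesgue E \<le> ennreal q * emeasure lebesgue ?U"
    by (intro mult_left_mono outer_measure_of_lebesgue_le[OF C(4)]) auto
  also have "emeasure lebesgue ?U = emeasure lborel ?U"
    by simp
  also have "\<dots> = (\<integral>\<^sup>+i. emeasure lborel {fst i..snd i} \<partial>count_space C)"
    by (intro emeasure_UN_countable C) auto
  also have "ennreal q * \<dots> = (\<integral>\<^sup>+i. ennreal q * emeasure lborel {fst i..snd i} \<partial>count_space C)"
    by (simp add: nn_integral_cmult)
  also have "\<dots> \<le> (\<integral>\<^sup>+i. emeasure \<mu> {fst i..snd i} \<partial>count_space C)"
  proof (rule nn_integral_mono)
    fix i assume "i \<in> space (count_space C)"
    then have "i \<in> C" by simp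
    with C(2)[of i] \<open>q \<ge> 0\<close>
    show "ennreal q * emeasure lborel {fst i..snd i} \<le> emeasure \<mu> {fst i..snd i}"
      by (simp add: emeasure_Icc ennreal_mult[symmetric] ennreal_leI)
  qed
  also have "\<dots> = emeasure \<mu> ?U"
    by (intro emeasure_UN_countable[symmetric] C) auto
  also have "\<dots> \<le> emeasure \<mu> G"
    by (intro emeasure_mono) (use C(2) G(1) in auto)
  finally show ?thesis .
qed

text \<open>The mirror estimate, in a form that can be iterated: the covering intervals are replaced
  by their interiors, at the price of countably many end points, so that X is open and can serve as
  the set G of \<open>emeasure_rate_above\<close>.\<close>

lemma rate_below_cover:
  assumes E: "\<And>x. x \<in> E \<Longrightarrow> rate_below p x" and G: "open G" "E \<subseteq> G" and "p \<ge> 0"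
  obtains X where "open X" "negligible (E - X)" "emeasure \<mu> X \<le> ennreal p * emeasure lebesgue G"
proof -
  obtain C where C: "countable C"
      "\<And>i. i \<in> C \<Longrightarrow> fst i < snd i \<and> {fst i..snd i} \<subseteq> G \<and> f (snd i) - f (fst i) \<le> p * (snd i - fst i)"
      "disjoint_family_on (\<lambda>i. {fst i..snd i}) C" "negligible (E - (\<Union>i\<in>C. {fst i..snd i}))"
    by (rule covering_in_open[OF _ G, of "\<lambda>u v. f v - f u \<le> p * (v - u)"])
      (use E in \<open>auto simp: rate_below_def\<close>)
  let ?U = "\<Union>i\<in>C. {fst i..snd i}" and ?X = "\<Union>i\<in>C. {fst i<..<snd i}"
  have [measurable]: "?U \<in> sets borel"
    by (intro sets.countable_UN' C) auto
  show thesis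
  proof (rule that[of ?X])
    show "open ?X" by auto
    have "countable (fst ` C \<union> snd ` C)"
      using C(1) by auto
    then have "negligible ((E - ?U) \<union> (fst ` C \<union> snd ` C))"
      using C(4) by (intro negligible_Un) (auto simp: negligible_iff_null_sets intro: null_sets_completionI countable_imp_null_set_lborel)
    then show "negligible (E - ?X)"
    proof (rule negligible_subset, safe)
      fix x i assume *: "x \<in> E" "x \<notin> ?X" "x \<notin> snd ` C" "x \<notin> fst ` C" "i \<in> C" "x \<in> {fst i..snd i}"
      then have "x \<noteq> fst i" "x \<noteq> snd i" by auto
      with * show False by force
    qed
    have "emeasure \<mu> ?X \<le> emeasure \<mu> ?U"
      by (intro emeasure_mono) force+
    also have "\<dots> = (\<integral>\<^sup>+i. emeasure \<mu> {fst i..snd i} \<partial>count_space C)"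
      by (intro emeasure_UN_countable C) auto
    also have "\<dots> \<le> (\<integral>\<^sup>+i. ennreal p * emeasure lborel {fst i..snd i} \<partial>count_space C)"
    proof (rule nn_integral_mono)
      fix i assume "i \<in> space (count_space C)"
      then have "i \<in> C" by simp
      with C(2)[of i] \<open>p \<ge> 0\<close>
      show "emeasure \<mu> {fst i..snd i} \<le> ennreal p * emeasure lborel {fst i..snd i}"
        by (simp add: emeasure_Icc ennreal_mult[symmetric] ennreal_leI)
    qed
    also have "\<dots> = ennreal p * (\<integral>\<^sup>+i. emeasure lborel {fst i..snd i} \<partial>count_space C)"
      by (simp add: nn_integral_cmult)
    also have "(\<integral>\<^sup>+i. emeasure lborel {fst i..snd i} \<partial>count_space C) = emeasure lborel ?U"
      by (intro emeasure_UN_countable[symmetric] C) auto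
    also have "\<dots> = emeasure lebesgue ?U"
      by simp
    also have "ennreal p * \<dots> \<le> ennreal p * emeasure lebesgue G"
      by (intro mult_left_mono emeasure_mono) (use C(2) G(1) in auto)
    finally show "emeasure \<mu> ?X \<le> ennreal p * emeasure lebesgue G" .
  qed
qed

text \<open>Vitali's comparison. Let e be the outer measure of a bounded part of the set. Flat
  intervals give an open X that covers it up to a null set and has Stieltjes measure at most p * (e
  + \<epsilon>); steep intervals inside X show that this measure is at least q * e. As e is finite,
  p < q forces e = 0.\<close>

lemma negligible_rate_gap:
  assumes "0 \<le> p" "p < q"
  shows "negligible {x. rate_below p x \<and> rate_above q x}"
proof -
  have "negligible ({x. rate_below p x \<and> rate_above q x} \<inter> cball 0 N)" (is "negligible ?E") for N
  proof -
    define e where "e = outer_measure_of lebesgue ?E"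
    \<comment> \<open>A measurable hull with the same outer measure: it can be approximated from
      outside by open sets.\<close>
    obtain H where H: "H \<in> sets lebesgue" "?E \<subseteq> H" "e = emeasure lebesgue H"
      using outer_measure_of_attain[of ?E lebesgue] by (auto simp: e_def)
    have "e \<le> outer_measure_of lebesgue (cball (0::real) N)"
      unfolding e_def by (rule outer_measure_of_mono) auto
    also have "\<dots> = emeasure lebesgue (cball (0::real) N)"
      by (rule outer_measure_of_eq) auto
    also have "\<dots> < \<infinity>"
      using emeasure_bounded_finite[of "cball (0::real) N"] by simp
    finally have e_fin: "e < \<infinity>" .
    have "ennreal q * e \<le> ennreal p * e + ennreal p * ennreal \<epsilon>" if "\<epsilon> > 0" for \<epsilon>
    proof -
      obtain G where G: "open G" "H \<subseteq> G" "emeasure lebesgue (G - H) < ennreal \<epsilon>"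
        by (rule sets_lebesgue_outer_open[OF H(1) \<open>\<epsilon> > 0\<close>]) blast
      obtain X where X: "open X" "negligible (?E - X)" "emeasure \<mu> X \<le> ennreal p * emeasure lebesgue G"
        by (rule rate_below_cover[of ?E p G]) (use G H assms in auto)
      obtain B where B: "B \<in> sets lebesgue" "?E \<inter> X \<subseteq> B" "outer_measure_of lebesgue (?E \<inter> X) = emeasure lebesgue B"
        using outer_measure_of_attain[of "?E \<inter> X" lebesgue] by auto
      have "e \<le> outer_measure_of lebesgue (?E \<inter> X)"
        unfolding e_def B(3)
        by (rule outer_measure_of_lebesgue_le[of _ "?E \<inter> X"]) (use X B in \<open>auto simp: Diff_Int\<close>)
      then have "ennreal q * e \<le> ennreal q * outer_measure_of lebesgue (?E \<inter> X)"
        by (rule mult_left_mono) auto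
      also have "\<dots> \<le> emeasure \<mu> X"
        by (rule emeasure_rate_above) (use X assms in auto)
      also have "\<dots> \<le> ennreal p * emeasure lebesgue G" by fact
      also have "emeasure lebesgue G = emeasure lebesgue (H \<union> (G - H))"
        using G by (simp add: Un_absorb1)
      also have "\<dots> \<le> e + emeasure lebesgue (G - H)"
        unfolding H(3) by (intro emeasure_subadditive) (use H G in auto)
      also have "\<dots> \<le> e + ennreal \<epsilon>"
        using G(3) by (intro add_left_mono) auto
      finally show ?thesis
        by (simp add: distrib_left mult_left_mono)
    qed
    then have le: "q * enn2real e \<le> p * enn2real e + p * \<epsilon>" if "\<epsilon> > 0" for \<epsilon>
      using that e_fin assms
      by (cases e) (auto simp: ennreal_mult[symmetric] ennreal_plus[symmetric] simp del: ennreal_plus)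
    have "q * enn2real e \<le> p * enn2real e"
    proof (rule field_le_epsilon)
      fix \<epsilon> :: real assume "\<epsilon> > 0"
      have "p * (\<epsilon> / (p + 1)) \<le> \<epsilon>"
        using assms \<open>\<epsilon> > 0\<close> by (simp add: field_simps)
      with le[of "\<epsilon> / (p + 1)"] \<open>\<epsilon> > 0\<close> assms show "q * enn2real e \<le> p * enn2real e + \<epsilon>"
        by auto
    qed
    then have "enn2real e \<le> 0"
      using assms by (metis enn2real_nonneg mult_right_mono_neg mult_le_cancel_right not_le)
    then have "e = 0"
      using e_fin by (cases e) auto
    then show ?thesis
      unfolding e_def by (rule negligible_if_outer_measure_zero)
  qed
  then show ?thesis
    by (rule negligible_if_cballs)
qed

text \<open>The product of q and the outer measure of the part in a ball is bounded by the growth of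
  f over a slightly larger interval, and that growth does not depend on q.\<close>

lemma negligible_rate_infinite: "negligible {x. \<forall>q. rate_above q x}"
proof -
  have "negligible ({x. \<forall>q. rate_above q x} \<inter> cball 0 N)" (is "negligible ?E") if "N > 0" for N
  proof -
    define e where "e = outer_measure_of lebesgue ?E"
    have *: "ennreal q * e \<le> ennreal (f (N+1) - f (-N-1))" if "q \<ge> 0" for q
    proof -
      have "ennreal q * e \<le> emeasure \<mu> {-N-1<..<N+1}"
        unfolding e_def by (rule emeasure_rate_above) (use that in \<open>auto simp: dist_real_def\<close>)
      also have "\<dots> \<le> emeasure \<mu> {-N-1..N+1}"
        by (rule emeasure_mono) auto
      finally show ?thesis
        using \<open>N > 0\<close> by (simp add: emeasure_Icc)
    qed
    have "e = 0"
    proof (rule ccontr)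
      assume "e \<noteq> 0"
      show False
      proof (cases e)
        case (real r)
        with \<open>e \<noteq> 0\<close> have "r > 0" by auto
        have fm: "f (-N-1) \<le> f (N+1)"
          by (rule monoD[OF mono]) (use \<open>N > 0\<close> in simp)
        \<comment> \<open>Makes q times the outer measure exceed the growth bound by 1.\<close>
        define q where "q = (f (N+1) - f (-N-1) + 1) / r"
        have "q \<ge> 0" "q * r = f (N+1) - f (-N-1) + 1"
          using \<open>r > 0\<close> fm by (auto simp: q_def)
        moreover have "ennreal (q * r) \<le> ennreal (f (N+1) - f (-N-1))"
          using *[OF \<open>q \<ge> 0\<close>] real \<open>q \<ge> 0\<close> by (simp add: ennreal_mult)
        ultimately show False
          using fm by (simp add: ennreal_le_iff)
      next
        case top
        with *[of 1] show False
          by (auto simp: top_unique)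
      qed
    qed
    then show ?thesis
      unfolding e_def by (rule negligible_if_outer_measure_zero)
  qed
  then show ?thesis
    by (rule negligible_if_cballs)
qed

text \<open>Were the lower limit of the difference quotient smaller than the upper one, two
  rationals between them would give a flat and a steep rate at once. Rationals are used because the
  exceptional set has to be a countable union. An infinite upper limit would give every steep
  rate.\<close>

lemma differentiable_at_if_rates:
  assumes gap: "\<And>p q. \<lbrakk>p \<in> \<rat>; q \<in> \<rat>; 0 \<le> p; p < q\<rbrakk> \<Longrightarrow> \<not> (rate_below p x \<and> rate_above q x)"
    and fin: "\<not> (\<forall>q. rate_above q x)"
  shows "f differentiable (at x)"
proof -
  define Q where "Q = (\<lambda>y. (f y - f x) / (y - x))"
  let ?F = "at x"
  have Q0: "Q y \<ge> 0" if "y \<noteq> x" for y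
  proof (cases "y < x")
    case True
    then have "f y \<le> f x" by (intro monoD[OF mono]) simp
    with True show ?thesis
      unfolding Q_def by (intro divide_nonpos_neg) auto
  next
    case False
    then have "f x \<le> f y" by (intro monoD[OF mono]) simp
    with False show ?thesis
      unfolding Q_def by (intro divide_nonneg_nonneg) auto
  qed
  have Qmult: "Q y * (y - x) = f y - f x" "Q y * (x - y) = f x - f y" if "y \<noteq> x" for y
  proof -
    show 1: "Q y * (y - x) = f y - f x"
      using that unfolding Q_def by simp
    have "Q y * (x - y) = - (Q y * (y - x))"
      by (simp add: algebra_simps)
    then show "Q y * (x - y) = f x - f y"
      unfolding 1 by simp
  qed
  have below: "rate_below p x" if freq: "\<exists>\<^sub>F y in ?F. Q y < p" for p
    unfolding rate_below_def
  proof (intro allI impI)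
    fix d :: real assume "d > 0"
    then have "\<forall>\<^sub>F y in ?F. dist y x < d \<and> y \<noteq> x"
      unfolding eventually_at by (intro exI[of _ d]) simp
    then have "\<exists>\<^sub>F y in ?F. (dist y x < d \<and> y \<noteq> x) \<and> Q y < p"
      by (rule frequently_eventually_conj[OF freq])
    then obtain y where y: "Q y < p" "dist y x < d" "y \<noteq> x"
      by (blast dest: frequently_ex)
    show "\<exists>u v. u < v \<and> u \<le> x \<and> x \<le> v \<and> v - u < d \<and> f v - f u \<le> p * (v - u)"
    proof (cases "y < x")
      case True
      have "f x - f y \<le> p * (x - y)"
        unfolding Qmult(2)[OF \<open>y \<noteq> x\<close>, symmetric] by (intro mult_right_mono) (use y(1) True in simp_all)
      moreover have "x - y < d"
        using y(2) by (simp add: dist_real_def)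
      ultimately show ?thesis
        by (intro exI[of _ y] exI[of _ x]) (use True in simp)
    next
      case False
      with y(3) have "x < y" by simp
      have "f y - f x \<le> p * (y - x)"
        unfolding Qmult(1)[OF \<open>y \<noteq> x\<close>, symmetric] by (intro mult_right_mono) (use y(1) \<open>x < y\<close> in simp_all)
      moreover have "y - x < d"
        using y(2) by (simp add: dist_real_def)
      ultimately show ?thesis
        by (intro exI[of _ x] exI[of _ y]) (use \<open>x < y\<close> in simp)
    qed
  qed
  have above: "rate_above p x" if freq: "\<exists>\<^sub>F y in ?F. p < Q y" for p
    unfolding rate_above_def
  proof (intro allI impI)
    fix d :: real assume "d > 0"
    then have "\<forall>\<^sub>F y in ?F. dist y x < d \<and> y \<noteq> x"
      unfolding eventually_at by (intro exI[of _ d]) simp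
    then have "\<exists>\<^sub>F y in ?F. (dist y x < d \<and> y \<noteq> x) \<and> p < Q y"
      by (rule frequently_eventually_conj[OF freq])
    then obtain y where y: "p < Q y" "dist y x < d" "y \<noteq> x"
      by (blast dest: frequently_ex)
    show "\<exists>u v. u < v \<and> u \<le> x \<and> x \<le> v \<and> v - u < d \<and> p * (v - u) \<le> f v - f u"
    proof (cases "y < x")
      case True
      have "p * (x - y) \<le> f x - f y"
        unfolding Qmult(2)[OF \<open>y \<noteq> x\<close>, symmetric] by (intro mult_right_mono) (use y(1) True in simp_all)
      moreover have "x - y < d"
        using y(2) by (simp add: dist_real_def)
      ultimately show ?thesis
        by (intro exI[of _ y] exI[of _ x]) (use True in simp)
    next
      case False
      with y(3) have "x < y" by simp
      have "p * (y - x) \<le> f y - f x"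
        unfolding Qmult(1)[OF \<open>y \<noteq> x\<close>, symmetric] by (intro mult_right_mono) (use y(1) \<open>x < y\<close> in simp_all)
      moreover have "y - x < d"
        using y(2) by (simp add: dist_real_def)
      ultimately show ?thesis
        by (intro exI[of _ x] exI[of _ y]) (use \<open>x < y\<close> in simp)
    qed
  qed
  define l where "l = Liminf ?F (\<lambda>y. ereal (Q y))"
  define L where "L = Limsup ?F (\<lambda>y. ereal (Q y))"
  have low: "\<exists>\<^sub>F y in ?F. Q y < p" if "l < ereal p" for p
  proof (rule ccontr)
    assume "\<not> ?thesis"
    then have "\<forall>\<^sub>F y in ?F. ereal p \<le> ereal (Q y)"
      by (simp add: not_frequently not_less)
    then have "ereal p \<le> l"
      unfolding l_def by (rule Liminf_bounded)
    with that show False by simp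
  qed
  have high: "\<exists>\<^sub>F y in ?F. p < Q y" if "ereal p < L" for p
  proof (rule ccontr)
    assume "\<not> ?thesis"
    then have "\<forall>\<^sub>F y in ?F. ereal (Q y) \<le> ereal p"
      by (simp add: not_frequently not_less)
    then have "L \<le> ereal p"
      unfolding L_def by (rule Limsup_bounded)
    with that show False by simp
  qed
  have l0: "0 \<le> l"
    unfolding l_def
    by (rule Liminf_bounded) (simp add: eventually_at, intro exI[of _ 1], simp add: Q0)
  have lL: "l \<le> L"
    unfolding l_def L_def by (rule Liminf_le_Limsup) simp
  have Ll: "L \<le> l"
  proof (rule ccontr)
    assume "\<not> L \<le> l"
    then have "l < L" by simp
    from ereal_dense3[OF this] obtain q' where q': "l < ereal (real_of_rat q')" "ereal (real_of_rat q') < L"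
      by blast
    from ereal_dense3[OF this(1)] obtain p'
      where p': "l < ereal (real_of_rat p')" "ereal (real_of_rat p') < ereal (real_of_rat q')"
      by blast
    have "ereal 0 < ereal (real_of_rat p')"
      unfolding zero_ereal_def[symmetric] using l0 p'(1) by (rule le_less_trans)
    then have "0 \<le> real_of_rat p'"
      by simp
    moreover have "rate_below (real_of_rat p') x" "rate_above (real_of_rat q') x"
      by (rule below[OF low[OF p'(1)]], rule above[OF high[OF q'(2)]])
    ultimately show False
      using gap[of "real_of_rat p'" "real_of_rat q'"] p'(2) by simp
  qed
  from lL Ll have "l = L" by simp
  have "L \<noteq> \<infinity>"
  proof
    assume "L = \<infinity>"
    then have "ereal q < L" for q by simp
    then have "rate_above q x" for q
      by (intro above high)
    with fin show False by blast
  qed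
  with \<open>l = L\<close> l0 have l: "\<bar>l\<bar> \<noteq> \<infinity>"
    by auto
  have lim: "Liminf ?F (\<lambda>y. ereal (Q y)) = ereal (real_of_ereal l)"
      "Limsup ?F (\<lambda>y. ereal (Q y)) = ereal (real_of_ereal l)"
    unfolding l_def[symmetric] L_def[symmetric] \<open>l = L\<close>[symmetric] ereal_real'[OF l] by simp_all
  then have "((\<lambda>y. ereal (Q y)) \<longlongrightarrow> ereal (real_of_ereal l)) ?F"
    by (subst tendsto_iff_Liminf_eq_Limsup) (simp_all only: lim trivial_limit_at not_False_eq_True simp_thms)
  then have "(Q \<longlongrightarrow> real_of_ereal l) ?F"
    by (simp only: lim_ereal)
  then have "(f has_field_derivative real_of_ereal l) (at x)"
    unfolding has_field_derivative_iff Q_def .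
  then show ?thesis
    by (meson differentiableI has_field_derivative_imp_has_derivative)
qed

theorem negligible_not_differentiable: "negligible {x. \<not> f differentiable (at x)}"
proof -
  let ?I = "{(p, q). p \<in> \<rat> \<and> q \<in> \<rat> \<and> 0 \<le> p \<and> p < q}"
  have "countable ?I"
    by (rule countable_subset[of _ "\<rat> \<times> \<rat>"]) (auto intro: countable_rat)
  then have "negligible (\<Union>i\<in>?I. {x. rate_below (fst i) x \<and> rate_above (snd i) x})"
    by (intro negligible_countable_Union countable_image) (auto intro: negligible_rate_gap)
  then have "negligible ((\<Union>i\<in>?I. {x. rate_below (fst i) x \<and> rate_above (snd i) x}) \<union> {x. \<forall>q. rate_above q x})"
    using negligible_rate_infinite by (rule negligible_Un)
  then show ?thesis
  proof (rule negligible_subset, intro subsetI)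
    fix x assume *: "x \<in> {x. \<not> f differentiable (at x)}"
    show "x \<in> (\<Union>i\<in>?I. {x. rate_below (fst i) x \<and> rate_above (snd i) x}) \<union> {x. \<forall>q. rate_above q x}"
    proof (rule ccontr)
      assume x: "x \<notin> (\<Union>i\<in>?I. {x. rate_below (fst i) x \<and> rate_above (snd i) x}) \<union> {x. \<forall>q. rate_above q x}"
      have "f differentiable (at x)"
        by (rule differentiable_at_if_rates) (use x in auto)
      with * show False by simp
    qed
  qed
qed

end

section \<open>Absolutely continuous paths\<close>

lemma division_of_Icc:
  fixes D :: "real set set"
  assumes "D division_of S" "k \<in> D"
  shows "k = {Inf k..Sup k}" "Inf k \<le> Sup k"
proof -
  obtain u v where "k = cbox u v" "k \<noteq> {}"
    using division_ofD(3,4)[OF assms] by blast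
  then have "k = {u..v}" "u \<le> v" by auto
  then show "k = {Inf k..Sup k}" "Inf k \<le> Sup k" by auto
qed

lemma division_of_disjoint_interior:
  fixes D :: "real set set"
  assumes "D division_of S" "k \<in> D" "l \<in> D" "k \<noteq> l"
  shows "{Inf k<..<Sup k} \<inter> {Inf l<..<Sup l} = {}"
proof -
  have "interior {Inf k..Sup k} \<inter> interior {Inf l..Sup l} = {}"
    using division_ofD(5)[OF assms] division_of_Icc(1)[OF assms(1,2)] division_of_Icc(1)[OF assms(1,3)]
    by simp
  then show ?thesis by simp
qed

text \<open>Strict inequalities and disjoint interiors make the indexed intervals distinct, so a sum
  over the division runs through every index exactly once.\<close>

lemma division_of_image:
  fixes D :: "'b set" and p q :: "'b \<Rightarrow> real"
  assumes "finite D" and pq: "\<And>k. k \<in> D \<Longrightarrow> p k < q k"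
    and disj: "\<And>k l. \<lbrakk>k \<in> D; l \<in> D; k \<noteq> l\<rbrakk> \<Longrightarrow> {p k<..<q k} \<inter> {p l<..<q l} = {}"
  defines "E \<equiv> (\<lambda>k. {p k..q k}) ` D"
  shows "E division_of \<Union>E" and "\<And>\<phi>. (\<Sum>k\<in>E. \<phi> (Inf k) (Sup k)) = (\<Sum>k\<in>D. \<phi> (p k) (q k))"
proof -
  have inj: "inj_on (\<lambda>k. {p k..q k}) D"
  proof (rule inj_onI, rule ccontr)
    fix k l assume *: "k \<in> D" "l \<in> D" "{p k..q k} = {p l..q l}" "k \<noteq> l"
    then have "p k = p l" "q k = q l"
      using pq[OF *(1)] by auto
    with disj[OF *(1,2,4)] pq[OF *(1)] show False
      by (metis dense disjoint_iff greaterThanLessThan_iff)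
  qed
  show "E division_of \<Union>E"
  proof (rule division_ofI)
    show "finite E" using \<open>finite D\<close> by (simp add: E_def)
    show "K \<subseteq> \<Union>E" if "K \<in> E" for K using that by blast
    show "K \<noteq> {}" if "K \<in> E" for K using that pq by (fastforce simp: E_def)
    show "\<exists>a b. K = cbox a b" if "K \<in> E" for K using that by (auto simp: E_def)
    show "interior K1 \<inter> interior K2 = {}" if K: "K1 \<in> E" "K2 \<in> E" "K1 \<noteq> K2" for K1 K2
    proof -
      obtain k l where kl: "k \<in> D" "l \<in> D" "K1 = {p k..q k}" "K2 = {p l..q l}"
        using K(1,2) unfolding E_def by blast
      with K(3) have "k \<noteq> l" by blast
      from disj[OF kl(1,2) this] kl(3,4) show ?thesis
        by (simp only: interior_atLeastAtMost_real)
    qed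
  qed simp
  show "(\<Sum>k\<in>E. \<phi> (Inf k) (Sup k)) = (\<Sum>k\<in>D. \<phi> (p k) (q k))" for \<phi>
    unfolding E_def by (subst sum.reindex[OF inj]) (use pq in \<open>auto intro!: sum.cong simp: less_imp_le\<close>)
qed

lemma absolutely_continuous_pathE:
  assumes "absolutely_continuous_path a b c" "\<epsilon> > 0"
  obtains \<delta> where "\<delta> > 0" "\<And>D. \<lbrakk>D division_of \<Union>D; \<Union>D \<subseteq> {a..b}; (\<Sum>k\<in>D. Sup k - Inf k) < \<delta>\<rbrakk>
     \<Longrightarrow> (\<Sum>k\<in>D. norm (c (Sup k) - c (Inf k))) < \<epsilon>"
  using assms unfolding absolutely_continuous_path_def by meson

text \<open>The index type is free since the families met later are indexed by the members of
  another division or by tagged intervals, with end points computed from the index.\<close>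

lemma absolutely_continuous_pathE_indexed:
  assumes "absolutely_continuous_path a b c" "\<epsilon> > 0"
  obtains \<delta> where "\<delta> > 0"
    "\<And>D (p :: 'b \<Rightarrow> real) q. \<lbrakk>finite D; \<And>k. k \<in> D \<Longrightarrow> a \<le> p k \<and> p k < q k \<and> q k \<le> b;
       \<And>k l. \<lbrakk>k \<in> D; l \<in> D; k \<noteq> l\<rbrakk> \<Longrightarrow> {p k<..<q k} \<inter> {p l<..<q l} = {};
       (\<Sum>k\<in>D. q k - p k) < \<delta>\<rbrakk> \<Longrightarrow> (\<Sum>k\<in>D. norm (c (q k) - c (p k))) < \<epsilon>"
proof -
  obtain \<delta> where "\<delta> > 0" and \<delta>: "\<And>D. \<lbrakk>D division_of \<Union>D; \<Union>D \<subseteq> {a..b}; (\<Sum>k\<in>D. Sup k - Inf k) < \<delta>\<rbrakk>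
     \<Longrightarrow> (\<Sum>k\<in>D. norm (c (Sup k) - c (Inf k))) < \<epsilon>"
    by (rule absolutely_continuous_pathE[OF assms]) blast
  show thesis
  proof (rule that[OF \<open>\<delta> > 0\<close>])
    fix D and p q :: "'b \<Rightarrow> real"
    assume fin: "finite D" and pq: "\<And>k. k \<in> D \<Longrightarrow> a \<le> p k \<and> p k < q k \<and> q k \<le> b"
      and disj: "\<And>k l. \<lbrakk>k \<in> D; l \<in> D; k \<noteq> l\<rbrakk> \<Longrightarrow> {p k<..<q k} \<inter> {p l<..<q l} = {}"
      and len: "(\<Sum>k\<in>D. q k - p k) < \<delta>"
    note E = division_of_image[of D p q, OF fin conjunct1[OF conjunct2[OF pq]] disj]
    let ?E = "(\<lambda>k. {p k..q k}) ` D"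
    have "(\<Sum>k\<in>?E. norm (c (Sup k) - c (Inf k))) < \<epsilon>"
    proof (rule \<delta>)
      show "?E division_of \<Union>?E" by (rule E(1))
      show "\<Union>?E \<subseteq> {a..b}" using pq by fastforce
      show "(\<Sum>k\<in>?E. Sup k - Inf k) < \<delta>"
        using len E(2)[of "\<lambda>u v. v - u"] by simp
    qed
    then show "(\<Sum>k\<in>D. norm (c (q k) - c (p k))) < \<epsilon>"
      using E(2)[of "\<lambda>u v. norm (c v - c u)"] by simp
  qed
qed

section \<open>Operations that preserve absolute continuity\<close>

lemma absolutely_continuous_path_subinterval:
  assumes "absolutely_continuous_path a b c" "a \<le> s" "t \<le> b"
  shows "absolutely_continuous_path s t c"
  unfolding absolutely_continuous_path_def
proof (intro allI impI)
  fix \<epsilon> :: real assume "\<epsilon> > 0"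
  from absolutely_continuous_pathE[OF assms(1) this] obtain \<delta> where "\<delta> > 0"
    and \<delta>: "\<And>D. \<lbrakk>D division_of \<Union>D; \<Union>D \<subseteq> {a..b}; (\<Sum>k\<in>D. Sup k - Inf k) < \<delta>\<rbrakk>
     \<Longrightarrow> (\<Sum>k\<in>D. norm (c (Sup k) - c (Inf k))) < \<epsilon>" by blast
  have "{s..t} \<subseteq> {a..b}" using assms by auto
  then show "\<exists>\<delta>>0. \<forall>D. D division_of \<Union>D \<and> \<Union>D \<subseteq> {s..t} \<and> (\<Sum>k\<in>D. Sup k - Inf k) < \<delta>
        \<longrightarrow> (\<Sum>k\<in>D. norm (c (Sup k) - c (Inf k))) < \<epsilon>"
    by (intro exI[of _ \<delta>] conjI \<open>\<delta> > 0\<close> allI impI \<delta>) (blast dest: subset_trans)+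
qed

lemma division_of_Inf_Sup_bounds:
  fixes D :: "real set set"
  assumes "D division_of \<Union>D" "\<Union>D \<subseteq> {a..b}" "k \<in> D"
  shows "a \<le> Inf k" "Inf k \<le> Sup k" "Sup k \<le> b"
proof -
  note k = division_of_Icc[OF assms(1,3)]
  have "{Inf k..Sup k} \<subseteq> {a..b}"
    using assms(2,3) k(1) by blast
  with k(2) show "a \<le> Inf k" "Inf k \<le> Sup k" "Sup k \<le> b" by auto
qed

lemma absolutely_continuous_path_cong:
  assumes "absolutely_continuous_path a b c" "\<And>t. a \<le> t \<Longrightarrow> t \<le> b \<Longrightarrow> c' t = c t"
  shows "absolutely_continuous_path a b c'"
  unfolding absolutely_continuous_path_def
proof (intro allI impI)
  fix \<epsilon> :: real assume "\<epsilon> > 0"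
  from absolutely_continuous_pathE[OF assms(1) this] obtain \<delta> where "\<delta> > 0"
    and \<delta>: "\<And>D. \<lbrakk>D division_of \<Union>D; \<Union>D \<subseteq> {a..b}; (\<Sum>k\<in>D. Sup k - Inf k) < \<delta>\<rbrakk>
     \<Longrightarrow> (\<Sum>k\<in>D. norm (c (Sup k) - c (Inf k))) < \<epsilon>" by blast
  show "\<exists>\<delta>>0. \<forall>D. D division_of \<Union>D \<and> \<Union>D \<subseteq> {a..b} \<and> (\<Sum>k\<in>D. Sup k - Inf k) < \<delta>
        \<longrightarrow> (\<Sum>k\<in>D. norm (c' (Sup k) - c' (Inf k))) < \<epsilon>"
  proof (intro exI[of _ \<delta>] conjI allI impI \<open>\<delta> > 0\<close>)
    fix D assume D: "D division_of \<Union>D \<and> \<Union>D \<subseteq> {a..b} \<and> (\<Sum>k\<in>D. Sup k - Inf k) < \<delta>"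
    have "(\<Sum>k\<in>D. norm (c' (Sup k) - c' (Inf k))) = (\<Sum>k\<in>D. norm (c (Sup k) - c (Inf k)))"
    proof (rule sum.cong[OF refl])
      fix k assume "k \<in> D"
      with division_of_Inf_Sup_bounds[of D a b k] D
      have "a \<le> Inf k" "Inf k \<le> Sup k" "Sup k \<le> b" by auto
      then show "norm (c' (Sup k) - c' (Inf k)) = norm (c (Sup k) - c (Inf k))"
        by (simp add: assms(2))
    qed
    with \<delta>[of D] D show "(\<Sum>k\<in>D. norm (c' (Sup k) - c' (Inf k))) < \<epsilon>" by simp
  qed
qed

lemma absolutely_continuous_path_uniform:
  assumes "absolutely_continuous_path a b c" "\<epsilon> > 0"
  obtains \<delta> where "\<delta> > 0" "\<And>s t. \<lbrakk>a \<le> s; s \<le> t; t \<le> b; t - s < \<delta>\<rbrakk> \<Longrightarrow> norm (c t - c s) < \<epsilon>"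
proof -
  obtain \<delta> where "\<delta> > 0" and \<delta>: "\<And>D. \<lbrakk>D division_of \<Union>D; \<Union>D \<subseteq> {a..b}; (\<Sum>k\<in>D. Sup k - Inf k) < \<delta>\<rbrakk>
     \<Longrightarrow> (\<Sum>k\<in>D. norm (c (Sup k) - c (Inf k))) < \<epsilon>"
    by (rule absolutely_continuous_pathE[OF assms]) blast
  show thesis
  proof (rule that[OF \<open>\<delta> > 0\<close>])
    fix s t assume st: "a \<le> s" "s \<le> t" "t \<le> b" "t - s < \<delta>"
    have "{{s..t}} division_of \<Union>{{s..t}}"
      using st division_of_self[of s t] by simp
    from \<delta>[OF this] st show "norm (c t - c s) < \<epsilon>" by simp
  qed
qed

lemma absolutely_continuous_path_imp_continuous:
  assumes "absolutely_continuous_path a b c"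
  shows "continuous_on {a..b} c"
  unfolding continuous_on_iff
proof (intro ballI allI impI)
  fix x \<epsilon> assume x: "x \<in> {a..b}" and "(0::real) < \<epsilon>"
  obtain \<delta> where "\<delta> > 0" and \<delta>: "\<And>s t. \<lbrakk>a \<le> s; s \<le> t; t \<le> b; t - s < \<delta>\<rbrakk> \<Longrightarrow> norm (c t - c s) < \<epsilon>"
    by (rule absolutely_continuous_path_uniform[OF assms \<open>0 < \<epsilon>\<close>]) blast
  show "\<exists>d>0. \<forall>x'\<in>{a..b}. dist x' x < d \<longrightarrow> dist (c x') (c x) < \<epsilon>"
  proof (intro exI[of _ \<delta>] conjI \<open>\<delta> > 0\<close> ballI impI)
    fix y assume y: "y \<in> {a..b}" "dist y x < \<delta>"
    show "dist (c y) (c x) < \<epsilon>"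
    proof (cases "x \<le> y")
      case True
      with \<delta>[of x y] x y show ?thesis by (auto simp: dist_norm)
    next
      case False
      with \<delta>[of y x] x y show ?thesis by (auto simp: dist_norm norm_minus_commute)
    qed
  qed
qed

lemma absolutely_continuous_path_lipschitz:
  assumes "\<And>s t. \<lbrakk>a \<le> s; s \<le> t; t \<le> b\<rbrakk> \<Longrightarrow> norm (c t - c s) \<le> K * (t - s)"
  shows "absolutely_continuous_path a b c"
  unfolding absolutely_continuous_path_def
proof (intro allI impI)
  fix \<epsilon> :: real assume "\<epsilon> > 0"
  \<comment> \<open>Raising the constant to at least 1 allows division by it even if K is not
    positive.\<close>
  define L where "L = max K 1"
  have "L > 0" by (simp add: L_def)
  show "\<exists>\<delta>>0. \<forall>D. D division_of \<Union>D \<and> \<Union>D \<subseteq> {a..b} \<and> (\<Sum>k\<in>D. Sup k - Inf k) < \<delta>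
        \<longrightarrow> (\<Sum>k\<in>D. norm (c (Sup k) - c (Inf k))) < \<epsilon>"
  proof (intro exI[of _ "\<epsilon> / L"] conjI allI impI)
    show "0 < \<epsilon> / L" using \<open>\<epsilon> > 0\<close> \<open>L > 0\<close> by simp
    fix D assume D: "D division_of \<Union>D \<and> \<Union>D \<subseteq> {a..b} \<and> (\<Sum>k\<in>D. Sup k - Inf k) < \<epsilon> / L"
    have "(\<Sum>k\<in>D. norm (c (Sup k) - c (Inf k))) \<le> (\<Sum>k\<in>D. L * (Sup k - Inf k))"
    proof (rule sum_mono)
      fix k assume "k \<in> D"
      with division_of_Inf_Sup_bounds[of D a b k] D
      have k: "a \<le> Inf k" "Inf k \<le> Sup k" "Sup k \<le> b" by auto
      have "norm (c (Sup k) - c (Inf k)) \<le> K * (Sup k - Inf k)"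
        by (rule assms) (use k in auto)
      also have "\<dots> \<le> L * (Sup k - Inf k)"
        by (rule mult_right_mono) (use k in \<open>auto simp: L_def\<close>)
      finally show "norm (c (Sup k) - c (Inf k)) \<le> L * (Sup k - Inf k)" .
    qed
    also have "\<dots> = L * (\<Sum>k\<in>D. Sup k - Inf k)"
      by (simp add: sum_distrib_left)
    also have "\<dots> < L * (\<epsilon> / L)"
      using D \<open>L > 0\<close> by (intro mult_strict_left_mono) simp_all
    finally show "(\<Sum>k\<in>D. norm (c (Sup k) - c (Inf k))) < \<epsilon>"
      using \<open>L > 0\<close> by simp
  qed
qed

lemma absolutely_continuous_path_lipschitz_image:
  assumes "absolutely_continuous_path a b c"
    and lip: "\<And>s t. \<lbrakk>a \<le> s; s \<le> b; a \<le> t; t \<le> b\<rbrakk> \<Longrightarrow> norm (c' t - c' s) \<le> K * norm (c t - c s)"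
  shows "absolutely_continuous_path a b c'"
  unfolding absolutely_continuous_path_def
proof (intro allI impI)
  fix \<epsilon> :: real assume "\<epsilon> > 0"
  define L where "L = max K 1"
  have "L > 0" by (simp add: L_def)
  with \<open>\<epsilon> > 0\<close> have "\<epsilon> / L > 0" by simp
  from absolutely_continuous_pathE[OF assms(1) this] obtain \<delta> where "\<delta> > 0"
    and \<delta>: "\<And>D. \<lbrakk>D division_of \<Union>D; \<Union>D \<subseteq> {a..b}; (\<Sum>k\<in>D. Sup k - Inf k) < \<delta>\<rbrakk>
     \<Longrightarrow> (\<Sum>k\<in>D. norm (c (Sup k) - c (Inf k))) < \<epsilon> / L" by blast
  show "\<exists>\<delta>>0. \<forall>D. D division_of \<Union>D \<and> \<Union>D \<subseteq> {a..b} \<and> (\<Sum>k\<in>D. Sup k - Inf k) < \<delta>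
        \<longrightarrow> (\<Sum>k\<in>D. norm (c' (Sup k) - c' (Inf k))) < \<epsilon>"
  proof (intro exI[of _ \<delta>] conjI allI impI \<open>\<delta> > 0\<close>)
    fix D assume D: "D division_of \<Union>D \<and> \<Union>D \<subseteq> {a..b} \<and> (\<Sum>k\<in>D. Sup k - Inf k) < \<delta>"
    have "(\<Sum>k\<in>D. norm (c' (Sup k) - c' (Inf k))) \<le> (\<Sum>k\<in>D. L * norm (c (Sup k) - c (Inf k)))"
    proof (rule sum_mono)
      fix k assume "k \<in> D"
      with division_of_Inf_Sup_bounds[of D a b k] D
      have "a \<le> Inf k" "Inf k \<le> Sup k" "Sup k \<le> b" by auto
      then have "norm (c' (Sup k) - c' (Inf k)) \<le> K * norm (c (Sup k) - c (Inf k))"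
        by (intro lip) auto
      also have "\<dots> \<le> L * norm (c (Sup k) - c (Inf k))"
        by (rule mult_right_mono) (auto simp: L_def)
      finally show "norm (c' (Sup k) - c' (Inf k)) \<le> L * norm (c (Sup k) - c (Inf k))" .
    qed
    also have "\<dots> = L * (\<Sum>k\<in>D. norm (c (Sup k) - c (Inf k)))"
      by (simp add: sum_distrib_left)
    also have "\<dots> < L * (\<epsilon> / L)"
      using D by (intro mult_strict_left_mono \<delta>) (simp_all add: \<open>L > 0\<close>)
    finally show "(\<Sum>k\<in>D. norm (c' (Sup k) - c' (Inf k))) < \<epsilon>"
      using \<open>L > 0\<close> by simp
  qed
qed

lemma absolutely_continuous_path_scaleR:
  "absolutely_continuous_path a b c \<Longrightarrow> absolutely_continuous_path a b (\<lambda>t. r *\<^sub>R c t)"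
  by (rule absolutely_continuous_path_lipschitz_image[where K = "\<bar>r\<bar>"])
    (auto simp: scaleR_diff_right[symmetric])

lemma absolutely_continuous_path_affine:
  assumes "absolutely_continuous_path a b c" "m \<noteq> 0"
    and maps: "\<And>t. \<lbrakk>a' \<le> t; t \<le> b'\<rbrakk> \<Longrightarrow> a \<le> m * t + z \<and> m * t + z \<le> b"
  shows "absolutely_continuous_path a' b' (\<lambda>t. c (m * t + z))"
  unfolding absolutely_continuous_path_def
proof (intro allI impI)
  fix \<epsilon> :: real assume "\<epsilon> > 0"
  obtain \<delta> where "\<delta> > 0" and \<delta>:
    "\<And>D (p :: real set \<Rightarrow> real) q. \<lbrakk>finite D; \<And>k. k \<in> D \<Longrightarrow> a \<le> p k \<and> p k < q k \<and> q k \<le> b;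
       \<And>k l. \<lbrakk>k \<in> D; l \<in> D; k \<noteq> l\<rbrakk> \<Longrightarrow> {p k<..<q k} \<inter> {p l<..<q l} = {};
       (\<Sum>k\<in>D. q k - p k) < \<delta>\<rbrakk> \<Longrightarrow> (\<Sum>k\<in>D. norm (c (q k) - c (p k))) < \<epsilon>"
    by (rule absolutely_continuous_pathE_indexed[OF assms(1) \<open>\<epsilon> > 0\<close>]) blast
  show "\<exists>\<delta>>0. \<forall>D. D division_of \<Union>D \<and> \<Union>D \<subseteq> {a'..b'} \<and> (\<Sum>k\<in>D. Sup k - Inf k) < \<delta>
        \<longrightarrow> (\<Sum>k\<in>D. norm (c (m * Sup k + z) - c (m * Inf k + z))) < \<epsilon>"
  proof (intro exI[of _ "\<delta> / \<bar>m\<bar>"] conjI allI impI)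
    show "0 < \<delta> / \<bar>m\<bar>" using \<open>\<delta> > 0\<close> \<open>m \<noteq> 0\<close> by simp
    fix D assume D: "D division_of \<Union>D \<and> \<Union>D \<subseteq> {a'..b'} \<and> (\<Sum>k\<in>D. Sup k - Inf k) < \<delta> / \<bar>m\<bar>"
    \<comment> \<open>Degenerate intervals contribute nothing and are dropped, because the indexed
      condition asks for strict inequalities.\<close>
    define D' where "D' = {k \<in> D. Inf k < Sup k}"
    have "finite D" using D division_of_finite by blast
    have bd: "a' \<le> Inf k" "Inf k \<le> Sup k" "Sup k \<le> b'" if "k \<in> D" for k
      using division_of_Inf_Sup_bounds[of D a' b' k] D that by auto
    \<comment> \<open>A negative m reverses orientation, so the end points change places.\<close>
    define p where "p = (\<lambda>k. if m > 0 then m * Inf k + z else m * Sup k + z)"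
    define q where "q = (\<lambda>k. if m > 0 then m * Sup k + z else m * Inf k + z)"
    have qp: "q k - p k = \<bar>m\<bar> * (Sup k - Inf k)" for k
      by (simp add: p_def q_def algebra_simps)
    have "(\<Sum>k\<in>D. norm (c (m * Sup k + z) - c (m * Inf k + z)))
        = (\<Sum>k\<in>D'. norm (c (m * Sup k + z) - c (m * Inf k + z)))"
    proof (rule sum.mono_neutral_right[OF \<open>finite D\<close>])
      show "\<forall>k\<in>D - D'. norm (c (m * Sup k + z) - c (m * Inf k + z)) = 0"
      proof
        fix k assume "k \<in> D - D'"
        then have "Sup k = Inf k" using bd(2)[of k] by (auto simp: D'_def)
        then show "norm (c (m * Sup k + z) - c (m * Inf k + z)) = 0" by simp
      qed
    qed (auto simp: D'_def)
    also have "\<dots> = (\<Sum>k\<in>D'. norm (c (q k) - c (p k)))"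
      by (rule sum.cong) (auto simp: p_def q_def norm_minus_commute)
    also have "\<dots> < \<epsilon>"
    proof (rule \<delta>)
      show "finite D'" using \<open>finite D\<close> by (simp add: D'_def)
      show "a \<le> p k \<and> p k < q k \<and> q k \<le> b" if "k \<in> D'" for k
      proof -
        have k: "k \<in> D" "Inf k < Sup k" using that by (auto simp: D'_def)
        have "p k < q k"
          using qp[of k] k \<open>m \<noteq> 0\<close> by (smt (verit) zero_less_abs_iff zero_less_mult_iff)
        moreover have "a \<le> p k" "q k \<le> b"
          using maps[of "Inf k"] maps[of "Sup k"] bd[OF k(1)] by (auto simp: p_def q_def)
        ultimately show ?thesis by simp
      qed
      show "{p k<..<q k} \<inter> {p l<..<q l} = {}" if "k \<in> D'" "l \<in> D'" "k \<noteq> l" for k l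
      proof (rule ccontr)
        assume "{p k<..<q k} \<inter> {p l<..<q l} \<noteq> {}"
        then obtain x where "x \<in> {p k<..<q k} \<inter> {p l<..<q l}" by blast
        then have x: "p k < x" "x < q k" "p l < x" "x < q l" by simp_all
        define y where "y = (x - z) / m"
        have xy: "x = m * y + z" using \<open>m \<noteq> 0\<close> by (simp add: y_def)
        have "y \<in> {Inf k<..<Sup k} \<inter> {Inf l<..<Sup l}"
          using x \<open>m \<noteq> 0\<close> unfolding xy p_def q_def
          by (cases "m > 0") (auto simp: mult_less_cancel_left)
        moreover have "{Inf k<..<Sup k} \<inter> {Inf l<..<Sup l} = {}"
          by (rule division_of_disjoint_interior[of D "\<Union>D"]) (use D that in \<open>simp_all add: D'_def\<close>)
        ultimately show False by blast
      qed
      have "(\<Sum>k\<in>D'. q k - p k) = \<bar>m\<bar> * (\<Sum>k\<in>D'. Sup k - Inf k)"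
        unfolding qp by (simp add: sum_distrib_left)
      also have "\<dots> \<le> \<bar>m\<bar> * (\<Sum>k\<in>D. Sup k - Inf k)"
        by (intro mult_left_mono sum_mono2 \<open>finite D\<close>) (use bd in \<open>auto simp: D'_def\<close>)
      also have "\<dots> < \<bar>m\<bar> * (\<delta> / \<bar>m\<bar>)"
        using D \<open>m \<noteq> 0\<close> by (intro mult_strict_left_mono) auto
      finally show "(\<Sum>k\<in>D'. q k - p k) < \<delta>" using \<open>m \<noteq> 0\<close> by simp
    qed
    finally show "(\<Sum>k\<in>D. norm (c (m * Sup k + z) - c (m * Inf k + z))) < \<epsilon>" .
  qed
qed

section \<open>Cutting of divisions and bounded variation\<close>

text \<open>Every interval is cut at m by minimum and maximum. An interval on one side of m leaves a
  degenerate piece on the other, which is removed; for an interval across m the triangle inequality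
  through \<open>c m\<close> applies.\<close>

lemma division_cut:
  fixes c :: "real \<Rightarrow> 'a::real_normed_vector"
  assumes D: "D division_of \<Union>D" "\<Union>D \<subseteq> {a..b}" and m: "a \<le> m" "m \<le> b"
  obtains L R where "L division_of \<Union>L" "\<Union>L \<subseteq> {a..m}" "R division_of \<Union>R" "\<Union>R \<subseteq> {m..b}"
    "(\<Sum>k\<in>D. norm (c (Sup k) - c (Inf k)))
       \<le> (\<Sum>k\<in>L. norm (c (Sup k) - c (Inf k))) + (\<Sum>k\<in>R. norm (c (Sup k) - c (Inf k)))"
    "(\<Sum>k\<in>L. Sup k - Inf k) \<le> (\<Sum>k\<in>D. Sup k - Inf k)"
    "(\<Sum>k\<in>R. Sup k - Inf k) \<le> (\<Sum>k\<in>D. Sup k - Inf k)"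
proof -
  have fin: "finite D" using D division_of_finite by blast
  have bd: "a \<le> Inf k" "Inf k \<le> Sup k" "Sup k \<le> b" if "k \<in> D" for k
    using division_of_Inf_Sup_bounds[OF D that] by auto
  define lo where "lo = (\<lambda>k::real set. min m (Inf k))"
  define mid where "mid = (\<lambda>k::real set. min m (Sup k))"
  define mid' where "mid' = (\<lambda>k::real set. max m (Inf k))"
  define hi where "hi = (\<lambda>k::real set. max m (Sup k))"
  define DL where "DL = {k \<in> D. lo k < mid k}"
  define DR where "DR = {k \<in> D. mid' k < hi k}"
  have sub: "DL \<subseteq> D" "DR \<subseteq> D" by (auto simp: DL_def DR_def)
  have "{lo k<..<mid k} \<inter> {lo l<..<mid l} = {}" if "k \<in> DL" "l \<in> DL" "k \<noteq> l" for k l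
    using division_of_disjoint_interior[OF D(1), of k l] that sub
    by (fastforce simp: lo_def mid_def)
  note L = division_of_image[of DL lo mid, OF finite_subset[OF sub(1) fin] _ this, simplified]
  have "{mid' k<..<hi k} \<inter> {mid' l<..<hi l} = {}" if "k \<in> DR" "l \<in> DR" "k \<noteq> l" for k l
    using division_of_disjoint_interior[OF D(1), of k l] that sub
    by (fastforce simp: mid'_def hi_def)
  note R = division_of_image[of DR mid' hi, OF finite_subset[OF sub(2) fin] _ this, simplified]
  have lm: "lo k \<le> mid k" "mid' k \<le> hi k" if "k \<in> D" for k
    using bd[OF that] by (auto simp: lo_def mid_def mid'_def hi_def)
  \<comment> \<open>The removed pieces return as zero terms, so that the sums can be compared with
    the sum over \<open>D\<close> term by term.\<close>
  have sumL: "(\<Sum>k\<in>DL. \<phi> (lo k) (mid k)) = (\<Sum>k\<in>D. \<phi> (lo k) (mid k))" if "\<And>x. \<phi> x x = (0::real)" for \<phi>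
  proof (rule sum.mono_neutral_left[OF fin sub(1)], rule ballI)
    fix k assume "k \<in> D - DL"
    then have "lo k = mid k" using lm(1)[of k] by (auto simp: DL_def)
    with that show "\<phi> (lo k) (mid k) = 0" by simp
  qed
  have sumR: "(\<Sum>k\<in>DR. \<phi> (mid' k) (hi k)) = (\<Sum>k\<in>D. \<phi> (mid' k) (hi k))" if "\<And>x. \<phi> x x = (0::real)" for \<phi>
  proof (rule sum.mono_neutral_left[OF fin sub(2)], rule ballI)
    fix k assume "k \<in> D - DR"
    then have "mid' k = hi k" using lm(2)[of k] by (auto simp: DR_def)
    with that show "\<phi> (mid' k) (hi k) = 0" by simp
  qed
  let ?L = "(\<lambda>k. {lo k..mid k}) ` DL" and ?R = "(\<lambda>k. {mid' k..hi k}) ` DR"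
  show thesis
  proof (rule that[of ?L ?R])
    show "?L division_of \<Union>?L" "?R division_of \<Union>?R"
      by (rule L(1) R(1); simp add: DL_def DR_def)+
    show "\<Union>?L \<subseteq> {a..m}" "\<Union>?R \<subseteq> {m..b}"
      using bd sub m by (fastforce simp: lo_def mid_def mid'_def hi_def)+
    have sL: "(\<Sum>k\<in>?L. \<phi> (Inf k) (Sup k)) = (\<Sum>k\<in>DL. \<phi> (lo k) (mid k))" for \<phi> :: "real \<Rightarrow> real \<Rightarrow> real"
      by (rule L(2)) (simp add: DL_def)
    have sR: "(\<Sum>k\<in>?R. \<phi> (Inf k) (Sup k)) = (\<Sum>k\<in>DR. \<phi> (mid' k) (hi k))" for \<phi> :: "real \<Rightarrow> real \<Rightarrow> real"
      by (rule R(2)) (simp add: DR_def)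
    have "(\<Sum>k\<in>D. norm (c (Sup k) - c (Inf k)))
        \<le> (\<Sum>k\<in>D. norm (c (mid k) - c (lo k)) + norm (c (hi k) - c (mid' k)))"
    proof (rule sum_mono)
      fix k assume "k \<in> D"
      show "norm (c (Sup k) - c (Inf k)) \<le> norm (c (mid k) - c (lo k)) + norm (c (hi k) - c (mid' k))"
        using bd(2)[OF \<open>k \<in> D\<close>] norm_triangle_ineq[of "c (Sup k) - c m" "c m - c (Inf k)"]
        by (cases "Sup k \<le> m"; cases "Inf k \<le> m")
          (auto simp: lo_def mid_def mid'_def hi_def min_def max_def)
    qed
    then show "(\<Sum>k\<in>D. norm (c (Sup k) - c (Inf k)))
       \<le> (\<Sum>k\<in>?L. norm (c (Sup k) - c (Inf k))) + (\<Sum>k\<in>?R. norm (c (Sup k) - c (Inf k)))"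
      unfolding sL[of "\<lambda>u v. norm (c v - c u)"] sR[of "\<lambda>u v. norm (c v - c u)"]
      by (subst sumL sumR; simp add: sum.distrib)+
    show "(\<Sum>k\<in>?L. Sup k - Inf k) \<le> (\<Sum>k\<in>D. Sup k - Inf k)"
      unfolding sL[of "\<lambda>u v. v - u"] by (subst sumL, simp, rule sum_mono, drule bd(2)) (auto simp: lo_def mid_def min_def)
    show "(\<Sum>k\<in>?R. Sup k - Inf k) \<le> (\<Sum>k\<in>D. Sup k - Inf k)"
      unfolding sR[of "\<lambda>u v. v - u"] by (subst sumR, simp, rule sum_mono, drule bd(2)) (auto simp: mid'_def hi_def max_def)
  qed
qed

lemma absolutely_continuous_path_join:
  assumes "absolutely_continuous_path a m c" "absolutely_continuous_path m b c" "a \<le> m" "m \<le> b"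
  shows "absolutely_continuous_path a b c"
  unfolding absolutely_continuous_path_def
proof (intro allI impI)
  fix \<epsilon> :: real assume "\<epsilon> > 0"
  then have "\<epsilon> / 2 > 0" by simp
  from absolutely_continuous_pathE[OF assms(1) this] obtain \<delta>1 where "\<delta>1 > 0"
    and \<delta>1: "\<And>D. \<lbrakk>D division_of \<Union>D; \<Union>D \<subseteq> {a..m}; (\<Sum>k\<in>D. Sup k - Inf k) < \<delta>1\<rbrakk>
     \<Longrightarrow> (\<Sum>k\<in>D. norm (c (Sup k) - c (Inf k))) < \<epsilon> / 2" by blast
  from absolutely_continuous_pathE[OF assms(2) \<open>\<epsilon> / 2 > 0\<close>] obtain \<delta>2 where "\<delta>2 > 0"
    and \<delta>2: "\<And>D. \<lbrakk>D division_of \<Union>D; \<Union>D \<subseteq> {m..b}; (\<Sum>k\<in>D. Sup k - Inf k) < \<delta>2\<rbrakk>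
     \<Longrightarrow> (\<Sum>k\<in>D. norm (c (Sup k) - c (Inf k))) < \<epsilon> / 2" by blast
  show "\<exists>\<delta>>0. \<forall>D. D division_of \<Union>D \<and> \<Union>D \<subseteq> {a..b} \<and> (\<Sum>k\<in>D. Sup k - Inf k) < \<delta>
        \<longrightarrow> (\<Sum>k\<in>D. norm (c (Sup k) - c (Inf k))) < \<epsilon>"
  proof (intro exI[of _ "min \<delta>1 \<delta>2"] conjI allI impI)
    show "0 < min \<delta>1 \<delta>2" using \<open>\<delta>1 > 0\<close> \<open>\<delta>2 > 0\<close> by simp
    fix D assume D: "D division_of \<Union>D \<and> \<Union>D \<subseteq> {a..b} \<and> (\<Sum>k\<in>D. Sup k - Inf k) < min \<delta>1 \<delta>2"
    obtain L R where LR: "L division_of \<Union>L" "\<Union>L \<subseteq> {a..m}" "R division_of \<Union>R" "\<Union>R \<subseteq> {m..b}"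
      "(\<Sum>k\<in>D. norm (c (Sup k) - c (Inf k)))
       \<le> (\<Sum>k\<in>L. norm (c (Sup k) - c (Inf k))) + (\<Sum>k\<in>R. norm (c (Sup k) - c (Inf k)))"
      "(\<Sum>k\<in>L. Sup k - Inf k) \<le> (\<Sum>k\<in>D. Sup k - Inf k)"
      "(\<Sum>k\<in>R. Sup k - Inf k) \<le> (\<Sum>k\<in>D. Sup k - Inf k)"
      by (rule division_cut[of D a b m c]) (use D assms in auto)
    then show "(\<Sum>k\<in>D. norm (c (Sup k) - c (Inf k))) < \<epsilon>"
      using \<delta>1[of L] \<delta>2[of R] D by fastforce
  qed
qed

lemma division_length_le:
  fixes D :: "real set set"
  assumes "D division_of \<Union>D" "\<Union>D \<subseteq> {a..b}" "a \<le> b"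
  shows "(\<Sum>k\<in>D. Sup k - Inf k) \<le> b - a"
proof -
  have "(\<Sum>k\<in>D. Sup k - Inf k) = (\<Sum>k\<in>D. measure lebesgue k)"
  proof (rule sum.cong[OF refl])
    fix k assume "k \<in> D"
    note k = division_of_Icc[OF assms(1) this]
    have "measure lebesgue {Inf k..Sup k} = Sup k - Inf k" using k(2) by simp
    then show "Sup k - Inf k = measure lebesgue k" using k(1) by simp
  qed
  also have "\<dots> = measure lebesgue (\<Union>D)"
    by (rule content_division[OF assms(1)])
  also have "\<dots> \<le> measure lebesgue {a..b}"
    by (rule measure_mono_fmeasurable) (use assms lmeasurable_division[of D "\<Union>D"] in \<open>auto simp: fmeasurableD\<close>)
  finally show ?thesis using \<open>a \<le> b\<close> by simp
qed

text \<open>Greedy grouping. In a division of total length at least \<delta>, take a subfamily of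
  length below \<delta> with the largest number of members; its variation is below 1, and one more
  interval, of increment at most 2 M, brings the length to at least \<delta>. Removing this group
  lowers the total length by at least \<delta> at cost K, so induction bounds the variation linearly
  in the total length.\<close>

lemma absolutely_continuous_path_bounded_variation:
  assumes ac: "absolutely_continuous_path a b c" and ab: "a \<le> b"
  obtains B where "\<And>D. \<lbrakk>D division_of \<Union>D; \<Union>D \<subseteq> {a..b}\<rbrakk> \<Longrightarrow> (\<Sum>k\<in>D. norm (c (Sup k) - c (Inf k))) \<le> B"
proof -
  obtain \<delta> where "\<delta> > 0" and \<delta>: "\<And>D. \<lbrakk>D division_of \<Union>D; \<Union>D \<subseteq> {a..b}; (\<Sum>k\<in>D. Sup k - Inf k) < \<delta>\<rbrakk>
     \<Longrightarrow> (\<Sum>k\<in>D. norm (c (Sup k) - c (Inf k))) < 1"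
    by (rule absolutely_continuous_pathE[OF ac zero_less_one]) blast
  have "bounded (c ` {a..b})"
    by (intro compact_imp_bounded compact_continuous_image absolutely_continuous_path_imp_continuous[OF ac]) simp
  then obtain M where M: "\<And>t. t \<in> {a..b} \<Longrightarrow> norm (c t) \<le> M"
    unfolding bounded_iff by blast
  define K where "K = 1 + 2 * M"
  have "M \<ge> 0"
    using M[of a] ab norm_ge_zero[of "c a"] by (simp del: norm_ge_zero)
  define v where "v = (\<lambda>k::real set. norm (c (Sup k) - c (Inf k)))"
  define len where "len = (\<lambda>D. \<Sum>k\<in>D. Sup k - Inf (k::real set))"
  have main: "(\<Sum>k\<in>D. v k) \<le> K * (1 + len D / \<delta>)"
    if "D division_of \<Union>D" "\<Union>D \<subseteq> {a..b}" for D
    using that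
  proof (induction "card D" arbitrary: D rule: less_induct)
    case less
    have fin: "finite D" using less.prems(1) division_of_finite by blast
    have bd: "a \<le> Inf k" "Inf k \<le> Sup k" "Sup k \<le> b" if "k \<in> D" for k
      using division_of_Inf_Sup_bounds[OF less.prems that] by auto
    have sub: "E division_of \<Union>E" "\<Union>E \<subseteq> {a..b}" if "E \<subseteq> D" for E
      using division_of_subset[OF less.prems(1) that] less.prems(2) that by auto
    have len0: "len E \<ge> 0" if "E \<subseteq> D" for E
      unfolding len_def using bd(2) that by (intro sum_nonneg) (auto simp: subset_iff)
    show ?case
    proof (cases "len D < \<delta>")
      case True
      have "(\<Sum>k\<in>D. v k) < 1"
        using \<delta>[OF less.prems] True unfolding v_def len_def by blast
      also have "\<dots> \<le> K * (1 + len D / \<delta>)"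
        using \<open>M \<ge> 0\<close> \<open>\<delta> > 0\<close> len0[of D] mult_mono[of 1 K 1 "1 + len D / \<delta>"] by (simp add: K_def)
      finally show ?thesis by simp
    next
      case False
      define P where "P = (\<lambda>E. E \<subseteq> D \<and> len E < \<delta>)"
      have "P {}" using \<open>\<delta> > 0\<close> by (simp add: P_def len_def)
      obtain E where E: "P E" and Emax: "\<And>F. P F \<Longrightarrow> card F \<le> card E"
        using ex_has_greatest_nat[of P "{}" card "Suc (card D)"] \<open>P {}\<close> fin
        by (metis P_def card_mono le_imp_less_Suc less_or_eq_imp_le)
      have "E \<noteq> D" using E False by (auto simp: P_def)
      then obtain k where k: "k \<in> D" "k \<notin> E" using E by (auto simp: P_def)
      have finE: "finite E" using E fin finite_subset by (auto simp: P_def)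
      define F where "F = insert k E"
      have F: "F \<subseteq> D" using E k by (auto simp: F_def P_def)
      have "card F = Suc (card E)" using k finE by (simp add: F_def)
      then have "\<not> P F" using Emax[of F] by auto
      then have lenF: "\<delta> \<le> len F" using F by (auto simp: P_def)
      have "(\<Sum>k\<in>E. v k) < 1"
        using \<delta>[OF sub[of E]] E unfolding v_def len_def P_def by blast
      moreover have "v k \<le> 2 * M"
      proof -
        have "norm (c (Sup k)) \<le> M" "norm (c (Inf k)) \<le> M"
          using bd[OF k(1)] by (auto intro!: M)
        then show ?thesis
          unfolding v_def using norm_triangle_ineq4[of "c (Sup k)" "c (Inf k)"] by linarith
      qed
      ultimately have vF: "(\<Sum>k\<in>F. v k) \<le> K"
        using k finE by (simp add: F_def K_def)
      have "card (D - F) < card D"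
        using F k(1) fin by (intro psubset_card_mono) (auto simp: F_def)
      from less.hyps[OF this sub] have IH: "(\<Sum>k\<in>D - F. v k) \<le> K * (1 + len (D - F) / \<delta>)"
        by simp
      have split: "sum g D = sum g F + sum g (D - F)" for g :: "real set \<Rightarrow> real"
        using sum.subset_diff[OF F fin, of g] by simp
      have "len (D - F) / \<delta> \<le> len D / \<delta> - 1"
        using lenF split[of "\<lambda>k. Sup k - Inf k"] \<open>\<delta> > 0\<close> by (simp add: len_def field_simps)
      then have "K * (1 + len (D - F) / \<delta>) \<le> K * (len D / \<delta>)"
        using \<open>M \<ge> 0\<close> by (intro mult_left_mono) (auto simp: K_def)
      then show ?thesis
        unfolding split[of v] using IH vF by (simp add: algebra_simps)
    qed
  qed
  show thesis
  proof (rule that)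
    fix D assume D: "D division_of \<Union>D" "\<Union>D \<subseteq> {a..b}"
    have "(\<Sum>k\<in>D. norm (c (Sup k) - c (Inf k))) \<le> K * (1 + len D / \<delta>)"
      using main[OF D] by (simp add: v_def)
    also have "\<dots> \<le> K * (1 + (b - a) / \<delta>)"
      using division_length_le[OF D ab] \<open>\<delta> > 0\<close> \<open>M \<ge> 0\<close>
      by (intro mult_left_mono add_left_mono divide_right_mono) (auto simp: K_def len_def)
    finally show "(\<Sum>k\<in>D. norm (c (Sup k) - c (Inf k))) \<le> K * (1 + (b - a) / \<delta>)" .
  qed
qed

text \<open>V is the total variation on \<open>{a..t}\<close>. Appending \<open>{s..t}\<close> to a
  division of \<open>{a..s}\<close> gives the lower estimate of its increments, which also yields
  monotonicity.\<close>

lemma absolutely_continuous_path_variation: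
  assumes ac: "absolutely_continuous_path a b c" and ab: "a \<le> b"
  obtains V :: "real \<Rightarrow> real" where "mono V" "continuous_on UNIV V"
    "\<And>s t. \<lbrakk>a \<le> s; s \<le> t; t \<le> b\<rbrakk> \<Longrightarrow> norm (c t - c s) \<le> V t - V s"
proof -
  obtain B where B: "\<And>D. \<lbrakk>D division_of \<Union>D; \<Union>D \<subseteq> {a..b}\<rbrakk> \<Longrightarrow> (\<Sum>k\<in>D. norm (c (Sup k) - c (Inf k))) \<le> B"
    by (rule absolutely_continuous_path_bounded_variation[OF ac ab]) blast
  define X where "X = (\<lambda>t. {D. D division_of \<Union>D \<and> \<Union>D \<subseteq> {a..t}})"
  define S where "S = (\<lambda>D::real set set. \<Sum>k\<in>D. norm (c (Sup k) - c (Inf k)))"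
  define v where "v = (\<lambda>t. SUP D\<in>X t. S D)"
  have ne: "X t \<noteq> {}" for t
  proof -
    have "{} \<in> X t" by (auto simp: X_def)
    then show ?thesis by blast
  qed
  have bdd: "bdd_above (S ` X t)" if "t \<le> b" for t
  proof (rule bdd_aboveI2)
    fix D assume "D \<in> X t"
    then have "D division_of \<Union>D" "\<Union>D \<subseteq> {a..b}" using that by (fastforce simp: X_def)+
    then show "S D \<le> B" unfolding S_def by (rule B)
  qed
  have v_lower: "v s + norm (c t - c s) \<le> v t" if st: "a \<le> s" "s \<le> t" "t \<le> b" for s t
  proof (cases "s = t")
    case False
    with st have "s < t" by simp
    have "S D \<le> v t - norm (c t - c s)" if D: "D \<in> X s" for D
    proof -
      have div: "D division_of \<Union>D" and sub: "\<Union>D \<subseteq> {a..s}" using D by (auto simp: X_def)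
      have fin: "finite D" using div division_of_finite by blast
      have notin: "{s..t} \<notin> D"
      proof
        assume "{s..t} \<in> D"
        moreover have "t \<in> {s..t}" using \<open>s < t\<close> by simp
        ultimately have "t \<in> \<Union>D" by (rule UnionI)
        with sub \<open>s < t\<close> show False by auto
      qed
      have "insert {s..t} D division_of {s..t} \<union> \<Union>D"
      proof (rule division_ofI)
        show "finite (insert {s..t} D)" using fin by simp
        show "K \<subseteq> {s..t} \<union> \<Union>D" if "K \<in> insert {s..t} D" for K using that by blast
        show "K \<noteq> {}" if "K \<in> insert {s..t} D" for K
          using that division_ofD(3)[OF div] \<open>s < t\<close> by auto
        show "\<exists>a b. K = cbox a b" if "K \<in> insert {s..t} D" for K
          using that division_ofD(4)[OF div] by (metis box_real(2) insertE)
        have *: "interior K \<inter> interior {s..t} = {}" if "K \<in> D" for K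
        proof -
          have "K \<subseteq> {a..s}" using sub that by blast
          from interior_mono[OF this] show ?thesis by fastforce
        qed
        show "interior K1 \<inter> interior K2 = {}"
          if "K1 \<in> insert {s..t} D" "K2 \<in> insert {s..t} D" "K1 \<noteq> K2" for K1 K2
          using that division_ofD(5)[OF div, of K1 K2] *[of K1] *[of K2] by blast
      qed simp
      moreover have "{s..t} \<union> \<Union>D \<subseteq> {a..t}" using sub st by fastforce
      ultimately have "insert {s..t} D \<in> X t" by (simp add: X_def)
      then have "S (insert {s..t} D) \<le> v t"
        unfolding v_def by (rule cSUP_upper) (rule bdd[OF st(3)])
      then show ?thesis
        using notin fin \<open>s < t\<close> by (simp add: S_def)
    qed
    then have "(SUP D\<in>X s. S D) \<le> v t - norm (c t - c s)"
      by (intro cSUP_least ne)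
    then show ?thesis by (simp add: v_def)
  qed simp
  \<comment> \<open>A division of \<open>{a..t}\<close> is cut at s; its part beyond s has length at
    most t - s and hence small variation. This gives continuity of the variation.\<close>
  have v_upper: "\<exists>\<delta>>0. \<forall>s t. a \<le> s \<longrightarrow> s \<le> t \<longrightarrow> t \<le> b \<longrightarrow> t - s < \<delta> \<longrightarrow> v t \<le> v s + \<epsilon>"
    if "\<epsilon> > 0" for \<epsilon>
  proof -
    obtain \<delta> where "\<delta> > 0" and \<delta>: "\<And>D. \<lbrakk>D division_of \<Union>D; \<Union>D \<subseteq> {a..b}; (\<Sum>k\<in>D. Sup k - Inf k) < \<delta>\<rbrakk>
     \<Longrightarrow> S D < \<epsilon>"
      unfolding S_def by (rule absolutely_continuous_pathE[OF ac \<open>\<epsilon> > 0\<close>]) blast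
    have "v t \<le> v s + \<epsilon>" if st: "a \<le> s" "s \<le> t" "t \<le> b" "t - s < \<delta>" for s t
    proof -
      have "S D \<le> v s + \<epsilon>" if D: "D \<in> X t" for D
      proof -
        obtain L R where LR: "L division_of \<Union>L" "\<Union>L \<subseteq> {a..s}" "R division_of \<Union>R" "\<Union>R \<subseteq> {s..t}"
           and le: "S D \<le> S L + S R"
          unfolding S_def by (rule division_cut[of D a t s c]) (use D st in \<open>auto simp: X_def\<close>)
        have "S L \<le> v s"
          unfolding v_def
        proof (rule cSUP_upper)
          show "L \<in> X s" using LR by (simp add: X_def)
          show "bdd_above (S ` X s)" by (rule bdd) (use st in simp)
        qed
        moreover have "S R < \<epsilon>"
        proof (rule \<delta>[OF LR(3)])
          have "{s..t} \<subseteq> {a..b}" using st by auto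
          with LR(4) show "\<Union>R \<subseteq> {a..b}" by (rule subset_trans)
          show "(\<Sum>k\<in>R. Sup k - Inf k) < \<delta>"
            using division_length_le[OF LR(3,4) st(2)] st(4) by simp
        qed
        ultimately show ?thesis using le by simp
      qed
      then have "(SUP D\<in>X t. S D) \<le> v s + \<epsilon>"
        by (intro cSUP_least ne)
      then show ?thesis by (simp add: v_def)
    qed
    with \<open>\<delta> > 0\<close> show ?thesis by blast
  qed
  \<comment> \<open>Clamping extends the variation by constants to the whole line, as
    \<open>continuous_mono\<close> requires.\<close>
  define cl where "cl = (\<lambda>t. max a (min b t))"
  have cl: "a \<le> cl t" "cl t \<le> b" for t using ab by (auto simp: cl_def)
  have cl_mono: "cl s \<le> cl t" if "s \<le> t" for s t using that by (auto simp: cl_def)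
  have v_mono: "v s \<le> v t" if "a \<le> s" "s \<le> t" "t \<le> b" for s t
    using v_lower[OF that] norm_ge_zero[of "c t - c s"] by linarith
  have "continuous_on {a..b} v"
    unfolding continuous_on_iff
  proof (intro ballI allI impI)
    fix x \<epsilon> assume x: "x \<in> {a..b}" and "(0::real) < \<epsilon>"
    then have "\<epsilon> / 2 > 0" by simp
    from v_upper[OF this] obtain \<delta> where "\<delta> > 0"
      and \<delta>: "\<And>s t. \<lbrakk>a \<le> s; s \<le> t; t \<le> b; t - s < \<delta>\<rbrakk> \<Longrightarrow> v t \<le> v s + \<epsilon> / 2" by blast
    show "\<exists>d>0. \<forall>x'\<in>{a..b}. dist x' x < d \<longrightarrow> dist (v x') (v x) < \<epsilon>"
    proof (intro exI[of _ \<delta>] conjI \<open>\<delta> > 0\<close> ballI impI)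
      fix y assume y: "y \<in> {a..b}" "dist y x < \<delta>"
      show "dist (v y) (v x) < \<epsilon>"
      proof (cases "x \<le> y")
        case True
        with \<delta>[of x y] v_mono[of x y] x y \<open>0 < \<epsilon>\<close> show ?thesis by (simp add: dist_real_def)
      next
        case False
        with \<delta>[of y x] v_mono[of y x] x y \<open>0 < \<epsilon>\<close> show ?thesis by (simp add: dist_real_def)
      qed
    qed
  qed
  then have "continuous_on UNIV (v \<circ> cl)"
    by (intro continuous_on_compose)
      (auto simp: cl_def intro!: continuous_intros elim!: continuous_on_subset intro: ab)
  moreover have "mono (v \<circ> cl)"
    by (intro monoI) (simp add: v_mono cl cl_mono)
  moreover have "norm (c t - c s) \<le> (v \<circ> cl) t - (v \<circ> cl) s" if "a \<le> s" "s \<le> t" "t \<le> b" for s t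
    using v_lower[OF that] that by (simp add: cl_def)
  ultimately show thesis by (intro that[of "v \<circ> cl"])
qed

section \<open>Almost everywhere differentiability and the fundamental theorem of calculus\<close>

text \<open>Increments of the variation \<open>W\<close> dominate those of c, so \<open>W\<close>
  plus any coordinate of c is nondecreasing. Each coordinate is thus a difference of two functions
  to which Lebesgue's theorem applies.\<close>

lemma absolutely_continuous_path_differentiable:
  assumes ac: "absolutely_continuous_path a b c"
  shows "negligible {t \<in> {a<..<b}. \<not> c differentiable (at t)}"
proof (cases "a < b")
  case False
  then have "{t \<in> {a<..<b}. \<not> c differentiable (at t)} = {}" by auto
  then show ?thesis by (simp only: negligible_empty)
next
  case True
  obtain V where V: "mono V" "continuous_on UNIV V"
    "\<And>s t. \<lbrakk>a \<le> s; s \<le> t; t \<le> b\<rbrakk> \<Longrightarrow> norm (c t - c s) \<le> V t - V s"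
    by (rule absolutely_continuous_path_variation[OF ac]) (use True in auto)
  define cl where "cl = (\<lambda>t. max a (min b t))"
  have cl: "a \<le> cl t" "cl t \<le> b" for t using True by (auto simp: cl_def)
  have cl_mono: "cl s \<le> cl t" if "s \<le> t" for s t using that by (auto simp: cl_def)
  have cl_cont: "continuous_on UNIV cl" unfolding cl_def by (intro continuous_intros)
  have cl_range: "range cl \<subseteq> {a..b}" using cl by auto
  define W where "W = (\<lambda>t. V (cl t))"
  have W_cont: "continuous_on UNIV W"
    unfolding W_def by (rule continuous_on_compose2[OF V(2) cl_cont]) simp
  have c_cont: "continuous_on UNIV (\<lambda>t. c (cl t))"
    by (rule continuous_on_compose2[OF absolutely_continuous_path_imp_continuous[OF ac] cl_cont cl_range])
  have incr: "norm (c (cl t) - c (cl s)) \<le> W t - W s" if "s \<le> t" for s t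
    unfolding W_def by (rule V(3)) (use cl cl_mono that in auto)
  have "continuous_mono W"
  proof
    show "mono W"
      by (rule monoI) (use incr norm_ge_zero order_trans in \<open>metis diff_ge_0_iff_ge\<close>)
  qed (rule W_cont)
  then have negW: "negligible {t. \<not> W differentiable (at t)}"
    by (rule continuous_mono.negligible_not_differentiable)
  have neg: "negligible {t. \<not> (\<lambda>t. W t + c (cl t) \<bullet> e) differentiable (at t)}" if "e \<in> Basis" for e
  proof (rule continuous_mono.negligible_not_differentiable)
    show "continuous_mono (\<lambda>t. W t + c (cl t) \<bullet> e)"
    proof
      show "mono (\<lambda>t. W t + c (cl t) \<bullet> e)"
      proof (rule monoI)
        fix s t :: real assume "s \<le> t"
        have "\<bar>(c (cl t) - c (cl s)) \<bullet> e\<bar> \<le> norm (c (cl t) - c (cl s))"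
          by (rule Basis_le_norm[OF that])
        also note incr[OF \<open>s \<le> t\<close>]
        finally show "W s + c (cl s) \<bullet> e \<le> W t + c (cl t) \<bullet> e"
          by (simp add: inner_diff_left abs_le_iff)
      qed
      show "continuous_on UNIV (\<lambda>t. W t + c (cl t) \<bullet> e)"
        by (intro continuous_intros W_cont c_cont)
    qed
  qed
  have "negligible ({t. \<not> W differentiable (at t)} \<union>
      (\<Union>e\<in>Basis. {t. \<not> (\<lambda>t. W t + c (cl t) \<bullet> e) differentiable (at t)}))"
    using negW neg by (intro negligible_Un negligible_Union) auto
  then show ?thesis
  proof (rule negligible_subset, intro subsetI)
    fix t assume t: "t \<in> {t \<in> {a<..<b}. \<not> c differentiable (at t)}"
    show "t \<in> {t. \<not> W differentiable (at t)} \<union>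
      (\<Union>e\<in>Basis. {t. \<not> (\<lambda>t. W t + c (cl t) \<bullet> e) differentiable (at t)})"
    proof (rule ccontr)
      assume *: "t \<notin> {t. \<not> W differentiable (at t)} \<union>
        (\<Union>e\<in>Basis. {t. \<not> (\<lambda>t. W t + c (cl t) \<bullet> e) differentiable (at t)})"
      have "(\<lambda>t. c (cl t) \<bullet> e) differentiable (at t)" if "e \<in> Basis" for e
      proof -
        have "(\<lambda>t. W t + c (cl t) \<bullet> e) differentiable (at t)" "W differentiable (at t)"
          using * that by auto
        then have "(\<lambda>t. (W t + c (cl t) \<bullet> e) - W t) differentiable (at t)"
          by (rule differentiable_diff)
        then show ?thesis by simp
      qed
      then have "(\<lambda>t. c (cl t)) differentiable (at t)"
        by (subst differentiable_componentwise_within) auto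
      then obtain f' where "((\<lambda>t. c (cl t)) has_derivative f') (at t)"
        unfolding differentiable_def by blast
      then have "(c has_derivative f') (at t)"
        by (rule has_derivative_transform_within_open[of _ _ _ _ "{a<..<b}"])
          (use t in \<open>auto simp: cl_def\<close>)
      with t show False unfolding differentiable_def by auto
    qed
  qed
qed


lemma velocity_interior: "t \<in> {a<..<b} \<Longrightarrow> velocity a b c t = vector_derivative c (at t)"
  unfolding velocity_def by (subst at_within_interior) auto

text \<open>The integral is taken in the Henstock-Kurzweil sense, where the gauge may depend on the
  tag. At a tag off the null set N it comes from the derivative, with error \<eta> times the length.
  At a tag in N it is an open set G around N of measure below \<delta>, so that the increments over
  intervals tagged in N sum to less than e / 2 by absolute continuity.\<close>

lemma velocity_has_integral:
  assumes ac: "absolutely_continuous_path a b c" and ab: "a \<le> b"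
  shows "(velocity a b c has_integral (c b - c a)) {a..b}"
proof -
  define N where "N = {t \<in> {a<..<b}. \<not> c differentiable (at t)} \<union> {a, b}"
  have N: "negligible N"
    unfolding N_def by (intro negligible_Un absolutely_continuous_path_differentiable[OF ac]) auto
  have N_null: "N \<in> null_sets lebesgue"
    using N by (simp add: negligible_iff_null_sets)
  \<comment> \<open>With the value 0 on N, a term tagged in N reduces to the increment of the path
    alone. The change on a null set is undone at the end.\<close>
  define g where "g = (\<lambda>t. if t \<in> N then 0 else velocity a b c t)"
  have deriv: "(c has_vector_derivative g t) (at t)" if "t \<in> {a..b}" "t \<notin> N" for t
  proof -
    have "t \<in> {a<..<b}" "c differentiable (at t)" using that by (auto simp: N_def)
    then show ?thesis
      using that by (simp add: g_def velocity_interior vector_derivative_works)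
  qed
  have "(g has_integral (c b - c a)) {a..b}"
    unfolding has_integral_real
  proof (intro allI impI)
    fix e :: real assume "e > 0"
    define \<eta> where "\<eta> = e / (2 * (b - a + 1))"
    have "\<eta> > 0" using \<open>e > 0\<close> ab by (simp add: \<eta>_def)
    have \<eta>: "\<eta> * (b - a) < e / 2"
      using \<open>e > 0\<close> ab by (simp add: \<eta>_def divide_simps)
    have "e / 2 > 0" using \<open>e > 0\<close> by simp
    obtain \<delta> where "\<delta> > 0" and \<delta>:
      "\<And>D (p :: real \<times> real set \<Rightarrow> real) q. \<lbrakk>finite D; \<And>k. k \<in> D \<Longrightarrow> a \<le> p k \<and> p k < q k \<and> q k \<le> b;
       \<And>k l. \<lbrakk>k \<in> D; l \<in> D; k \<noteq> l\<rbrakk> \<Longrightarrow> {p k<..<q k} \<inter> {p l<..<q l} = {};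
       (\<Sum>k\<in>D. q k - p k) < \<delta>\<rbrakk> \<Longrightarrow> (\<Sum>k\<in>D. norm (c (q k) - c (p k))) < e / 2"
      by (rule absolutely_continuous_pathE_indexed[OF ac \<open>e / 2 > 0\<close>]) blast
    obtain G where G: "open G" "N \<subseteq> G" "emeasure lebesgue (G - N) < ennreal \<delta>"
      using sets_lebesgue_outer_open[of N \<delta>] N_null \<open>\<delta> > 0\<close> by blast
    have "emeasure lebesgue G = emeasure lebesgue (G - N)"
      using G(1) N_null by (intro emeasure_Diff_null_set[symmetric]) auto
    then have mG: "emeasure lebesgue G < ennreal \<delta>" using G(3) by simp
    have "\<exists>d>0. \<forall>y. \<bar>y - t\<bar> < d \<longrightarrow> norm (c y - c t - (y - t) *\<^sub>R g t) \<le> \<eta> * \<bar>y - t\<bar>"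
      if "t \<in> {a..b}" "t \<notin> N" for t
      using deriv[OF that] \<open>\<eta> > 0\<close>
      unfolding has_vector_derivative_def has_derivative_at_alt by (auto simp: real_norm_def)
    then obtain d where d: "\<And>t. \<lbrakk>t \<in> {a..b}; t \<notin> N\<rbrakk> \<Longrightarrow> d t > 0"
      "\<And>t y. \<lbrakk>t \<in> {a..b}; t \<notin> N; \<bar>y - t\<bar> < d t\<rbrakk>
        \<Longrightarrow> norm (c y - c t - (y - t) *\<^sub>R g t) \<le> \<eta> * \<bar>y - t\<bar>"
      by metis
    define \<gamma> where "\<gamma> = (\<lambda>t. if t \<in> N then G else if t \<in> {a..b} then ball t (d t) else ball t 1)"
    have "gauge \<gamma>"
      unfolding gauge_def \<gamma>_def using G d(1) by auto
    moreover have "norm ((\<Sum>(x, k)\<in>p. measure lborel k *\<^sub>R g x) - (c b - c a)) < e"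
      if p: "p tagged_division_of {a..b}" and fine: "\<gamma> fine p" for p
    proof -
      have fin: "finite p" using p by auto
      have k: "k = {Inf k..Sup k}" "Inf k \<le> x" "x \<le> Sup k" "a \<le> Inf k" "Sup k \<le> b" "k \<subseteq> \<gamma> x"
        if xk: "(x, k) \<in> p" for x k
      proof -
        obtain u v where uv: "k = cbox u v" using tagged_division_ofD(4)[OF p xk] by blast
        have "x \<in> k" "k \<subseteq> {a..b}" using tagged_division_ofD(2,3)[OF p xk] by auto
        with uv show "k = {Inf k..Sup k}" "Inf k \<le> x" "x \<le> Sup k" "a \<le> Inf k" "Sup k \<le> b"
          by auto
        show "k \<subseteq> \<gamma> x" by (rule fineD[OF fine xk])
      qed
      define P where "P = {i \<in> p. fst i \<in> N \<and> Inf (snd i) < Sup (snd i)}"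
      have "finite P" using fin by (simp add: P_def)
      define v where "v = (\<lambda>k::real set. norm (c (Sup k) - c (Inf k)))"
      have "(\<Sum>i\<in>P. v (snd i)) < e / 2"
        unfolding v_def
      proof (rule \<delta>[OF \<open>finite P\<close>])
        show "a \<le> Inf (snd i) \<and> Inf (snd i) < Sup (snd i) \<and> Sup (snd i) \<le> b" if "i \<in> P" for i
          using k[of "fst i" "snd i"] that by (simp add: P_def)
        show disj: "{Inf (snd i)<..<Sup (snd i)} \<inter> {Inf (snd j)<..<Sup (snd j)} = {}"
          if ij: "i \<in> P" "j \<in> P" "i \<noteq> j" for i j
        proof -
          have i: "(fst i, snd i) \<in> p" "(fst j, snd j) \<in> p" using ij by (auto simp: P_def)
          have "interior (snd i) \<inter> interior (snd j) = {}"
            by (rule tagged_division_ofD(5)[OF p i]) (use ij(3) in \<open>simp add: prod_eq_iff\<close>)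
          moreover have "interior (snd i) = {Inf (snd i)<..<Sup (snd i)}"
            by (subst k(1)[OF i(1)]) (rule interior_atLeastAtMost_real)
          moreover have "interior (snd j) = {Inf (snd j)<..<Sup (snd j)}"
            by (subst k(1)[OF i(2)]) (rule interior_atLeastAtMost_real)
          ultimately show ?thesis by simp
        qed
        have "ennreal (\<Sum>i\<in>P. Sup (snd i) - Inf (snd i)) = (\<Sum>i\<in>P. ennreal (Sup (snd i) - Inf (snd i)))"
          by (subst sum_ennreal) (auto simp: P_def)
        also have "\<dots> = (\<Sum>i\<in>P. emeasure lebesgue {Inf (snd i)<..<Sup (snd i)})"
          by (rule sum.cong) (auto simp: P_def)
        also have "\<dots> = emeasure lebesgue (\<Union>i\<in>P. {Inf (snd i)<..<Sup (snd i)})"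
          by (rule sum_emeasure) (use disj \<open>finite P\<close> in \<open>auto simp: disjoint_family_on_def\<close>)
        also have "\<dots> \<le> emeasure lebesgue G"
        proof (rule emeasure_mono)
          show "(\<Union>i\<in>P. {Inf (snd i)<..<Sup (snd i)}) \<subseteq> G"
          proof (rule UN_least)
            fix i assume "i \<in> P"
            then have i: "(fst i, snd i) \<in> p" "fst i \<in> N" by (auto simp: P_def)
            have "{Inf (snd i)<..<Sup (snd i)} \<subseteq> {Inf (snd i)..Sup (snd i)}" by auto
            also have "\<dots> = snd i" by (rule k(1)[OF i(1), symmetric])
            also have "\<dots> \<subseteq> G" using k(6)[OF i(1)] i(2) by (simp add: \<gamma>_def)
            finally show "{Inf (snd i)<..<Sup (snd i)} \<subseteq> G" .
          qed
          show "G \<in> sets lebesgue" using G(1) by auto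
        qed
        also note mG
        finally show "(\<Sum>i\<in>P. Sup (snd i) - Inf (snd i)) < \<delta>"
          by (metis ennreal_leI leD not_le)
      qed
      then have sumP: "(\<Sum>i\<in>p. if i \<in> P then v (snd i) else 0) < e / 2"
        using fin sum.inter_filter[OF fin, of "\<lambda>i. v (snd i)" "\<lambda>i. i \<in> P"]
        by (simp add: P_def conj_ac cong: conj_cong)
      have "(\<Sum>(x, k)\<in>p. measure lborel k *\<^sub>R g x) - (c b - c a)
          = (\<Sum>(x, k)\<in>p. measure lborel k *\<^sub>R g x) - (\<Sum>(x, k)\<in>p. c (Sup k) - c (Inf k))"
        by (simp add: additive_tagged_division_1[OF ab p])
      also have "\<dots> = (\<Sum>i\<in>p. measure lborel (snd i) *\<^sub>R g (fst i) - (c (Sup (snd i)) - c (Inf (snd i))))"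
        by (simp add: sum_subtractf case_prod_beta)
      also have "norm \<dots> \<le> (\<Sum>i\<in>p. \<eta> * measure lborel (snd i) + (if i \<in> P then v (snd i) else 0))"
      proof (rule sum_norm_le)
        fix i assume "i \<in> p"
        then have i: "(fst i, snd i) \<in> p" by simp
        define x u w where "x = fst i" "u = Inf (snd i)" "w = Sup (snd i)"
        have kk: "u \<le> x" "x \<le> w" "a \<le> u" "w \<le> b" "snd i = {u..w}"
          unfolding x_u_w_def by (rule k(2)[OF i] k(3)[OF i] k(4)[OF i] k(5)[OF i] k(1)[OF i])+
        have ct: "measure lborel (snd i) = w - u" using kk by simp
        show "norm (measure lborel (snd i) *\<^sub>R g (fst i) - (c (Sup (snd i)) - c (Inf (snd i))))
            \<le> \<eta> * measure lborel (snd i) + (if i \<in> P then v (snd i) else 0)"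
        proof (cases "x \<in> N")
          case True
          then have "g x = 0" by (simp add: g_def)
          moreover have "v (snd i) = 0" if "i \<notin> P"
          proof -
            have "\<not> u < w" using that True \<open>i \<in> p\<close> unfolding P_def x_u_w_def by simp
            with kk(1,2) have "u = w" by linarith
            then show ?thesis unfolding v_def x_u_w_def[symmetric] by simp
          qed
          ultimately show ?thesis
            using \<open>\<eta> > 0\<close> kk(1,2) unfolding ct v_def x_u_w_def[symmetric]
            by (auto simp: norm_minus_commute)
        next
          case False
          have xab: "x \<in> {a..b}" using kk by simp
          have "{u..w} \<subseteq> ball x (d x)"
            using k(6)[OF i] False xab unfolding x_u_w_def(1)[symmetric] kk(5) \<gamma>_def by simp
          moreover have "u \<in> {u..w}" "w \<in> {u..w}" using kk(1,2) by auto
          ultimately have "u \<in> ball x (d x)" "w \<in> ball x (d x)" by blast+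
          then have "\<bar>u - x\<bar> < d x" "\<bar>w - x\<bar> < d x" by (auto simp: dist_real_def)
          then have n: "norm (c u - c x - (u - x) *\<^sub>R g x) \<le> \<eta> * \<bar>u - x\<bar>"
            "norm (c w - c x - (w - x) *\<^sub>R g x) \<le> \<eta> * \<bar>w - x\<bar>"
            using d(2)[OF xab False] by auto
          have eq: "(w - u) *\<^sub>R g x - (c w - c u)
              = (c u - c x - (u - x) *\<^sub>R g x) - (c w - c x - (w - x) *\<^sub>R g x)"
            by (simp add: algebra_simps)
          have "norm ((w - u) *\<^sub>R g x - (c w - c u)) \<le> \<eta> * \<bar>u - x\<bar> + \<eta> * \<bar>w - x\<bar>"
            unfolding eq by (rule order_trans[OF norm_triangle_ineq4 add_mono[OF n]])
          also have "\<dots> = \<eta> * (w - u)"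
            using kk by (simp add: algebra_simps)
          finally show ?thesis
            unfolding ct x_u_w_def[symmetric] by (rule order_trans) (simp add: v_def)
        qed
      qed
      also have "\<dots> = \<eta> * (\<Sum>i\<in>p. measure lborel (snd i)) + (\<Sum>i\<in>p. if i \<in> P then v (snd i) else 0)"
        by (simp add: sum.distrib sum_distrib_left)
      also have "(\<Sum>i\<in>p. measure lborel (snd i)) = b - a"
        using additive_content_tagged_division[of p a b] p ab by (simp add: case_prod_beta)
      finally show ?thesis
        using \<eta> sumP by linarith
    qed
    ultimately show "\<exists>\<gamma>. gauge \<gamma> \<and> (\<forall>p. p tagged_division_of {a..b} \<and> \<gamma> fine p
        \<longrightarrow> norm ((\<Sum>(x, k)\<in>p. measure lborel k *\<^sub>R g x) - (c b - c a)) < e)"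
      by (intro exI[of _ \<gamma>] conjI allI impI) simp_all
  qed
  then show ?thesis
    by (rule has_integral_spike[OF N, rotated]) (simp add: g_def)
qed

lemma velocity_subinterval_has_integral:
  assumes ac: "absolutely_continuous_path a b c" and "a \<le> s" "s \<le> t" "t \<le> b"
  shows "(velocity a b c has_integral (c t - c s)) {s..t}"
proof -
  have "absolutely_continuous_path s t c"
    by (rule absolutely_continuous_path_subinterval[OF ac]) (use assms in auto)
  from velocity_has_integral[OF this \<open>s \<le> t\<close>]
  have "(velocity s t c has_integral (c t - c s)) (cbox s t)" by simp
  then have "(velocity a b c has_integral (c t - c s)) (cbox s t)"
  proof (rule has_integral_spike_interior)
    fix x assume "x \<in> box s t"
    then have "x \<in> {s<..<t}" "x \<in> {a<..<b}" using assms by auto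
    then show "velocity a b c x = velocity s t c x"
      by (simp only: velocity_interior)
  qed
  then show ?thesis by simp
qed

text \<open>The integral of the velocity over a subinterval is the increment of the path, whose
  bounded variation upgrades integrability to absolute integrability.\<close>

lemma velocity_absolutely_integrable:
  assumes ac: "absolutely_continuous_path a b c" and ab: "a \<le> b"
  shows "velocity a b c absolutely_integrable_on {a..b}"
proof -
  obtain B where B: "\<And>D. \<lbrakk>D division_of \<Union>D; \<Union>D \<subseteq> {a..b}\<rbrakk> \<Longrightarrow> (\<Sum>k\<in>D. norm (c (Sup k) - c (Inf k))) \<le> B"
    by (rule absolutely_continuous_path_bounded_variation[OF ac ab]) blast
  have "velocity a b c absolutely_integrable_on cbox a b"
  proof (rule bounded_variation_absolutely_integrable_interval)
    show "velocity a b c integrable_on cbox a b"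
      using velocity_has_integral[OF ac ab] by (auto simp: integrable_on_def)
    fix D assume "D division_of cbox a b"
    note div = this
    from division_ofD(6)[OF div] have eq: "\<Union>D = {a..b}" by simp
    with div have D: "D division_of \<Union>D" "\<Union>D \<subseteq> {a..b}" by simp_all
    have "(\<Sum>K\<in>D. norm (integral K (velocity a b c))) = (\<Sum>k\<in>D. norm (c (Sup k) - c (Inf k)))"
    proof (rule sum.cong[OF refl])
      fix k assume k: "k \<in> D"
      have "integral {Inf k..Sup k} (velocity a b c) = c (Sup k) - c (Inf k)"
        by (rule integral_unique, rule velocity_subinterval_has_integral[OF ac])
          (use division_of_Inf_Sup_bounds[OF D k] in auto)
      then show "norm (integral k (velocity a b c)) = norm (c (Sup k) - c (Inf k))"
        using division_of_Icc(1)[OF D(1) k] by simp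
    qed
    also have "\<dots> \<le> B" by (rule B[OF D])
    finally show "(\<Sum>K\<in>D. norm (integral K (velocity a b c))) \<le> B" .
  qed
  then show ?thesis by simp
qed

lemma velocity_measurable:
  assumes "absolutely_continuous_path a b c"
  shows "velocity a b c \<in> borel_measurable (lebesgue_on {a..b})"
proof (cases "a \<le> b")
  case True
  then have "velocity a b c integrable_on {a..b}"
    using velocity_has_integral[OF assms] by (auto simp: integrable_on_def)
  then show ?thesis by (rule integrable_imp_measurable)
next
  case False
  then have "{a..b} = {}" by simp
  then show ?thesis by (simp add: measurable_def space_restrict_space)
qed

text \<open>The chord is at most the arc; this is the source of the lower bounds for the
  distance.\<close>

lemma norm_diff_le_nn_integral_velocity:
  assumes ac: "absolutely_continuous_path a b c" and ab: "a \<le> b"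
  shows "ennreal (norm (c b - c a)) \<le> (\<integral>\<^sup>+t\<in>{a..b}. ennreal (norm (velocity a b c t)) \<partial>lebesgue)"
proof -
  let ?f = "\<lambda>t. indicat_real {a..b} t *\<^sub>R velocity a b c t"
  have int: "integrable lebesgue ?f"
    using velocity_absolutely_integrable[OF ac ab] by (simp add: set_integrable_def)
  have "c b - c a = integral {a..b} (velocity a b c)"
    using velocity_has_integral[OF ac ab] by (simp add: integral_unique)
  also have "\<dots> = (LINT t|lebesgue. ?f t)"
    using set_lebesgue_integral_eq_integral(2)[OF velocity_absolutely_integrable[OF ac ab]]
    by (simp add: set_lebesgue_integral_def)
  finally have "ennreal (norm (c b - c a)) = ennreal (norm (LINT t|lebesgue. ?f t))" by simp
  also have "\<dots> \<le> ennreal (LINT t|lebesgue. norm (?f t))"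
    by (intro ennreal_leI integral_norm_bound)
  also have "\<dots> = (\<integral>\<^sup>+t. ennreal (norm (?f t)) \<partial>lebesgue)"
    by (rule nn_integral_eq_integral[OF integrable_norm[OF int], symmetric]) (rule AE_I2, rule norm_ge_zero)
  also have "\<dots> = (\<integral>\<^sup>+t\<in>{a..b}. ennreal (norm (velocity a b c t)) \<partial>lebesgue)"
    by (rule nn_integral_cong) (auto simp: indicator_def)
  finally show ?thesis .
qed

section \<open>Integral functionals of paths\<close>

lemma AE_lebesgue_off_finite:
  fixes S :: "real set"
  assumes "finite S"
  shows "AE t in lebesgue. t \<notin> S"
proof -
  have "S \<in> null_sets lebesgue"
    using negligible_finite[OF assms] by (simp add: negligible_iff_null_sets)
  then show ?thesis by (rule AE_not_in)
qed

lemma absolutely_continuous_path_AE_differentiable: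
  assumes "absolutely_continuous_path a b c"
  shows "AE t in lebesgue. t \<in> {a<..<b} \<longrightarrow> c differentiable (at t)"
proof -
  have "AE t in lebesgue. t \<notin> {t \<in> {a<..<b}. \<not> c differentiable (at t)}"
    using absolutely_continuous_path_differentiable[OF assms]
    by (intro AE_not_in) (simp add: negligible_iff_null_sets)
  then show ?thesis by eventually_elim auto
qed

lemma vector_derivative_cong_open:
  assumes "open S" "t \<in> S" "\<And>s. s \<in> S \<Longrightarrow> c s = c' s"
  shows "vector_derivative c (at t) = vector_derivative c' (at t)"
proof -
  have "\<forall>\<^sub>F s in nhds t. c s = c' s"
    using assms eventually_nhds by blast
  then show ?thesis
    by (intro vector_derivative_cong_eq) (auto simp: assms eventually_nhds_conv_at)
qed

text \<open>Covers length and action together: both integrate a Borel function of position and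
  velocity.\<close>

locale path_functional =
  fixes \<Phi> :: "'a::euclidean_space \<Rightarrow> 'a \<Rightarrow> ennreal"
  assumes meas: "(\<lambda>p. \<Phi> (fst p) (snd p)) \<in> borel_measurable borel"
begin

definition functional :: "real \<Rightarrow> real \<Rightarrow> (real \<Rightarrow> 'a) \<Rightarrow> ennreal" where
  "functional a b c = (\<integral>\<^sup>+t\<in>{a..b}. \<Phi> (c t) (velocity a b c t) \<partial>lebesgue)"

text \<open>On the open interval \<open>velocity\<close> is the ordinary derivative, which does not
  depend on the end points; integrals over different intervals can then be compared.\<close>

lemma functional_interior:
  "functional a b c = (\<integral>\<^sup>+t\<in>{a<..<b}. \<Phi> (c t) (vector_derivative c (at t)) \<partial>lebesgue)"
  unfolding functional_def
proof (rule nn_integral_cong_AE)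
  show "AE t in lebesgue. \<Phi> (c t) (velocity a b c t) * indicator {a..b} t
      = \<Phi> (c t) (vector_derivative c (at t)) * indicator {a<..<b} t"
    using AE_lebesgue_off_finite[of "{a, b}", OF finite.insertI[OF finite.insertI[OF finite.emptyI]]]
    by eventually_elim (auto simp: indicator_def velocity_interior)
qed

lemma functional_measurable:
  assumes ac: "absolutely_continuous_path a b c"
  shows "(\<lambda>t. \<Phi> (c t) (vector_derivative c (at t)) * indicator {a<..<b} t) \<in> borel_measurable lebesgue"
proof -
  have ac': "(\<lambda>t. (c t, velocity a b c t)) \<in> borel_measurable (lebesgue_on {a..b})"
    by (intro borel_measurable_Pair velocity_measurable[OF ac] continuous_imp_measurable_on_sets_lebesgue
        absolutely_continuous_path_imp_continuous[OF ac]) auto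
  have "(\<lambda>t. \<Phi> (c t) (velocity a b c t)) \<in> borel_measurable (lebesgue_on {a..b})"
    using measurable_compose[OF ac' meas] by simp
  then have "(\<lambda>t. \<Phi> (c t) (velocity a b c t)) \<in> borel_measurable (lebesgue_on {a<..<b})"
    by (rule measurable_restrict_mono) auto
  moreover have "\<Phi> (c t) (velocity a b c t) = \<Phi> (c t) (vector_derivative c (at t))"
    if "t \<in> space (lebesgue_on {a<..<b})" for t
    using that by (simp add: velocity_interior)
  ultimately have "(\<lambda>t. \<Phi> (c t) (vector_derivative c (at t))) \<in> borel_measurable (lebesgue_on {a<..<b})"
    by (rule measurable_cong[THEN iffD1, rotated])
  then show ?thesis
    by (subst (asm) borel_measurable_restrict_space_iff_ennreal) auto
qed

lemma functional_cong:
  assumes "\<And>t. a < t \<Longrightarrow> t < b \<Longrightarrow> c t = c' t"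
  shows "functional a b c = functional a b c'"
  unfolding functional_interior
proof (rule nn_integral_cong)
  fix t
  show "\<Phi> (c t) (vector_derivative c (at t)) * indicator {a<..<b} t =
         \<Phi> (c' t) (vector_derivative c' (at t)) * indicator {a<..<b} t"
    using vector_derivative_cong_open[of "{a<..<b}" t c c'] assms
    by (auto simp: indicator_def)
qed

lemma functional_split:
  assumes ac: "absolutely_continuous_path a b c" and "a \<le> s" "s \<le> b"
  shows "functional a b c = functional a s c + functional s b c"
proof -
  let ?F = "\<lambda>t. \<Phi> (c t) (vector_derivative c (at t))"
  have ac': "absolutely_continuous_path a s c" "absolutely_continuous_path s b c"
    using assms by (auto intro: absolutely_continuous_path_subinterval)
  have "functional a b c = (\<integral>\<^sup>+t. (?F t * indicator {a<..<s} t + ?F t * indicator {s<..<b} t) \<partial>lebesgue)"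
    unfolding functional_interior
  proof (rule nn_integral_cong_AE)
    show "AE t in lebesgue. ?F t * indicator {a<..<b} t = ?F t * indicator {a<..<s} t + ?F t * indicator {s<..<b} t"
      using AE_lebesgue_off_finite[of "{s}", OF finite.insertI[OF finite.emptyI]]
      by eventually_elim (use assms in \<open>auto simp: indicator_def\<close>)
  qed
  also have "\<dots> = functional a s c + functional s b c"
    unfolding functional_interior
    by (intro nn_integral_add functional_measurable ac')
  finally show ?thesis .
qed

lemma functional_subinterval_le:
  assumes ac: "absolutely_continuous_path a b c" and "a \<le> s" "s \<le> t" "t \<le> b"
  shows "functional s t c \<le> functional a b c"
proof -
  have "functional a b c = functional a s c + functional s b c"
    by (rule functional_split[OF ac]) (use assms in auto)
  moreover have "functional s b c = functional s t c + functional t b c"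
    by (rule functional_split) (use assms in \<open>auto intro: absolutely_continuous_path_subinterval\<close>)
  ultimately show ?thesis by (simp add: add_increasing add_increasing2)
qed

lemma functional_join:
  assumes "absolutely_continuous_path a m c1" "absolutely_continuous_path m b c2" "c1 m = c2 m"
    and "a \<le> m" "m \<le> b"
  defines "c \<equiv> \<lambda>t. if t \<le> m then c1 t else c2 t"
  shows "absolutely_continuous_path a b c" "functional a b c = functional a m c1 + functional m b c2"
proof -
  have "absolutely_continuous_path a m c"
    by (rule absolutely_continuous_path_cong[OF assms(1)]) (simp add: c_def)
  moreover have "absolutely_continuous_path m b c"
    by (rule absolutely_continuous_path_cong[OF assms(2)]) (use assms(3) in \<open>auto simp: c_def\<close>)
  ultimately show ac: "absolutely_continuous_path a b c"
    by (rule absolutely_continuous_path_join) fact+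
  show "functional a b c = functional a m c1 + functional m b c2"
    unfolding functional_split[OF ac \<open>a \<le> m\<close> \<open>m \<le> b\<close>]
    by (intro arg_cong2[where f = "(+)"] functional_cong) (auto simp: c_def)
qed

lemma functional_affine:
  assumes ac: "absolutely_continuous_path a b c" and "m \<noteq> 0"
    and maps: "\<And>t. t \<in> {a'<..<b'} \<longleftrightarrow> m * t + z \<in> {a<..<b}"
    and ac': "absolutely_continuous_path a' b' (\<lambda>t. c (m * t + z))"
  shows "ennreal \<bar>m\<bar> * functional a' b' (\<lambda>t. c (m * t + z))
    = (\<integral>\<^sup>+t\<in>{a<..<b}. \<Phi> (c t) (m *\<^sub>R vector_derivative c (at t)) \<partial>lebesgue)"
proof -
  let ?G = "\<lambda>t. \<Phi> (c t) (m *\<^sub>R vector_derivative c (at t)) * indicator {a<..<b} t"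
  \<comment> \<open>The integrand with rescaled velocity is again of the form covered by the locale,
    which supplies its measurability along c.\<close>
  have "(\<lambda>p. \<Phi> (fst p) (m *\<^sub>R snd p)) \<in> borel_measurable borel"
    using measurable_compose[of "\<lambda>p. (fst p, m *\<^sub>R snd p)" borel borel, OF _ meas]
    by (simp add: borel_measurable_continuous_onI continuous_intros)
  then interpret scaled: path_functional "\<lambda>q v. \<Phi> q (m *\<^sub>R v)" by unfold_locales
  have "(\<integral>\<^sup>+t. ?G t \<partial>lebesgue) = ennreal \<bar>m\<bar> * (\<integral>\<^sup>+t. ?G (z + m * t) \<partial>lebesgue)"
    by (rule nn_integral_real_affine_lebesgue[OF scaled.functional_measurable[OF ac] \<open>m \<noteq> 0\<close>])
  also have "(\<integral>\<^sup>+t. ?G (z + m * t) \<partial>lebesgue) = functional a' b' (\<lambda>t. c (m * t + z))"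
    unfolding functional_interior
  proof (rule nn_integral_cong_AE)
    show "AE t in lebesgue. ?G (z + m * t) = \<Phi> (c (m * t + z))
        (vector_derivative (\<lambda>t. c (m * t + z)) (at t)) * indicator {a'<..<b'} t"
      using absolutely_continuous_path_AE_differentiable[OF ac']
    proof eventually_elim
      case (elim t)
      show ?case
      proof (cases "t \<in> {a'<..<b'}")
        case True
        define f where "f = (\<lambda>t. c (m * t + z))"
        define w where "w = vector_derivative f (at t)"
        have der: "(f has_vector_derivative w) (at t)"
          using elim True by (simp add: f_def w_def vector_derivative_works)
        \<comment> \<open>The chain rule is applied to the inverse time change: the composed path is
          known to be differentiable at almost every t, so the exceptional set already lives in the
          right time variable.\<close>
        have "((\<lambda>s. (s - z) / m) has_vector_derivative (1 / m)) (at (m * t + z))"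
          unfolding has_real_derivative_iff_has_vector_derivative[symmetric]
          using \<open>m \<noteq> 0\<close> by (auto intro!: derivative_eq_intros)
        from vector_diff_chain_at[OF this, of f w] der \<open>m \<noteq> 0\<close>
        have "(f \<circ> (\<lambda>s. (s - z) / m) has_vector_derivative (1 / m) *\<^sub>R w) (at (m * t + z))"
          by simp
        moreover have "f \<circ> (\<lambda>s. (s - z) / m) = c"
          using \<open>m \<noteq> 0\<close> by (auto simp: f_def)
        ultimately have "vector_derivative c (at (m * t + z)) = (1 / m) *\<^sub>R w"
          by (simp add: vector_derivative_at)
        then have "m *\<^sub>R vector_derivative c (at (m * t + z)) = w"
          using \<open>m \<noteq> 0\<close> by simp
        then show ?thesis
          using True maps[of t] by (simp add: f_def w_def add.commute)
      next
        case False
        then have "z + m * t \<notin> {a<..<b}"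
          unfolding add.commute[of z "m * t"] using maps[of t] by blast
        then show ?thesis
          unfolding indicator_simps(2)[OF False] indicator_simps(2)[OF \<open>z + m * t \<notin> {a<..<b}\<close>] by simp
      qed
    qed
  qed
  finally show ?thesis by simp
qed

lemma functional_affine':
  assumes ac: "absolutely_continuous_path a b c" and "m \<noteq> 0"
    and maps: "\<And>t. t \<in> {a'<..<b'} \<longleftrightarrow> m * t + z \<in> {a<..<b}"
      "\<And>t. t \<in> {a'..b'} \<Longrightarrow> m * t + z \<in> {a..b}"
  shows "absolutely_continuous_path a' b' (\<lambda>t. c (m * t + z))"
    and "ennreal \<bar>m\<bar> * functional a' b' (\<lambda>t. c (m * t + z))
    = (\<integral>\<^sup>+t\<in>{a<..<b}. \<Phi> (c t) (m *\<^sub>R vector_derivative c (at t)) \<partial>lebesgue)"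
proof -
  show ac': "absolutely_continuous_path a' b' (\<lambda>t. c (m * t + z))"
    by (rule absolutely_continuous_path_affine[OF ac \<open>m \<noteq> 0\<close>]) (use maps(2) in auto)
  show "ennreal \<bar>m\<bar> * functional a' b' (\<lambda>t. c (m * t + z))
    = (\<integral>\<^sup>+t\<in>{a<..<b}. \<Phi> (c t) (m *\<^sub>R vector_derivative c (at t)) \<partial>lebesgue)"
    by (rule functional_affine[OF ac \<open>m \<noteq> 0\<close> maps(1) ac'])
qed

lemma functional_translate:
  assumes "absolutely_continuous_path a b c"
  shows "absolutely_continuous_path (a + z) (b + z) (\<lambda>t. c (t - z))"
    "functional (a + z) (b + z) (\<lambda>t. c (t - z)) = functional a b c"
  using functional_affine'[OF assms, of 1 "a + z" "b + z" "- z"]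
  by (simp_all add: functional_interior[of a b] less_diff_eq diff_less_eq le_diff_eq diff_le_eq add.commute)

end

section \<open>Homogeneous potentials and the Jacobi-Maupertuis distance\<close>

lemma le_ennreal_sqrt_iff:
  assumes "k \<ge> 0"
  shows "ennreal k \<le> ennreal_sqrt x \<longleftrightarrow> ennreal (k\<^sup>2) \<le> x"
proof (cases x)
  case (real r)
  then show ?thesis
    using assms by (simp add: ennreal_sqrt_def real_le_rsqrt real_le_lsqrt abs_le_square_iff[symmetric])
      (metis abs_of_nonneg real_sqrt_abs real_sqrt_le_iff)
next
  case top
  then show ?thesis by (simp add: ennreal_sqrt_def)
qed

lemma ennreal_sqrt_le_iff:
  assumes "k \<ge> 0"
  shows "ennreal_sqrt x \<le> ennreal k \<longleftrightarrow> x \<le> ennreal (k\<^sup>2)"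
proof (cases x)
  case (real r)
  then show ?thesis
    using assms by (simp add: ennreal_sqrt_def) (metis abs_of_nonneg real_sqrt_abs real_sqrt_le_iff)
next
  case top
  then show ?thesis by (simp add: ennreal_sqrt_def top_unique)
qed

lemma ennreal_sqrt_measurable [measurable]: "ennreal_sqrt \<in> borel_measurable borel"
  unfolding ennreal_sqrt_def by measurable

lemma e2ennreal_mult_ereal:
  assumes "a \<ge> 0" "y \<ge> 0"
  shows "e2ennreal (ereal a * y) = ennreal a * e2ennreal y"
proof -
  have "e2ennreal (ereal a * y) = e2ennreal (enn2ereal (ennreal a) * enn2ereal (e2ennreal y))"
    using assms by (simp add: enn2ereal_e2ennreal enn2ereal_ennreal)
  also have "\<dots> = ennreal a * e2ennreal y"
    unfolding times_ennreal.rep_eq[symmetric] by simp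
  finally show ?thesis .
qed

section \<open>Bounds on the potential from homogeneity\<close>

locale homogeneous_potential =
  fixes V :: "'a::euclidean_space \<Rightarrow> ereal" and \<alpha> :: real
  assumes \<alpha>_pos: "\<alpha> > 0" and potential: "potential V"
    and homogeneous: "homogeneous_of_degree (- \<alpha>) V"
    and smooth: "smooth_away_from_0 V"
begin

abbreviation U :: "'a \<Rightarrow> ennreal" where "U \<equiv> neg_potential V"

definition W :: "'a \<Rightarrow> ennreal" where "W q = ennreal_sqrt (2 * U q)"

definition \<beta> :: real where "\<beta> = 1 - \<alpha> / 2"

lemma U_continuous: "continuous_on UNIV U"
  unfolding neg_potential_def
  using potential
  by (auto simp: potential_def intro!: continuous_on_compose2[OF continuous_on_e2ennreal[of UNIV]]
      continuous_on_compose2[OF continuous_uminus_ereal[of UNIV]])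

lemma U_pos: "U q > 0"
proof -
  have "V q < 0" using potential by (simp add: potential_def)
  then have "- V q > 0" by (simp add: ereal_less_uminus_reorder)
  then show ?thesis
    unfolding neg_potential_def by (cases "V q") auto
qed

lemma U_homogeneous:
  assumes "r > 0" "q \<noteq> 0"
  shows "U (r *\<^sub>R q) = ennreal (r powr - \<alpha>) * U q"
proof -
  have "V q < 0" using potential by (simp add: potential_def)
  then have "0 \<le> - V q" by (simp add: less_imp_le)
  moreover have "- V (r *\<^sub>R q) = ereal (r powr - \<alpha>) * (- V q)"
    using homogeneous assms by (simp add: homogeneous_of_degree_def)
  ultimately show ?thesis
    unfolding neg_potential_def by (simp only: e2ennreal_mult_ereal powr_ge_zero)
qed

lemma U_finite: "q \<noteq> 0 \<Longrightarrow> U q < \<infinity>"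
  using smooth unfolding smooth_away_from_0_def neg_potential_def
  by (cases "V q") auto

lemma sphere_nonempty: "sphere (0::'a) 1 \<noteq> {}"
  by (metis sphere_eq_empty zero_neq_one not_one_less_zero)

text \<open>Compactness of the unit sphere, on which U is continuous, positive and finite;
  homogeneity carries the bounds to all nonzero points.\<close>

lemma U_bounds:
  obtains m M where "m > 0" "M > 0" "\<And>q. q \<noteq> 0 \<Longrightarrow> ennreal (m * norm q powr - \<alpha>) \<le> U q"
    "\<And>q. q \<noteq> 0 \<Longrightarrow> U q \<le> ennreal (M * norm q powr - \<alpha>)"
proof -
  have cont: "continuous_on (sphere 0 1) U"
    using U_continuous by (rule continuous_on_subset) auto
  obtain s where s: "s \<in> sphere 0 1" "\<And>q. q \<in> sphere 0 1 \<Longrightarrow> U s \<le> U q"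
    using continuous_attains_inf[OF compact_sphere sphere_nonempty cont] by blast
  obtain S where S: "S \<in> sphere 0 1" "\<And>q. q \<in> sphere 0 1 \<Longrightarrow> U q \<le> U S"
    using continuous_attains_sup[OF compact_sphere sphere_nonempty cont] by blast
  have ne: "s \<noteq> 0" "S \<noteq> 0" using s S by auto
  obtain m where m: "U s = ennreal m" "m \<ge> 0" using U_finite[OF ne(1)] by (cases "U s") auto
  obtain M where M: "U S = ennreal M" "M \<ge> 0" using U_finite[OF ne(2)] by (cases "U S") auto
  have "m > 0" "M > 0" using U_pos[of s] U_pos[of S] m M by auto
  have scaled: "U q = ennreal (norm q powr - \<alpha>) * U (q /\<^sub>R norm q)" "q /\<^sub>R norm q \<in> sphere 0 1"
    if "q \<noteq> 0" for q
    using U_homogeneous[of "norm q" "q /\<^sub>R norm q"] that by auto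
  show thesis
  proof (rule that[OF \<open>m > 0\<close> \<open>M > 0\<close>])
    fix q :: 'a assume "q \<noteq> 0"
    note sc = scaled[OF this]
    have "ennreal (norm q powr - \<alpha>) * ennreal m \<le> U q"
      unfolding sc(1) m(1)[symmetric] by (intro mult_left_mono s(2)[OF sc(2)]) simp
    then show "ennreal (m * norm q powr - \<alpha>) \<le> U q"
      using m(2) by (simp add: ennreal_mult mult.commute)
    have "U q \<le> ennreal (norm q powr - \<alpha>) * ennreal M"
      unfolding sc(1) M(1)[symmetric] by (intro mult_left_mono S(2)[OF sc(2)]) simp
    then show "U q \<le> ennreal (M * norm q powr - \<alpha>)"
      using M(2) by (simp add: ennreal_mult mult.commute)
  qed
qed

lemma powr_neg_antimono: "0 < x \<Longrightarrow> x \<le> y \<Longrightarrow> 0 \<le> a \<Longrightarrow> y powr - a \<le> x powr - (a::real)"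
  by (rule powr_mono2') auto

lemma U_large_near_0:
  obtains r where "r > 0" "\<And>q. norm q \<le> r \<Longrightarrow> ennreal K \<le> U q"
proof -
  obtain m where m: "m > 0" "\<And>q. q \<noteq> 0 \<Longrightarrow> ennreal (m * norm q powr - \<alpha>) \<le> U q"
    by (rule U_bounds) blast
  \<comment> \<open>Raising K to at least 1 keeps the following radius, the solution of
    \<open>m * r powr - \<alpha> = L\<close>, positive.\<close>
  define L where "L = max K 1"
  define r where "r = (L / m) powr (- 1 / \<alpha>)"
  have "r > 0" using m(1) by (simp add: r_def L_def)
  have rL: "m * r powr - \<alpha> = L"
    using m(1) \<alpha>_pos by (simp add: r_def powr_powr L_def)
  have ne0: "ennreal L \<le> U q" if "norm q \<le> r" "q \<noteq> 0" for q
  proof -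
    have "L \<le> m * norm q powr - \<alpha>"
      unfolding rL[symmetric] using m(1) that \<alpha>_pos
      by (intro mult_left_mono powr_neg_antimono) auto
    then show ?thesis using m(2)[OF that(2)] by (meson ennreal_leI order_trans)
  qed
  \<comment> \<open>Homogeneity is silent about the origin; the value there is reached by continuity
    of U.\<close>
  have "ennreal L \<le> U 0"
  proof (rule tendsto_lowerbound)
    show "(U \<longlongrightarrow> U 0) (at 0)"
      using U_continuous by (simp add: continuous_on_def)
    show "\<forall>\<^sub>F q in at 0. ennreal L \<le> U q"
      unfolding eventually_at using \<open>r > 0\<close> ne0 by (intro exI[of _ r]) (auto simp: dist_norm)
  qed simp
  with ne0 have "ennreal L \<le> U q" if "norm q \<le> r" for q
    using that by (cases "q = 0") auto
  moreover have "ennreal K \<le> ennreal L" by (rule ennreal_leI) (simp add: L_def)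
  ultimately show thesis
    using \<open>r > 0\<close> that order_trans by blast
qed

lemma U_0: "U 0 = \<infinity>"
proof (rule ccontr)
  assume "U 0 \<noteq> \<infinity>"
  then obtain x where x: "U 0 = ennreal x" "x \<ge> 0" by (cases "U 0") auto
  obtain r where "r > 0" "\<And>q. norm q \<le> r \<Longrightarrow> ennreal (x + 1) \<le> U q"
    by (rule U_large_near_0) blast
  from this(2)[of 0] this(1) x show False by simp
qed

lemma collision_point_iff: "collision_point V p \<longleftrightarrow> p = 0"
  using U_0 U_finite[of p] by (cases "p = 0") (auto simp: collision_point_def)

lemma W_bounds:
  obtains m M where "m > 0" "M > 0" "\<And>q. q \<noteq> 0 \<Longrightarrow> ennreal (m * norm q powr - (\<alpha> / 2)) \<le> W q"
    "\<And>q. q \<noteq> 0 \<Longrightarrow> W q \<le> ennreal (M * norm q powr - (\<alpha> / 2))"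
proof -
  obtain m M where m: "m > 0" "\<And>q. q \<noteq> 0 \<Longrightarrow> ennreal (m * norm q powr - \<alpha>) \<le> U q"
    and M: "M > 0" "\<And>q. q \<noteq> 0 \<Longrightarrow> U q \<le> ennreal (M * norm q powr - \<alpha>)"
    by (rule U_bounds) blast
  have sq: "(sqrt (2 * x) * y powr - (\<alpha> / 2))\<^sup>2 = 2 * (x * y powr - \<alpha>)" if "x > 0" for x y
    using that by (simp add: power_mult_distrib power2_eq_square[of "y powr _"] powr_add[symmetric])
  have 2: "2 * ennreal x = ennreal (2 * x)" for x
    by (simp add: ennreal_mult')
  show thesis
  proof (rule that)
    show "sqrt (2 * m) > 0" "sqrt (2 * M) > 0" using m M by auto
    fix q :: 'a assume q: "q \<noteq> 0"
    show "ennreal (sqrt (2 * m) * norm q powr - (\<alpha> / 2)) \<le> W q"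
      unfolding W_def
      by (subst le_ennreal_sqrt_iff)
        (use m q in \<open>auto simp: sq 2[symmetric] intro!: mult_left_mono\<close>)
    show "W q \<le> ennreal (sqrt (2 * M) * norm q powr - (\<alpha> / 2))"
      unfolding W_def
      by (subst ennreal_sqrt_le_iff)
        (use M q in \<open>auto simp: sq 2[symmetric] intro!: mult_left_mono\<close>)
  qed
qed

lemma W_0: "W 0 = \<infinity>"
  by (simp add: W_def U_0 ennreal_sqrt_def ennreal_mult_top)

lemma W_homogeneous:
  assumes "r > 0"
  shows "W (r *\<^sub>R q) = ennreal (r powr - (\<alpha> / 2)) * W q"
proof (cases "q = 0")
  case True
  then show ?thesis using assms by (simp add: W_0 ennreal_mult_top)
next
  case False
  then obtain u where u: "U q = ennreal u" "u \<ge> 0" using U_finite[of q] by (cases "U q") auto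
  have "sqrt (r powr - \<alpha>) = r powr - (\<alpha> / 2)"
    using assms by (simp add: powr_half_sqrt[symmetric] powr_powr)
  then show ?thesis
    using assms False u unfolding W_def U_homogeneous[OF assms False]
    by (simp add: ennreal_sqrt_def ennreal_mult[symmetric] real_sqrt_mult ennreal_mult_eq_top_iff
        mult_ac flip: ennreal_numeral)
qed

lemma W_measurable [measurable]: "W \<in> borel_measurable borel"
proof -
  have [measurable]: "U \<in> borel_measurable borel"
    by (rule borel_measurable_continuous_onI[OF U_continuous])
  show ?thesis unfolding W_def by measurable
qed

text \<open>Comparing \<open>k\<^sup>2\<close> with \<open>2 * U\<close> moves the question to U,
  whose continuity includes the origin, where the value is infinite.\<close>

lemma W_lower_semicontinuous:
  assumes "k \<ge> 0" "ennreal k < W x"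
  obtains \<rho> where "\<rho> > 0" "\<And>y. y \<in> cball x \<rho> \<Longrightarrow> ennreal k \<le> W y"
proof -
  have "\<not> W x \<le> ennreal k" using assms by simp
  then have "ennreal (k\<^sup>2) < 2 * U x"
    unfolding W_def using ennreal_sqrt_le_iff[OF assms(1)] by simp
  moreover have "continuous_on UNIV (\<lambda>y. 2 * U y)"
    unfolding mult_2 by (intro continuous_on_add U_continuous)
  then have "((\<lambda>y. 2 * U y) \<longlongrightarrow> 2 * U x) (at x)"
    by (simp add: continuous_on_def)
  ultimately have "\<forall>\<^sub>F y in at x. ennreal (k\<^sup>2) < 2 * U y"
    by (rule order_tendstoD(1)[rotated])
  then obtain d where d: "d > 0" "\<And>y. y \<noteq> x \<Longrightarrow> dist y x < d \<Longrightarrow> ennreal (k\<^sup>2) < 2 * U y"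
    unfolding eventually_at by auto
  show thesis
  proof (rule that[of "d / 2"])
    fix y assume "y \<in> cball x (d / 2)"
    then have "ennreal (k\<^sup>2) < 2 * U y"
      using d \<open>ennreal (k\<^sup>2) < 2 * U x\<close> by (cases "y = x") (auto simp: dist_commute)
    then show "ennreal k \<le> W y"
      unfolding W_def le_ennreal_sqrt_iff[OF assms(1)] by simp
  qed (use d in simp)
qed

sublocale jm: path_functional "\<lambda>q v. W q * ennreal (norm v)"
proof
  show "(\<lambda>p. W (fst p) * ennreal (norm (snd p))) \<in> borel_measurable (borel :: ('a \<times> 'a) measure)"
    unfolding borel_prod[symmetric] by measurable
qed

sublocale lag: path_functional "lagrangian V"
proof
  have [measurable]: "U \<in> borel_measurable borel"
    by (rule borel_measurable_continuous_onI[OF U_continuous])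
  show "(\<lambda>p. lagrangian V (fst p) (snd p)) \<in> borel_measurable (borel :: ('a \<times> 'a) measure)"
    unfolding borel_prod[symmetric] lagrangian_def by measurable
qed

lemma jm_length_eq: "jm_length V a b c = jm.functional a b c"
  unfolding jm.functional_def jm_length_def by (simp only: W_def)

lemma action_eq: "action V a b c = lag.functional a b c"
  by (simp only: action_def lag.functional_def)

lemma jm_le_lagrangian: "W q * ennreal (norm v) \<le> lagrangian V q v"
proof (cases "q = 0")
  case True
  then show ?thesis by (simp add: lagrangian_def U_0)
next
  case False
  then obtain u where u: "U q = ennreal u" "u \<ge> 0" using U_finite[of q] by (cases "U q") auto
  have "sqrt (2 * u) * norm v \<le> (norm v)\<^sup>2 / 2 + u"
    using arith_geo_mean_sqrt[of "2 * u" "(norm v)\<^sup>2"] u by (simp add: real_sqrt_mult)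
  then show ?thesis
    unfolding lagrangian_def W_def u(1) using u(2)
    by (simp add: ennreal_sqrt_def ennreal_mult[symmetric] ennreal_mult_eq_top_iff
        flip: ennreal_numeral ennreal_plus)
qed

lemma jm_le_action: "jm.functional a b c \<le> lag.functional a b c"
  unfolding jm.functional_def lag.functional_def
  by (intro nn_integral_mono mult_right_mono jm_le_lagrangian) simp

end

section \<open>The Jacobi-Maupertuis distance and its lower bounds\<close>

context homogeneous_potential
begin

text \<open>The infimum runs over all parameter intervals, like the competitors in
  \<open>minimizing_jm_geodesic\<close>: a curve of finite length at most the distance of its end
  points is then minimizing.\<close>

definition D :: "'a \<Rightarrow> 'a \<Rightarrow> ennreal" where
  "D x y = (INF (a, b, \<sigma>)\<in>{(a, b, \<sigma>). a < b \<and> absolutely_continuous_path a b \<sigma> \<and> \<sigma> a = x \<and> \<sigma> b = y}.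
      jm.functional a b \<sigma>)"

lemma D_greatest:
  assumes "\<And>a b \<sigma>. \<lbrakk>a < b; absolutely_continuous_path a b \<sigma>; \<sigma> a = x; \<sigma> b = y\<rbrakk> \<Longrightarrow> k \<le> jm.functional a b \<sigma>"
  shows "k \<le> D x y"
  unfolding D_def using assms by (auto intro!: INF_greatest)

lemma D_le_functional:
  assumes "a < b" "absolutely_continuous_path a b \<sigma>"
  shows "D (\<sigma> a) (\<sigma> b) \<le> jm.functional a b \<sigma>"
  unfolding D_def by (rule INF_lower2[of "(a, b, \<sigma>)"]) (use assms in auto)

lemma D_approx:
  assumes "D x y < k"
  obtains a b \<sigma> where "a < b" "absolutely_continuous_path a b \<sigma>" "\<sigma> a = x" "\<sigma> b = y" "jm.functional a b \<sigma> < k"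
  using assms unfolding D_def INF_less_iff by auto

lemma D_refl: "D x x = 0"
proof -
  have "absolutely_continuous_path 0 1 (\<lambda>_. x)"
    by (rule absolutely_continuous_path_lipschitz[where K = 0]) simp
  from D_le_functional[OF zero_less_one this] show ?thesis
    by (simp add: jm.functional_interior)
qed

lemma D_le_subpath:
  assumes ac: "absolutely_continuous_path a b c" and "a \<le> s" "s \<le> t" "t \<le> b"
  shows "D (c s) (c t) \<le> jm.functional s t c"
proof (cases "s = t")
  case True
  then show ?thesis by (simp add: D_refl)
next
  case False
  then show ?thesis
    using assms by (intro D_le_functional) (auto intro: absolutely_continuous_path_subinterval[OF ac])
qed

lemma D_sym: "D x y = D y x"
proof -
  have "D y x \<le> D x y" for x y
  proof (rule D_greatest)
    fix a b \<sigma> assume *: "a < b" "absolutely_continuous_path a b \<sigma>" "\<sigma> a = x" "\<sigma> b = y"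
    note aff = jm.functional_affine'[OF *(2), of "-1" "-b" "-a" 0, simplified]
    have "absolutely_continuous_path (- b) (- a) (\<lambda>t. \<sigma> (- t))"
      by (rule aff(1)) auto
    from D_le_functional[OF _ this] *
    have "D y x \<le> jm.functional (- b) (- a) (\<lambda>t. \<sigma> (- t))" by simp
    also have "\<dots> = jm.functional a b \<sigma>"
      unfolding jm.functional_interior[of a b] by (rule aff(2)) auto
    finally show "D y x \<le> jm.functional a b \<sigma>" .
  qed
  then show ?thesis by (meson antisym)
qed

lemma D_triangle: "D x z \<le> D x y + D y z"
proof (rule ccontr)
  assume "\<not> ?thesis"
  then have less: "D x y + D y z < D x z" by simp
  then have fin: "D x y \<noteq> \<infinity>" "D y z \<noteq> \<infinity>" by auto
  \<comment> \<open>Each of the two nearly optimal paths may exceed its distance by less than e,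
    which is half of the room left below a real number under \<open>D x z\<close>.\<close>
  obtain e where e: "e > 0" "D x y + D y z + 2 * ennreal e < D x z"
  proof -
    obtain r where r: "D x y + D y z < r" "r < D x z" using less dense by blast
    then obtain s where s: "r = ennreal s" "s \<ge> 0" by (cases r) auto
    obtain p q where pq: "D x y = ennreal p" "p \<ge> 0" "D y z = ennreal q" "q \<ge> 0"
      using fin by (cases "D x y"; cases "D y z") auto
    have "p + q < s" using r(1) pq s by (simp add: ennreal_less_iff flip: ennreal_plus)
    moreover have "D x y + D y z + 2 * ennreal ((s - p - q) / 2) = ennreal s"
      using pq \<open>p + q < s\<close> by (simp add: field_simps flip: ennreal_plus ennreal_mult ennreal_numeral)
    ultimately show thesis
      using r(2) s(1) by (intro that[of "(s - p - q) / 2"]) auto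
  qed
  have "D x y < D x y + ennreal e"
    using fin e(1) by (cases "D x y") (auto simp: ennreal_less_iff simp flip: ennreal_plus)
  then obtain a b \<sigma> where 1: "a < b" "absolutely_continuous_path a b \<sigma>" "\<sigma> a = x" "\<sigma> b = y"
      "jm.functional a b \<sigma> < D x y + ennreal e"
    by (rule D_approx)
  have "D y z < D y z + ennreal e"
    using fin e(1) by (cases "D y z") (auto simp: ennreal_less_iff simp flip: ennreal_plus)
  then obtain a' b' \<tau> where 2: "a' < b'" "absolutely_continuous_path a' b' \<tau>" "\<tau> a' = y" "\<tau> b' = z"
      "jm.functional a' b' \<tau> < D y z + ennreal e"
    by (rule D_approx)
  define w where "w = b - a'"
  note tr = jm.functional_translate[OF 2(2), of w]
  have ab: "a' + w = b" "b \<le> b' + w" using 2(1) by (auto simp: w_def)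
  note tr' = tr[unfolded ab(1)]
  note jn = jm.functional_join[OF 1(2) tr'(1) _ less_imp_le[OF 1(1)] ab(2)]
  have eq: "\<sigma> b = \<tau> (b - w)" using 1 2 by (simp add: w_def)
  have "D x z \<le> jm.functional a (b' + w) (\<lambda>t. if t \<le> b then \<sigma> t else \<tau> (t - w))"
    using D_le_functional[OF _ jn(1)[OF eq]] 1 2 ab by (simp add: w_def)
  also have "\<dots> = jm.functional a b \<sigma> + jm.functional a' b' \<tau>"
    unfolding jn(2)[OF eq] tr'(2) ..
  also have "\<dots> \<le> (D x y + ennreal e) + (D y z + ennreal e)"
    using 1(5) 2(5) by (intro add_mono) auto
  also have "\<dots> = D x y + D y z + 2 * ennreal e"
    unfolding mult_2 by (simp only: add_ac)
  also note e(2)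
  finally show False by simp
qed

text \<open>Until the path first reaches distance r the density is at least k, and the chord up to
  then has length r. That time is returned so that the rest of the path can be estimated
  separately.\<close>

lemma functional_ge_exit:
  assumes ac: "absolutely_continuous_path a b \<sigma>" and "a \<le> b" and k: "k \<ge> 0" "0 \<le> r" "r \<le> norm (\<sigma> b - \<sigma> a)"
    and W: "\<And>y. y \<in> cball (\<sigma> a) r \<Longrightarrow> ennreal k \<le> W y"
  obtains s where "a \<le> s" "s \<le> b" "norm (\<sigma> s - \<sigma> a) = r" "ennreal (k * r) \<le> jm.functional a s \<sigma>"
proof -
  define S where "S = {s \<in> {a..b}. norm (\<sigma> s - \<sigma> a) = r}"
  have cont: "continuous_on {a..b} (\<lambda>s. norm (\<sigma> s - \<sigma> a))"
    by (intro continuous_intros absolutely_continuous_path_imp_continuous[OF ac])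
  have "\<exists>s\<ge>a. s \<le> b \<and> norm (\<sigma> s - \<sigma> a) = r"
    by (rule IVT') (use assms cont in auto)
  then have "S \<noteq> {}" by (auto simp: S_def)
  have "closed S"
    unfolding S_def by (rule continuous_closed_preimage_constant[OF cont]) simp
  then have cS: "compact S" using compact_Icc[of a b]
    by (metis (no_types, lifting) S_def bounded_closed_interval bounded_subset compact_eq_bounded_closed mem_Collect_eq subsetI)
  obtain s where s: "s \<in> S" "\<And>t. t \<in> S \<Longrightarrow> s \<le> t"
    using compact_attains_inf[OF cS \<open>S \<noteq> {}\<close>] by blast
  then have s': "a \<le> s" "s \<le> b" "norm (\<sigma> s - \<sigma> a) = r" by (auto simp: S_def)
  have inside: "norm (\<sigma> t - \<sigma> a) \<le> r" if t: "a \<le> t" "t \<le> s" for t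
  proof (rule ccontr)
    assume "\<not> ?thesis"
    then have gt: "r < norm (\<sigma> t - \<sigma> a)" by simp
    have "\<exists>u\<ge>a. u \<le> t \<and> norm (\<sigma> u - \<sigma> a) = r"
      by (rule IVT') (use gt \<open>0 \<le> r\<close> t s' in \<open>auto intro: continuous_on_subset[OF cont]\<close>)
    then obtain u where u: "a \<le> u" "u \<le> t" "norm (\<sigma> u - \<sigma> a) = r" by blast
    with t s' have "u \<in> S" by (simp add: S_def)
    with s(2) u t have "u = t" by force
    with u gt show False by simp
  qed
  have ac': "absolutely_continuous_path a s \<sigma>"
    using absolutely_continuous_path_subinterval[OF ac] s' by simp
  have "ennreal k * ennreal r \<le> ennreal k * (\<integral>\<^sup>+t\<in>{a..s}. ennreal (norm (velocity a s \<sigma> t)) \<partial>lebesgue)"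
    using norm_diff_le_nn_integral_velocity[OF ac' s'(1)] s'(3) by (intro mult_left_mono) auto
  also have "\<dots> = (\<integral>\<^sup>+t. ennreal k * (ennreal (norm (velocity a s \<sigma> t)) * indicator {a..s} t) \<partial>lebesgue)"
  proof (rule nn_integral_cmult[symmetric])
    have "(\<lambda>t. ennreal (norm (velocity a s \<sigma> t))) \<in> borel_measurable (lebesgue_on {a..s})"
      using velocity_measurable[OF ac'] by measurable
    then show "(\<lambda>t. ennreal (norm (velocity a s \<sigma> t)) * indicator {a..s} t) \<in> borel_measurable lebesgue"
      by (subst (asm) borel_measurable_restrict_space_iff_ennreal) auto
  qed
  also have "\<dots> \<le> jm.functional a s \<sigma>"
    unfolding jm.functional_def
  proof (rule nn_integral_mono)
    fix t
    show "ennreal k * (ennreal (norm (velocity a s \<sigma> t)) * indicator {a..s} t)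
      \<le> W (\<sigma> t) * ennreal (norm (velocity a s \<sigma> t)) * indicator {a..s} t"
    proof (cases "t \<in> {a..s}")
      case True
      then have "ennreal k \<le> W (\<sigma> t)"
        using inside[of t] by (intro W) (simp add: dist_norm norm_minus_commute[of "\<sigma> a"])
      with True show ?thesis by (auto intro!: mult_right_mono)
    qed simp
  qed
  finally show thesis
    using that[OF s'] k by (simp add: ennreal_mult)
qed

lemma D_ge:
  assumes k: "k \<ge> 0" "0 \<le> r" "r \<le> norm (y - x)" and W: "\<And>z. z \<in> cball x r \<Longrightarrow> ennreal k \<le> W z"
  shows "ennreal (k * r) \<le> D x y"
proof (rule D_greatest)
  fix a b \<sigma> assume *: "a < b" "absolutely_continuous_path a b \<sigma>" "\<sigma> a = x" "\<sigma> b = y"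
  obtain s where s: "a \<le> s" "s \<le> b" "ennreal (k * r) \<le> jm.functional a s \<sigma>"
    by (rule functional_ge_exit[OF *(2), of k r]) (use * k W in auto)
  note s(3)
  also have "jm.functional a s \<sigma> \<le> jm.functional a b \<sigma>"
    by (rule jm.functional_subinterval_le[OF *(2)]) (use s in auto)
  finally show "ennreal (k * r) \<le> jm.functional a b \<sigma>" .
qed

lemma W_ge_near:
  obtains m where "m > 0"
    "\<And>x z. \<lbrakk>x \<noteq> 0; z \<in> cball x (norm x / 2)\<rbrakk> \<Longrightarrow> ennreal (m * norm x powr - (\<alpha> / 2)) \<le> W z"
proof -
  obtain m where m: "m > 0" "\<And>q. q \<noteq> 0 \<Longrightarrow> ennreal (m * norm q powr - (\<alpha> / 2)) \<le> W q"
    by (rule W_bounds) blast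
  show thesis
  \<comment> \<open>Points of the ball have norm at most twice that of x, and the power is
    decreasing; hence the factor.\<close>
  proof (rule that[of "m * 2 powr - (\<alpha> / 2)"])
    show "m * 2 powr - (\<alpha> / 2) > 0" using m(1) by simp
    fix x z :: 'a assume x: "x \<noteq> 0" and z: "z \<in> cball x (norm x / 2)"
    have zn: "norm z \<le> 2 * norm x" "z \<noteq> 0"
      using z x norm_triangle_ineq2[of x z] norm_triangle_ineq2[of z x]
      by (auto simp: dist_norm norm_minus_commute)
    have "m * 2 powr - (\<alpha> / 2) * norm x powr - (\<alpha> / 2) = m * (2 * norm x) powr - (\<alpha> / 2)"
      by (simp add: powr_mult)
    also have "\<dots> \<le> m * norm z powr - (\<alpha> / 2)"
      using m(1) zn \<alpha>_pos by (intro mult_left_mono powr_neg_antimono) auto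
    finally show "ennreal (m * 2 powr - (\<alpha> / 2) * norm x powr - (\<alpha> / 2)) \<le> W z"
      using m(2)[OF zn(2)] by (meson ennreal_leI order_trans)
  qed
qed

lemma powr_\<beta>: "x > 0 \<Longrightarrow> x powr - (\<alpha> / 2) * x = x powr \<beta>"
  using powr_add[of x "- (\<alpha> / 2)" 1] by (simp add: \<beta>_def)

text \<open>The way to y has to leave the ball of radius \<open>norm x / 2\<close> about x, which
  costs this radius times the density bound of \<open>W_ge_near\<close>.\<close>

lemma D_ge_powr:
  obtains k where "k > 0" "\<And>x y. \<lbrakk>x \<noteq> 0; norm x / 2 \<le> norm (y - x)\<rbrakk> \<Longrightarrow> ennreal (k * norm x powr \<beta>) \<le> D x y"
proof -
  obtain m where m: "m > 0"
    "\<And>x z. \<lbrakk>x \<noteq> 0; z \<in> cball x (norm x / 2)\<rbrakk> \<Longrightarrow> ennreal (m * norm x powr - (\<alpha> / 2)) \<le> W z"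
    by (rule W_ge_near) blast
  show thesis
  proof (rule that[of "m / 2"])
    fix x y :: 'a assume x: "x \<noteq> 0" "norm x / 2 \<le> norm (y - x)"
    have "ennreal ((m * norm x powr - (\<alpha> / 2)) * (norm x / 2)) \<le> D x y"
      by (rule D_ge) (use m x in auto)
    moreover have eq: "(m * norm x powr - (\<alpha> / 2)) * (norm x / 2) = m / 2 * norm x powr \<beta>"
      using powr_\<beta>[of "norm x"] x(1) by simp
    ultimately show "ennreal (m / 2 * norm x powr \<beta>) \<le> D x y" unfolding eq by simp
  qed (use m in simp)
qed

lemma D_to_0_ge:
  obtains k where "k > 0" "\<And>x. ennreal (k * norm x powr \<beta>) \<le> D x 0"
proof -
  obtain k where k: "k > 0" "\<And>x y. \<lbrakk>x \<noteq> 0; norm x / 2 \<le> norm (y - x)\<rbrakk> \<Longrightarrow> ennreal (k * norm x powr \<beta>) \<le> D x y"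
    by (rule D_ge_powr) blast
  show thesis
  proof (rule that[OF k(1)])
    fix x
    show "ennreal (k * norm x powr \<beta>) \<le> D x 0"
      using k(2)[of x 0] by (cases "x = 0") auto
  qed
qed

text \<open>Each halving of the distance to the origin costs at least a fixed amount of length.\<close>

lemma D_to_0_infinite:
  assumes "\<beta> \<le> 0" "x \<noteq> 0"
  shows "D x 0 = \<infinity>"
proof -
  obtain m where m: "m > 0"
    "\<And>x z. \<lbrakk>x \<noteq> 0; z \<in> cball x (norm x / 2)\<rbrakk> \<Longrightarrow> ennreal (m * norm x powr - (\<alpha> / 2)) \<le> W z"
    by (rule W_ge_near) blast
  define k where "k = m / 2"
  have "ennreal (real n * (k * norm x powr \<beta>)) \<le> D x 0" if "x \<noteq> 0" for n and x :: 'a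
    using that
  proof (induction n arbitrary: x)
    case (Suc n)
    show ?case
    proof (rule D_greatest)
      fix a b \<sigma> assume *: "a < b" "absolutely_continuous_path a b \<sigma>" "\<sigma> a = x" "\<sigma> b = 0"
      obtain s where s: "a \<le> s" "s \<le> b" "norm (\<sigma> s - \<sigma> a) = norm x / 2"
         "ennreal ((m * norm x powr - (\<alpha> / 2)) * (norm x / 2)) \<le> jm.functional a s \<sigma>"
        by (rule functional_ge_exit[OF *(2), of "m * norm x powr - (\<alpha> / 2)" "norm x / 2"]) (use * m Suc.prems in auto)
      have first: "(m * norm x powr - (\<alpha> / 2)) * (norm x / 2) = k * norm x powr \<beta>"
        using powr_\<beta>[of "norm x"] Suc.prems by (simp add: k_def)
      \<comment> \<open>The exit point has norm at least \<open>norm x / 2\<close> and the path ends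
        at the origin, so it meets the sphere on which the induction hypothesis is applied.\<close>
      obtain u where u: "s \<le> u" "u \<le> b" "norm (\<sigma> u) = norm x / 2"
      proof -
        have "norm (\<sigma> s) \<ge> norm x / 2"
          using s(3) *(3) norm_triangle_ineq2[of x "\<sigma> s"] by (simp add: norm_minus_commute)
        moreover have "continuous_on {s..b} (\<lambda>t. norm (\<sigma> t))"
          using absolutely_continuous_path_imp_continuous[OF *(2)] s(1)
          by (intro continuous_intros) (auto intro: continuous_on_subset)
        ultimately have "\<exists>u\<ge>s. u \<le> b \<and> norm (\<sigma> u) = norm x / 2"
          using s(2) *(4) by (intro IVT2') auto
        then show thesis using that by blast
      qed
      \<comment> \<open>Here \<open>\<beta> \<le> 0\<close> enters: halving the norm does not make
        the cost smaller.\<close>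
      have "ennreal (real n * (k * norm x powr \<beta>)) \<le> ennreal (real n * (k * norm (\<sigma> u) powr \<beta>))"
      proof (intro ennreal_leI mult_left_mono)
        show "norm x powr \<beta> \<le> norm (\<sigma> u) powr \<beta>"
          unfolding u(3) using powr_neg_antimono[of "norm x / 2" "norm x" "- \<beta>"] \<open>\<beta> \<le> 0\<close> Suc.prems by simp
      qed (use m in \<open>auto simp: k_def\<close>)
      also have "\<dots> \<le> D (\<sigma> u) 0"
        by (rule Suc.IH) (use u(3) Suc.prems in auto)
      also have "\<dots> \<le> jm.functional u b \<sigma>"
        using D_le_subpath[OF *(2), of u b] u s *(4) by simp
      also have "\<dots> \<le> jm.functional s b \<sigma>"
        by (rule jm.functional_subinterval_le) (use u s absolutely_continuous_path_subinterval[OF *(2)] in auto)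
      finally have second: "ennreal (real n * (k * norm x powr \<beta>)) \<le> jm.functional s b \<sigma>" .
      have "ennreal (real (Suc n) * (k * norm x powr \<beta>))
          = ennreal (k * norm x powr \<beta>) + ennreal (real n * (k * norm x powr \<beta>))"
        using m(1) by (simp add: k_def distrib_right flip: ennreal_plus)
      also have "\<dots> \<le> jm.functional a s \<sigma> + jm.functional s b \<sigma>"
        using second s(4) unfolding first by (intro add_mono)
      also have "\<dots> = jm.functional a b \<sigma>"
        using jm.functional_split[OF *(2) s(1,2)] by simp
      finally show "ennreal (real (Suc n) * (k * norm x powr \<beta>)) \<le> jm.functional a b \<sigma>" .
    qed
  qed simp
  note all = this[OF \<open>x \<noteq> 0\<close>]
  have "k * norm x powr \<beta> > 0" using m(1) \<open>x \<noteq> 0\<close> by (simp add: k_def)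
  show ?thesis
  proof (rule ccontr)
    assume "D x 0 \<noteq> \<infinity>"
    then obtain r where r: "D x 0 = ennreal r" "r \<ge> 0" by (cases "D x 0") auto
    obtain n where "r < real n * (k * norm x powr \<beta>)"
      using reals_Archimedean3[OF \<open>k * norm x powr \<beta> > 0\<close>] by blast
    with all[of n] r show False by (simp add: ennreal_le_iff)
  qed
qed

end

section \<open>Scaling and upper bounds for the distance\<close>

context homogeneous_potential
begin

text \<open>W contributes the exponent \<open>- (\<alpha> / 2)\<close> and the velocity the exponent
  1.\<close>

lemma functional_scaleR:
  assumes ac: "absolutely_continuous_path a b \<sigma>" and "r > 0"
  shows "jm.functional a b (\<lambda>t. r *\<^sub>R \<sigma> t) = ennreal (r powr \<beta>) * jm.functional a b \<sigma>"
proof -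
  have "jm.functional a b (\<lambda>t. r *\<^sub>R \<sigma> t) = (\<integral>\<^sup>+t. ennreal (r powr \<beta>) *
      (W (\<sigma> t) * ennreal (norm (vector_derivative \<sigma> (at t))) * indicator {a<..<b} t) \<partial>lebesgue)"
    unfolding jm.functional_interior
  proof (rule nn_integral_cong_AE)
    show "AE t in lebesgue. W (r *\<^sub>R \<sigma> t) * ennreal (norm (vector_derivative (\<lambda>t. r *\<^sub>R \<sigma> t) (at t))) *
        indicator {a<..<b} t = ennreal (r powr \<beta>) *
      (W (\<sigma> t) * ennreal (norm (vector_derivative \<sigma> (at t))) * indicator {a<..<b} t)"
      using absolutely_continuous_path_AE_differentiable[OF ac]
    proof eventually_elim
      case (elim t)
      show ?case
      proof (cases "t \<in> {a<..<b}")
        case True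
        with elim have "(\<sigma> has_vector_derivative vector_derivative \<sigma> (at t)) (at t)"
          by (simp add: vector_derivative_works)
        then have "((\<lambda>t. r *\<^sub>R \<sigma> t) has_vector_derivative r *\<^sub>R vector_derivative \<sigma> (at t)) (at t)"
          by (rule bounded_linear.has_vector_derivative[OF bounded_linear_scaleR_right])
        then have "vector_derivative (\<lambda>t. r *\<^sub>R \<sigma> t) (at t) = r *\<^sub>R vector_derivative \<sigma> (at t)"
          by (rule vector_derivative_at)
        moreover have "ennreal (r powr - (\<alpha> / 2)) * ennreal r = ennreal (r powr \<beta>)"
          using powr_\<beta>[OF \<open>r > 0\<close>] \<open>r > 0\<close> by (simp flip: ennreal_mult)
        ultimately show ?thesis
          using True \<open>r > 0\<close> by (simp add: W_homogeneous ennreal_mult mult_ac flip: \<open>_ = ennreal (r powr \<beta>)\<close>)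
      next
        case False
        then show ?thesis unfolding indicator_simps(2)[OF False] by simp
      qed
    qed
  qed
  also have "\<dots> = ennreal (r powr \<beta>) * jm.functional a b \<sigma>"
    unfolding jm.functional_interior by (rule nn_integral_cmult[OF jm.functional_measurable[OF ac]])
  finally show ?thesis .
qed

lemma D_scaleR_le:
  assumes "r > 0"
  shows "D (r *\<^sub>R x) (r *\<^sub>R y) \<le> ennreal (r powr \<beta>) * D x y"
proof (rule ccontr)
  assume "\<not> ?thesis"
  then have less: "ennreal (r powr \<beta>) * D x y < D (r *\<^sub>R x) (r *\<^sub>R y)" by simp
  have pos: "r powr \<beta> > 0" "r powr - \<beta> > 0" using assms by auto
  have inv: "ennreal (r powr \<beta>) * ennreal (r powr - \<beta>) = 1"
    using assms by (simp flip: ennreal_mult powr_add)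
  have "D x y < ennreal (r powr - \<beta>) * D (r *\<^sub>R x) (r *\<^sub>R y)"
  proof -
    have "D x y = ennreal (r powr - \<beta>) * (ennreal (r powr \<beta>) * D x y)"
      using inv by (simp add: mult_ac flip: mult.assoc)
    also have "\<dots> < ennreal (r powr - \<beta>) * D (r *\<^sub>R x) (r *\<^sub>R y)"
      using less pos by (intro ennreal_mult_strict_left_mono) auto
    finally show ?thesis .
  qed
  then obtain a b \<sigma> where *: "a < b" "absolutely_continuous_path a b \<sigma>" "\<sigma> a = x" "\<sigma> b = y"
     "jm.functional a b \<sigma> < ennreal (r powr - \<beta>) * D (r *\<^sub>R x) (r *\<^sub>R y)"
    by (rule D_approx)
  have "D (r *\<^sub>R x) (r *\<^sub>R y) \<le> jm.functional a b (\<lambda>t. r *\<^sub>R \<sigma> t)"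
    using D_le_functional[OF *(1) absolutely_continuous_path_scaleR[OF *(2), of r]] * by simp
  also have "\<dots> = ennreal (r powr \<beta>) * jm.functional a b \<sigma>"
    by (rule functional_scaleR[OF *(2) assms])
  also have "\<dots> < ennreal (r powr \<beta>) * (ennreal (r powr - \<beta>) * D (r *\<^sub>R x) (r *\<^sub>R y))"
    using *(5) pos by (intro ennreal_mult_strict_left_mono) auto
  also have "\<dots> = D (r *\<^sub>R x) (r *\<^sub>R y)"
    using inv by (simp flip: mult.assoc)
  finally show False by simp
qed

lemma D_scaleR:
  assumes "r > 0"
  shows "D (r *\<^sub>R x) (r *\<^sub>R y) = ennreal (r powr \<beta>) * D x y"
proof (rule antisym)
  have inv: "ennreal (r powr \<beta>) * ennreal ((1 / r) powr \<beta>) = 1"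
    using assms by (simp flip: ennreal_mult powr_mult)
  \<comment> \<open>The reverse inequality is the same statement for the factor 1 / r.\<close>
  have "D x y \<le> ennreal ((1 / r) powr \<beta>) * D (r *\<^sub>R x) (r *\<^sub>R y)"
    using D_scaleR_le[of "1 / r" "r *\<^sub>R x" "r *\<^sub>R y"] assms by simp
  then have "ennreal (r powr \<beta>) * D x y \<le> ennreal (r powr \<beta>) * (ennreal ((1 / r) powr \<beta>) * D (r *\<^sub>R x) (r *\<^sub>R y))"
    by (intro mult_left_mono) auto
  also have "\<dots> = D (r *\<^sub>R x) (r *\<^sub>R y)"
    using inv by (simp flip: mult.assoc)
  finally show "ennreal (r powr \<beta>) * D x y \<le> D (r *\<^sub>R x) (r *\<^sub>R y)" .
qed (rule D_scaleR_le[OF assms])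

text \<open>The segment is the competitor. The bound K depends on t and concerns interior times, so
  the segment may start at the collision.\<close>

lemma functional_line_le:
  assumes K: "\<And>t. 0 < t \<Longrightarrow> t < 1 \<Longrightarrow> W (x + t *\<^sub>R (y - x)) \<le> ennreal (K t)"
  shows "D x y \<le> (\<integral>\<^sup>+t\<in>{0..1}. ennreal (K t) * ennreal (norm (y - x)) \<partial>lebesgue)"
proof -
  let ?\<sigma> = "\<lambda>t. x + t *\<^sub>R (y - x)"
  have "absolutely_continuous_path 0 1 ?\<sigma>"
    by (rule absolutely_continuous_path_lipschitz[where K = "norm (y - x)"])
      (simp add: scaleR_diff_left[symmetric] mult.commute)
  from D_le_functional[OF zero_less_one this] have "D x y \<le> jm.functional 0 1 ?\<sigma>"
    by simp
  also have "\<dots> \<le> (\<integral>\<^sup>+t\<in>{0..1}. ennreal (K t) * ennreal (norm (y - x)) \<partial>lebesgue)"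
    unfolding jm.functional_interior
  proof (rule nn_integral_mono)
    fix t :: real
    have "(?\<sigma> has_vector_derivative (y - x)) (at t)"
      by (auto intro!: derivative_eq_intros)
    then have vd: "vector_derivative ?\<sigma> (at t) = y - x"
      by (rule vector_derivative_at)
    show "W (?\<sigma> t) * ennreal (norm (vector_derivative ?\<sigma> (at t))) * indicator {0<..<1} t
        \<le> ennreal (K t) * ennreal (norm (y - x)) * indicator {0..1} t"
      unfolding vd using K[of t] by (auto simp: indicator_def intro!: mult_right_mono)
  qed
  finally show ?thesis .
qed

text \<open>Segments to these points keep norm at least \<open>norm x / 2\<close>, where W is
  bounded.\<close>

lemma D_le_locally:
  assumes "x \<noteq> 0"
  obtains K where "K > 0" "\<And>y. norm (y - x) \<le> norm x / 2 \<Longrightarrow> D x y \<le> ennreal (K * norm (y - x))"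
proof -
  obtain M where M: "M > 0" "\<And>q. q \<noteq> 0 \<Longrightarrow> W q \<le> ennreal (M * norm q powr - (\<alpha> / 2))"
    by (rule W_bounds) blast
  define K where "K = M * (norm x / 2) powr - (\<alpha> / 2)"
  have "K > 0" using M assms by (simp add: K_def)
  show thesis
  proof (rule that[OF \<open>K > 0\<close>])
    fix y assume y: "norm (y - x) \<le> norm x / 2"
    have "W (x + t *\<^sub>R (y - x)) \<le> ennreal K" if t: "0 < t" "t < 1" for t
    proof -
      let ?z = "x + t *\<^sub>R (y - x)"
      have "norm (t *\<^sub>R (y - x)) \<le> 1 * norm (y - x)"
        unfolding norm_scaleR using t by (intro mult_right_mono) auto
      then have z: "norm x / 2 \<le> norm ?z"
        using norm_triangle_ineq2[of x "- (t *\<^sub>R (y - x))"] y by simp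
      then have "?z \<noteq> 0" using assms by auto
      have "norm ?z powr - (\<alpha> / 2) \<le> (norm x / 2) powr - (\<alpha> / 2)"
        using z assms \<alpha>_pos by (intro powr_neg_antimono) auto
      then have "M * norm ?z powr - (\<alpha> / 2) \<le> K"
        using M(1) unfolding K_def by (intro mult_left_mono) auto
      then show ?thesis
        using M(2)[OF \<open>?z \<noteq> 0\<close>] by (meson ennreal_leI order_trans)
    qed
    then have "D x y \<le> (\<integral>\<^sup>+t\<in>{0..1::real}. ennreal K * ennreal (norm (y - x)) \<partial>lebesgue)"
      by (rule functional_line_le)
    also have "\<dots> = ennreal K * ennreal (norm (y - x)) * emeasure lebesgue {0..1::real}"
      by (rule nn_integral_cmult_indicator) simp
    also have "\<dots> = ennreal (K * norm (y - x))"
      using \<open>K > 0\<close> by (simp add: ennreal_mult)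
    finally show "D x y \<le> ennreal (K * norm (y - x))" .
  qed
qed

end

section \<open>The finite distance in the subcritical case\<close>

locale subcritical_potential = homogeneous_potential +
  assumes \<beta>_pos: "0 < \<beta>"
begin

text \<open>A radial segment has length at most \<open>M * norm y powr \<beta>\<close> times the
  integral of \<open>t powr - (\<alpha> / 2)\<close> over the unit interval, which is
  \<open>1 / \<beta>\<close> because \<beta> is positive.\<close>

lemma D_to_0_le:
  obtains C where "C > 0" "\<And>y. D y 0 \<le> ennreal (C * norm y powr \<beta>)"
proof -
  obtain M where M: "M > 0" "\<And>q. q \<noteq> 0 \<Longrightarrow> W q \<le> ennreal (M * norm q powr - (\<alpha> / 2))"
    by (rule W_bounds) blast
  show thesis
  proof (rule that[of "M / \<beta>"])
    show "M / \<beta> > 0" using M \<beta>_pos by simp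
    fix y
    show "D y 0 \<le> ennreal (M / \<beta> * norm y powr \<beta>)"
    proof (cases "y = 0")
      case True
      then show ?thesis by (simp add: D_refl)
    next
      case False
      have "W (0 + t *\<^sub>R (y - 0)) \<le> ennreal (M * norm y powr - (\<alpha> / 2) * t powr - (\<alpha> / 2))"
        if t: "0 < t" "t < 1" for t
        using M(2)[of "t *\<^sub>R y"] t False by (simp add: powr_mult mult_ac)
      then have "D 0 y \<le> (\<integral>\<^sup>+t\<in>{0..1}. ennreal (M * norm y powr - (\<alpha> / 2) * t powr - (\<alpha> / 2))
          * ennreal (norm (y - 0)) \<partial>lebesgue)"
        by (rule functional_line_le)
      also have "\<dots> = (\<integral>\<^sup>+t. ennreal (M * norm y powr \<beta>) * ennreal (indicator {0..1} t * t powr - (\<alpha> / 2)) \<partial>lebesgue)"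
        using powr_\<beta>[of "norm y"] False M(1)
        by (intro nn_integral_cong) (auto simp: indicator_def mult_ac simp flip: ennreal_mult)
      also have "\<dots> = ennreal (M * norm y powr \<beta>) * (\<integral>\<^sup>+t. ennreal (indicator {0..1} t * t powr - (\<alpha> / 2)) \<partial>lebesgue)"
        by (rule nn_integral_cmult) (rule measurable_completion, measurable)
      also have "(\<integral>\<^sup>+t. ennreal (indicator {0..1} t * t powr - (\<alpha> / 2)) \<partial>lebesgue)
          = (\<integral>\<^sup>+t. ennreal (indicator {0..1} t * t powr - (\<alpha> / 2)) \<partial>lborel)"
        by (rule nn_integral_completion)
      also have "\<dots> = ennreal (1 / \<beta>)"
      proof (rule nn_integral_has_integral_lebesgue)
        have "((\<lambda>x. x powr - (\<alpha> / 2)) has_integral (1 powr (- (\<alpha> / 2) + 1) / (- (\<alpha> / 2) + 1))) {0..1::real}"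
          using \<beta>_pos by (intro has_integral_powr_from_0) (auto simp: \<beta>_def)
        then show "((\<lambda>x. x powr - (\<alpha> / 2)) has_integral 1 / \<beta>) {0..1}"
          by (simp add: \<beta>_def)
      qed auto
      finally show ?thesis
        using M(1) \<beta>_pos by (simp add: D_sym[of y] flip: ennreal_mult)
    qed
  qed
qed

lemma D_finite: "D x y < \<infinity>"
proof -
  obtain C where C: "\<And>y. D y 0 \<le> ennreal (C * norm y powr \<beta>)"
    by (rule D_to_0_le) blast
  have "D x y \<le> D x 0 + D 0 y" by (rule D_triangle)
  also have "\<dots> < \<infinity>"
    using C[of x] C[of y] by (auto simp: D_sym[of 0] intro: le_less_trans)
  finally show ?thesis .
qed

definition d :: "'a \<Rightarrow> 'a \<Rightarrow> real" where "d x y = enn2real (D x y)"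

lemma D_eq: "D x y = ennreal (d x y)"
  using D_finite[of x y] by (simp add: d_def)

lemma d_nonneg [simp]: "d x y \<ge> 0"
  by (simp add: d_def)

lemma d_refl [simp]: "d x x = 0"
  by (simp add: d_def D_refl)

lemma d_sym: "d x y = d y x"
  by (simp add: d_def D_sym)

lemma d_triangle: "d x z \<le> d x y + d y z"
  using D_triangle[of x z y] by (simp add: D_eq ennreal_le_iff flip: ennreal_plus)

lemma d_scaleR: "r > 0 \<Longrightarrow> d (r *\<^sub>R x) (r *\<^sub>R y) = r powr \<beta> * d x y"
  using D_scaleR[of r x y] by (simp add: d_def enn2real_mult)

lemma d_to_0_ge:
  obtains k where "k > 0" "\<And>x. k * norm x powr \<beta> \<le> d x 0"
proof -
  obtain k where k: "k > 0" "\<And>x. ennreal (k * norm x powr \<beta>) \<le> D x 0"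
    by (rule D_to_0_ge) blast
  show thesis by (rule that[OF k(1)]) (use k(2) in \<open>simp add: D_eq ennreal_le_iff\<close>)
qed

text \<open>Away from the origin the distance satisfies a local Lipschitz bound; at the origin its
  place is taken by \<open>C * norm y powr \<beta>\<close>, and \<delta> is the radius at which this
  equals e.\<close>

lemma d_small:
  assumes "e > 0"
  obtains \<delta> where "\<delta> > 0" "\<And>y. dist y x < \<delta> \<Longrightarrow> d x y < e"
proof (cases "x = 0")
  case True
  obtain C where C: "C > 0" "\<And>y. D y 0 \<le> ennreal (C * norm y powr \<beta>)"
    by (rule D_to_0_le) blast
  define \<delta> where "\<delta> = (e / C) powr (1 / \<beta>)"
  have "\<delta> > 0" using C assms by (simp add: \<delta>_def)
  show thesis
  proof (rule that[OF \<open>\<delta> > 0\<close>])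
    fix y assume "dist y x < \<delta>"
    then have "norm y powr \<beta> < \<delta> powr \<beta>"
      using True \<beta>_pos by (intro powr_less_mono2) auto
    also have "\<dots> = e / C" using \<beta>_pos C(1) assms by (simp add: \<delta>_def powr_powr)
    finally have "C * norm y powr \<beta> < e" using C(1) by (simp add: field_simps)
    moreover have "d y 0 \<le> C * norm y powr \<beta>"
      using C(2)[of y] C(1) by (simp add: D_eq ennreal_le_iff)
    ultimately show "d x y < e" using True by (simp add: d_sym)
  qed
next
  case False
  obtain K where K: "K > 0" "\<And>y. norm (y - x) \<le> norm x / 2 \<Longrightarrow> D x y \<le> ennreal (K * norm (y - x))"
    by (rule D_le_locally[OF False]) blast
  show thesis
  proof (rule that[of "min (norm x / 2) (e / K)"])
    show "0 < min (norm x / 2) (e / K)" using K assms False by simp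
    fix y assume y: "dist y x < min (norm x / 2) (e / K)"
    then have "d x y \<le> K * norm (y - x)"
      using K(2)[of y] K(1) by (simp add: D_eq ennreal_le_iff dist_norm)
    also have "\<dots> < K * (e / K)"
      using y K(1) by (intro mult_strict_left_mono) (auto simp: dist_norm)
    finally show "d x y < e" using K(1) by simp
  qed
qed

lemma d_continuous: "continuous_on UNIV (\<lambda>p. d (fst p) (snd p))"
  unfolding continuous_on_iff
proof (intro ballI allI impI)
  fix p :: "'a \<times> 'a" and e :: real assume "e > 0"
  then have "e / 2 > 0" by simp
  obtain \<delta>1 where 1: "\<delta>1 > 0" "\<And>y. dist y (fst p) < \<delta>1 \<Longrightarrow> d (fst p) y < e / 2"
    by (rule d_small[OF \<open>e / 2 > 0\<close>]) blast
  obtain \<delta>2 where 2: "\<delta>2 > 0" "\<And>y. dist y (snd p) < \<delta>2 \<Longrightarrow> d (snd p) y < e / 2"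
    by (rule d_small[OF \<open>e / 2 > 0\<close>]) blast
  show "\<exists>\<delta>>0. \<forall>p'\<in>UNIV. dist p' p < \<delta> \<longrightarrow> dist (d (fst p') (snd p')) (d (fst p) (snd p)) < e"
  proof (intro exI[of _ "min \<delta>1 \<delta>2"] conjI ballI impI)
    fix p' assume "dist p' p < min \<delta>1 \<delta>2"
    then have "dist (fst p') (fst p) < \<delta>1" "dist (snd p') (snd p) < \<delta>2"
      using dist_fst_le[of p' p] dist_snd_le[of p' p] by linarith+
    then have "d (fst p) (fst p') < e / 2" "d (snd p) (snd p') < e / 2"
      using 1(2) 2(2) by auto
    then show "dist (d (fst p') (snd p')) (d (fst p) (snd p)) < e"
      using d_triangle[of "fst p'" "snd p'" "fst p"] d_triangle[of "fst p" "snd p'" "snd p"]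
        d_triangle[of "fst p" "snd p" "fst p'"] d_triangle[of "fst p'" "snd p" "snd p'"]
        d_sym[of "fst p" "fst p'"] d_sym[of "snd p" "snd p'"]
      by (simp add: dist_real_def abs_less_iff)
  qed (use 1 2 in simp)
qed

lemma tendsto_d:
  assumes "(f \<longlongrightarrow> x) F" "(g \<longlongrightarrow> y) F"
  shows "((\<lambda>t. d (f t) (g t)) \<longlongrightarrow> d x y) F"
  using continuous_on_tendsto_compose[OF d_continuous tendsto_Pair[OF assms]] by simp

end

section \<open>Geodesics\<close>

text \<open>F is the primitive of the integrand. Its continuity permits a parametrization
  proportional to the functional by the intermediate value theorem.\<close>

lemma (in path_functional) functional_continuous:
  assumes ac: "absolutely_continuous_path a b c" and fin: "functional a b c < \<infinity>"
  obtains F :: "real \<Rightarrow> real" where "continuous_on {a..b} F"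
    "\<And>s t. \<lbrakk>a \<le> s; s \<le> t; t \<le> b\<rbrakk> \<Longrightarrow> F s \<le> F t"
    "\<And>s t. \<lbrakk>a \<le> s; s \<le> t; t \<le> b\<rbrakk> \<Longrightarrow> functional s t c = ennreal (F t - F s)"
proof -
  define f where "f = (\<lambda>t. \<Phi> (c t) (vector_derivative c (at t)) * indicator {a<..<b} t)"
  \<comment> \<open>A finite integral makes the integrand finite almost everywhere, so the default
    value of \<open>enn2real\<close> at infinity is taken on a null set only.\<close>
  define g where "g = (\<lambda>t. enn2real (f t))"
  have f_meas [measurable]: "f \<in> borel_measurable lebesgue"
    unfolding f_def by (rule functional_measurable[OF ac])
  have "(\<integral>\<^sup>+t. f t \<partial>lebesgue) \<noteq> \<infinity>"
    using fin by (simp add: functional_interior f_def)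
  from nn_integral_PInf_AE[OF f_meas this] have f_fin: "AE t in lebesgue. f t = ennreal (g t)"
    by eventually_elim (simp add: g_def less_top)
  have g0: "g t \<ge> 0" for t by (simp add: g_def)
  have g_int: "integrable lebesgue g"
  proof (rule integrableI_nonneg)
    have "(\<integral>\<^sup>+t. ennreal (g t) \<partial>lebesgue) = (\<integral>\<^sup>+t. f t \<partial>lebesgue)"
      by (rule nn_integral_cong_AE) (use f_fin in eventually_elim, simp)
    then show "(\<integral>\<^sup>+t. ennreal (g t) \<partial>lebesgue) < \<infinity>"
      using fin by (simp add: functional_interior f_def)
  qed (use g0 in \<open>auto simp: g_def\<close>)
  have g_ai: "g absolutely_integrable_on {s..t}" for s t
    unfolding set_integrable_def by (rule integrable_mult_indicator[OF _ g_int]) auto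
  then have g_i: "g integrable_on {s..t}" for s t
    by (rule set_lebesgue_integral_eq_integral(1))
  define F where "F = (\<lambda>t. integral {a..t} g)"
  have diff: "F t - F s = integral {s..t} g" if "a \<le> s" "s \<le> t" "t \<le> b" for s t
    using Henstock_Kurzweil_Integration.integral_combine[OF that(1,2) g_i] by (simp add: F_def)
  show thesis
  proof (rule that[of F])
    show "continuous_on {a..b} F"
      unfolding F_def by (rule indefinite_integral_continuous_1[OF g_i])
    fix s t assume st: "a \<le> s" "s \<le> t" "t \<le> b"
    have "0 \<le> integral {s..t} g"
      by (rule integral_nonneg[OF g_i]) (rule g0)
    then show "F s \<le> F t" using diff[OF st] by simp
    have "functional s t c = (\<integral>\<^sup>+u. ennreal (indicat_real {s..t} u *\<^sub>R g u) \<partial>lebesgue)"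
      unfolding functional_interior
    proof (rule nn_integral_cong_AE)
      show "AE u in lebesgue. \<Phi> (c u) (vector_derivative c (at u)) * indicator {s<..<t} u
          = ennreal (indicat_real {s..t} u *\<^sub>R g u)"
        using f_fin AE_lebesgue_off_finite[of "{s, t}", OF finite.insertI[OF finite.insertI[OF finite.emptyI]]]
      proof eventually_elim
        case (elim u)
        show ?case
        proof (cases "u \<in> {s<..<t}")
          case True
          then have "u \<in> {a<..<b}" using st by auto
          with True elim(1) show ?thesis by (simp add: f_def)
        next
          case False
          with elim(2) have "u \<notin> {s..t}" by auto
          with False show ?thesis by (simp only: indicator_simps(2)[OF False] indicator_simps(2)[OF \<open>u \<notin> {s..t}\<close>]) simp
        qed
      qed
    qed
    also have "\<dots> = ennreal (LINT u|lebesgue. indicat_real {s..t} u *\<^sub>R g u)"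
      by (rule nn_integral_eq_integral) (use g_ai[of s t] g0 in \<open>auto simp: set_integrable_def\<close>)
    also have "(LINT u|lebesgue. indicat_real {s..t} u *\<^sub>R g u) = integral {s..t} g"
      using set_lebesgue_integral_eq_integral(2)[OF g_ai[of s t]] by (simp add: set_lebesgue_integral_def)
    finally show "functional s t c = ennreal (F t - F s)"
      using diff[OF st] by simp
  qed
qed

context homogeneous_potential
begin

lemma D_ge_lipschitz:
  assumes "R > 0"
  obtains \<kappa> where "\<kappa> > 0" "\<And>x y. \<lbrakk>norm x \<le> R; norm y \<le> R\<rbrakk> \<Longrightarrow> ennreal (\<kappa> * norm (y - x)) \<le> D x y"
proof -
  obtain m where m: "m > 0" "\<And>q. q \<noteq> 0 \<Longrightarrow> ennreal (m * norm q powr - (\<alpha> / 2)) \<le> W q"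
    by (rule W_bounds) blast
  \<comment> \<open>Points no farther from x than y have norm at most 3 R when x and y have norm at
    most R; there W is at least this number.\<close>
  define \<kappa> where "\<kappa> = m * (3 * R) powr - (\<alpha> / 2)"
  have "\<kappa> > 0" using m(1) assms by (simp add: \<kappa>_def)
  show thesis
  proof (rule that[OF \<open>\<kappa> > 0\<close>])
    fix x y :: 'a assume xy: "norm x \<le> R" "norm y \<le> R"
    show "ennreal (\<kappa> * norm (y - x)) \<le> D x y"
    proof (rule D_ge)
      fix z assume z: "z \<in> cball x (norm (y - x))"
      show "ennreal \<kappa> \<le> W z"
      proof (cases "z = 0")
        case False
        have "norm z \<le> norm x + norm (y - x)"
          using z norm_triangle_ineq2[of z x] by (simp add: dist_norm norm_minus_commute)
        also have "\<dots> \<le> 3 * R"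
          using xy norm_triangle_ineq4[of y x] by simp
        finally have "norm z powr - (\<alpha> / 2) \<ge> (3 * R) powr - (\<alpha> / 2)"
          using False \<alpha>_pos by (intro powr_neg_antimono) auto
        then have "\<kappa> \<le> m * norm z powr - (\<alpha> / 2)"
          unfolding \<kappa>_def using m(1) by (intro mult_left_mono) auto
        then show ?thesis using m(2)[OF False] by (meson ennreal_leI order_trans)
      qed (simp add: W_0)
    qed (use \<open>\<kappa> > 0\<close> in auto)
  qed
qed

end

context subcritical_potential
begin

lemma d_le_functional:
  assumes "a \<le> b" "absolutely_continuous_path a b \<sigma>"
  shows "ennreal (d (\<sigma> a) (\<sigma> b)) \<le> jm.functional a b \<sigma>"
  using D_le_subpath[OF assms(2), of a b] assms(1) by (simp add: D_eq)

text \<open>By \<open>d_to_0_ge\<close> the distance to the origin dominates a positive power of the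
  norm. This confines curves of bounded length to a Euclidean ball.\<close>

lemma d_ball_bounded:
  assumes "C \<ge> 0"
  obtains R where "R > 0" "\<And>x. d x 0 \<le> C \<Longrightarrow> norm x \<le> R"
proof -
  obtain k where k: "k > 0" "\<And>x. k * norm x powr \<beta> \<le> d x 0"
    by (rule d_to_0_ge) blast
  define R where "R = ((C + 1) / k) powr (1 / \<beta>)"
  have "R > 0" using k assms by (simp add: R_def)
  show thesis
  proof (rule that[OF \<open>R > 0\<close>], rule ccontr)
    fix x assume x: "d x 0 \<le> C" "\<not> norm x \<le> R"
    then have "R powr \<beta> < norm x powr \<beta>"
      using \<open>R > 0\<close> \<beta>_pos by (intro powr_less_mono2) auto
    moreover have "R powr \<beta> = (C + 1) / k"
      using k(1) assms \<beta>_pos by (simp add: R_def powr_powr)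
    ultimately have "C + 1 < k * norm x powr \<beta>"
      using k(1) by (simp add: field_simps)
    with k(2)[of x] x(1) show False by simp
  qed
qed

lemma d_ge_lipschitz:
  assumes "R > 0"
  obtains \<kappa> where "\<kappa> > 0" "\<And>x y. \<lbrakk>norm x \<le> R; norm y \<le> R\<rbrakk> \<Longrightarrow> \<kappa> * norm (y - x) \<le> d x y"
proof -
  obtain \<kappa> where k: "\<kappa> > 0" "\<And>x y. \<lbrakk>norm x \<le> R; norm y \<le> R\<rbrakk> \<Longrightarrow> ennreal (\<kappa> * norm (y - x)) \<le> D x y"
    by (rule D_ge_lipschitz[OF assms]) blast
  show thesis
  proof (rule that[OF k(1)])
    fix x y :: 'a assume "norm x \<le> R" "norm y \<le> R"
    from k(2)[OF this] show "\<kappa> * norm (y - x) \<le> d x y"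
      by (simp add: D_eq ennreal_le_iff)
  qed
qed

text \<open>The Finsler norm \<open>W\<close> bounds the metric speed from below; at a collision, where \<open>W = \<infinity>\<close>,
  the statement says that the velocity vanishes.\<close>

lemma speed_bound:
  assumes c: "(c has_vector_derivative v) (at t)" and H: "(H has_real_derivative h) (at t)"
    and le: "\<forall>\<^sub>F s in at t. d (c t) (c s) \<le> \<bar>H s - H t\<bar>"
  shows "W (c t) * ennreal (norm v) \<le> ennreal \<bar>h\<bar>"
proof -
  \<comment> \<open>Each k below the density at \<open>c t\<close> bounds it from below on a small
    ball, so \<open>D_ge\<close> compares k times the chord with the distance, which in turn is at
    most the increment of H.\<close>
  have main: "k * norm v \<le> \<bar>h\<bar>" if k: "k \<ge> 0" "ennreal k < W (c t)" for k
  proof (rule field_le_epsilon)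
    fix e :: real assume "e > 0"
    \<comment> \<open>The errors of the two first-order expansions, one of them multiplied by k, add
      up to \<open>(k + 1) * e'\<close> per unit of time.\<close>
    define e' where "e' = e / (k + 1)"
    have "e' > 0" using \<open>e > 0\<close> k(1) by (simp add: e'_def)
    obtain \<rho> where \<rho>: "\<rho> > 0" "\<And>y. y \<in> cball (c t) \<rho> \<Longrightarrow> ennreal k \<le> W y"
      by (rule W_lower_semicontinuous[OF k]) blast
    have "isCont c t" using c has_vector_derivative_continuous by blast
    then have "\<forall>\<^sub>F s in at t. dist (c s) (c t) < \<rho>"
      using \<rho>(1) by (simp add: isCont_def tendsto_iff)
    moreover obtain d1 where d1: "d1 > 0" "\<And>s. \<bar>s - t\<bar> < d1 \<Longrightarrow> norm (c s - c t - (s - t) *\<^sub>R v) \<le> e' * \<bar>s - t\<bar>"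
      using c \<open>e' > 0\<close> unfolding has_vector_derivative_def has_derivative_at_alt real_norm_def by meson
    moreover obtain d2 where d2: "d2 > 0" "\<And>s. \<bar>s - t\<bar> < d2 \<Longrightarrow> \<bar>H s - H t - h * (s - t)\<bar> \<le> e' * \<bar>s - t\<bar>"
      using H \<open>e' > 0\<close> unfolding has_field_derivative_def has_derivative_at_alt real_norm_def by meson
    moreover have "\<forall>\<^sub>F s in at t. \<bar>s - t\<bar> < d1" "\<forall>\<^sub>F s in at t. \<bar>s - t\<bar> < d2" "\<forall>\<^sub>F s in at t. s \<noteq> t"
      using d1(1) d2(1) by (auto simp: eventually_at dist_real_def)
    ultimately have "\<forall>\<^sub>F s in at t. dist (c s) (c t) < \<rho> \<and> \<bar>s - t\<bar> < d1 \<and> \<bar>s - t\<bar> < d2 \<and> s \<noteq> t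
        \<and> d (c t) (c s) \<le> \<bar>H s - H t\<bar>"
      using le by (simp add: eventually_conj_iff)
    from eventually_happens'[OF _ this] obtain s where s: "dist (c s) (c t) < \<rho>" "\<bar>s - t\<bar> < d1" "\<bar>s - t\<bar> < d2"
      "s \<noteq> t" "d (c t) (c s) \<le> \<bar>H s - H t\<bar>" by auto
    have "ennreal (k * norm (c s - c t)) \<le> D (c t) (c s)"
    proof (rule D_ge)
      fix z assume "z \<in> cball (c t) (norm (c s - c t))"
      then have "z \<in> cball (c t) \<rho>" using s(1) by (simp add: dist_norm)
      then show "ennreal k \<le> W z" by (rule \<rho>(2))
    qed (use k in auto)
    then have "k * norm (c s - c t) \<le> d (c t) (c s)"
      by (simp add: D_eq ennreal_le_iff)
    also note s(5)
    also have "\<bar>H s - H t\<bar> \<le> \<bar>h * (s - t)\<bar> + e' * \<bar>s - t\<bar>"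
      using d2(2)[OF s(3)] by linarith
    also have "\<dots> = (\<bar>h\<bar> + e') * \<bar>s - t\<bar>"
      by (simp add: abs_mult distrib_right)
    finally have up: "k * norm (c s - c t) \<le> (\<bar>h\<bar> + e') * \<bar>s - t\<bar>" .
    have "norm ((s - t) *\<^sub>R v) \<le> norm (c s - c t) + e' * \<bar>s - t\<bar>"
      using norm_triangle_ineq2[of "(s - t) *\<^sub>R v" "c s - c t"] d1(2)[OF s(2)]
      by (simp add: norm_minus_commute)
    then have "k * (\<bar>s - t\<bar> * norm v) \<le> k * (norm (c s - c t) + e' * \<bar>s - t\<bar>)"
      using k(1) by (intro mult_left_mono) auto
    also have "\<dots> \<le> (\<bar>h\<bar> + e') * \<bar>s - t\<bar> + k * (e' * \<bar>s - t\<bar>)"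
      using up by (simp add: distrib_left)
    also have "\<dots> = (\<bar>h\<bar> + (k + 1) * e') * \<bar>s - t\<bar>"
      by (simp add: algebra_simps)
    finally have "(k * norm v) * \<bar>s - t\<bar> \<le> (\<bar>h\<bar> + (k + 1) * e') * \<bar>s - t\<bar>"
      by (simp add: mult_ac)
    then have "k * norm v \<le> \<bar>h\<bar> + (k + 1) * e'"
      using s(4) by simp
    then show "k * norm v \<le> \<bar>h\<bar> + e"
      using k(1) by (simp add: e'_def)
  qed
  show ?thesis
  proof (cases "v = 0")
    case False
    then have v: "norm v > 0" by simp
    \<comment> \<open>For nonzero v the estimate for every finite k below the density bounds the
      density itself and so excludes the value infinity.\<close>
    have "W (c t) \<le> ennreal (\<bar>h\<bar> / norm v)"
    proof (rule ccontr)
      assume "\<not> ?thesis"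
      then have "ennreal (\<bar>h\<bar> / norm v) < W (c t)" by simp
      then obtain r where r: "ennreal (\<bar>h\<bar> / norm v) < r" "r < W (c t)" using dense by blast
      then obtain k where k: "r = ennreal k" "k \<ge> 0" by (cases r) auto
      have "\<bar>h\<bar> / norm v < k" using r(1) k v by (simp add: ennreal_less_iff)
      then have "\<bar>h\<bar> < k * norm v" using v by (simp add: field_simps)
      with main[of k] r(2) k show False by simp
    qed
    then have "W (c t) * ennreal (norm v) \<le> ennreal (\<bar>h\<bar> / norm v) * ennreal (norm v)"
      by (rule mult_right_mono) simp
    also have "\<dots> = ennreal \<bar>h\<bar>" using v by (simp flip: ennreal_mult)
    finally show ?thesis .
  qed simp
qed

text \<open>The Lipschitz bound for \<open>d\<close> confines the curve to a Euclidean ball, on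
  which \<open>d\<close> dominates a multiple of the Euclidean distance.\<close>

lemma d_lipschitz_imp_lipschitz:
  assumes K: "K \<ge> 0" and lip: "\<And>s t. \<lbrakk>a \<le> s; s \<le> t; t \<le> b\<rbrakk> \<Longrightarrow> d (c s) (c t) \<le> K * (t - s)"
  obtains K' where "\<And>s t. \<lbrakk>a \<le> s; s \<le> t; t \<le> b\<rbrakk> \<Longrightarrow> norm (c t - c s) \<le> K' * (t - s)"
proof (cases "a \<le> b")
  case True
  have "0 \<le> d (c a) 0 + K * (b - a)" using K True by simp
  then obtain R where R: "R > 0" "\<And>x. d x 0 \<le> d (c a) 0 + K * (b - a) \<Longrightarrow> norm x \<le> R"
    by (rule d_ball_bounded) blast
  have in_ball: "norm (c t) \<le> R" if "a \<le> t" "t \<le> b" for t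
  proof (rule R(2))
    have "d (c t) 0 \<le> d (c a) (c t) + d (c a) 0"
      using d_triangle[of "c t" 0 "c a"] d_sym[of "c a" "c t"] by simp
    also have "d (c a) (c t) \<le> K * (t - a)" by (rule lip) (use that in auto)
    also have "\<dots> \<le> K * (b - a)" using K that by (intro mult_left_mono) auto
    finally show "d (c t) 0 \<le> d (c a) 0 + K * (b - a)" by simp
  qed
  obtain \<kappa> where k: "\<kappa> > 0" "\<And>x y. \<lbrakk>norm x \<le> R; norm y \<le> R\<rbrakk> \<Longrightarrow> \<kappa> * norm (y - x) \<le> d x y"
    by (rule d_ge_lipschitz[OF R(1)]) blast
  show thesis
  proof (rule that[of "K / \<kappa>"])
    fix s t assume st: "a \<le> s" "s \<le> t" "t \<le> b"
    have "\<kappa> * norm (c t - c s) \<le> d (c s) (c t)"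
      by (rule k(2)) (use in_ball st in auto)
    also have "\<dots> \<le> K * (t - s)" by (rule lip[OF st])
    finally show "norm (c t - c s) \<le> K / \<kappa> * (t - s)"
      using k(1) by (simp add: field_simps)
  qed
next
  case False
  then show thesis by (intro that[of 0]) auto
qed

text \<open>\<open>speed_bound\<close> with a linear H of slope K bounds the integrand by K almost
  everywhere, so a metric Lipschitz condition controls the length.\<close>

lemma d_lipschitz_path:
  assumes K: "K \<ge> 0" and ab: "a \<le> b"
    and lip: "\<And>s t. \<lbrakk>a \<le> s; s \<le> t; t \<le> b\<rbrakk> \<Longrightarrow> d (c s) (c t) \<le> K * (t - s)"
  shows "absolutely_continuous_path a b c" "jm.functional a b c \<le> ennreal (K * (b - a))"
proof -
  obtain K' where "\<And>s t. \<lbrakk>a \<le> s; s \<le> t; t \<le> b\<rbrakk> \<Longrightarrow> norm (c t - c s) \<le> K' * (t - s)"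
    by (rule d_lipschitz_imp_lipschitz[OF K lip]) auto
  then show ac: "absolutely_continuous_path a b c"
    by (rule absolutely_continuous_path_lipschitz)
  have "jm.functional a b c \<le> (\<integral>\<^sup>+t\<in>{a..b}. ennreal K \<partial>lebesgue)"
    unfolding jm.functional_interior
  proof (rule nn_integral_mono_AE)
    show "AE t in lebesgue. W (c t) * ennreal (norm (vector_derivative c (at t))) * indicator {a<..<b} t
        \<le> ennreal K * indicator {a..b} t"
      using absolutely_continuous_path_AE_differentiable[OF ac]
    proof eventually_elim
      case (elim t)
      show ?case
      proof (cases "t \<in> {a<..<b}")
        case True
        with elim have v: "(c has_vector_derivative vector_derivative c (at t)) (at t)"
          by (simp add: vector_derivative_works)
        have H: "((\<lambda>s. K * s) has_real_derivative K) (at t)"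
          by (auto intro!: derivative_eq_intros)
        have "\<forall>\<^sub>F s in at t. s \<in> {a<..<b}"
          using True by (intro eventually_at_in_open') auto
        then have "\<forall>\<^sub>F s in at t. d (c t) (c s) \<le> \<bar>K * s - K * t\<bar>"
        proof eventually_elim
          case (elim s)
          show ?case
          proof (cases "s \<le> t")
            case le: True
            have "d (c s) (c t) \<le> K * (t - s)" by (rule lip) (use True elim le in auto)
            then show ?thesis by (simp add: d_sym algebra_simps)
          next
            case False
            have "d (c t) (c s) \<le> K * (s - t)" by (rule lip) (use True elim False in auto)
            then show ?thesis by (simp add: algebra_simps)
          qed
        qed
        from speed_bound[OF v H this] True K show ?thesis by simp
      next
        case False
        then show ?thesis by (simp only: indicator_simps(2)[OF False]) simp
      qed
    qed
  qed
  also have "\<dots> = ennreal K * emeasure lebesgue {a..b}"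
    by (rule nn_integral_cmult_indicator) simp
  also have "\<dots> = ennreal (K * (b - a))"
    using ab K by (simp add: ennreal_mult)
  finally show "jm.functional a b c \<le> ennreal (K * (b - a))" .
qed

section \<open>Existence of geodesics\<close>

text \<open>A nearly optimal path is parametrized proportionally to length: \<tau> picks a time at
  which the fraction s of the length L has been covered. It may jump where F is constant, but
  \<open>d\<close> is estimated through the increments of F, which vanish across such a
  jump.\<close>

lemma approximate_geodesic:
  assumes "e > 0"
  obtains \<gamma> where "\<gamma> 0 = p" "\<gamma> 1 = q"
    "\<And>s t. \<lbrakk>0 \<le> s; s \<le> 1; 0 \<le> t; t \<le> 1\<rbrakk> \<Longrightarrow> d (\<gamma> s) (\<gamma> t) \<le> (d p q + e) * \<bar>t - s\<bar>"
proof -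
  have "D p q < ennreal (d p q + e)"
    using assms by (simp add: D_eq ennreal_less_iff)
  then obtain a b \<sigma> where \<sigma>: "a < b" "absolutely_continuous_path a b \<sigma>" "\<sigma> a = p" "\<sigma> b = q"
      "jm.functional a b \<sigma> < ennreal (d p q + e)"
    by (rule D_approx)
  have "jm.functional a b \<sigma> < \<infinity>" using \<sigma>(5) less_top order_less_trans by fastforce
  then obtain F where F: "continuous_on {a..b} F"
    "\<And>s t. \<lbrakk>a \<le> s; s \<le> t; t \<le> b\<rbrakk> \<Longrightarrow> F s \<le> F t"
    "\<And>s t. \<lbrakk>a \<le> s; s \<le> t; t \<le> b\<rbrakk> \<Longrightarrow> jm.functional s t \<sigma> = ennreal (F t - F s)"
    by (rule jm.functional_continuous[OF \<sigma>(2)]) blast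
  define L where "L = F b - F a"
  have L: "0 \<le> L" "L \<le> d p q + e"
    using F(2)[of a b] F(3)[of a b] \<sigma>(1,5) assms
    by (auto simp: L_def ennreal_less_iff simp del: ennreal_plus)
  have d_F: "d (\<sigma> s) (\<sigma> t) \<le> \<bar>F t - F s\<bar>" if st: "s \<in> {a..b}" "t \<in> {a..b}" for s t
  proof -
    have *: "d (\<sigma> s) (\<sigma> t) \<le> F t - F s" if "a \<le> s" "s \<le> t" "t \<le> b" for s t
      using d_le_functional[of s t \<sigma>] absolutely_continuous_path_subinterval[OF \<sigma>(2)] F(2,3)[OF that] that
      by (simp add: ennreal_le_iff)
    show ?thesis
      using *[of s t] *[of t s] st by (cases "s \<le> t") (auto simp: d_sym)
  qed
  \<comment> \<open>F may be constant near the ends; the choices for s = 0 and s = 1 are prescribed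
    so that the curve starts at p and ends at q.\<close>
  have "\<exists>t. t \<in> {a..b} \<and> F t = F a + s * L \<and> (s = 0 \<longrightarrow> t = a) \<and> (s = 1 \<longrightarrow> t = b)"
    if s: "s \<in> {0..1}" for s
  proof (cases "s = 0 \<or> s = 1")
    case True
    then show ?thesis
    proof
      assume "s = 0" then show ?thesis using \<sigma>(1) by (intro exI[of _ a]) auto
    next
      assume "s = 1" then show ?thesis using \<sigma>(1) by (intro exI[of _ b]) (auto simp: L_def)
    qed
  next
    case False
    have "s * L \<le> 1 * L" using s L by (intro mult_right_mono) auto
    then have "\<exists>t\<ge>a. t \<le> b \<and> F t = F a + s * L"
      using s L \<sigma>(1) F(1) by (intro IVT') (auto simp: L_def)
    with False show ?thesis by auto
  qed
  then obtain \<tau> where \<tau>: "\<And>s. s \<in> {0..1} \<Longrightarrow> \<tau> s \<in> {a..b}" "\<And>s. s \<in> {0..1} \<Longrightarrow> F (\<tau> s) = F a + s * L"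
      "\<tau> 0 = a" "\<tau> 1 = b"
    by (metis atLeastAtMost_iff order_refl zero_le_one)
  show thesis
  proof (rule that[of "\<lambda>s. \<sigma> (\<tau> s)"])
    fix s t :: real assume st: "0 \<le> s" "s \<le> 1" "0 \<le> t" "t \<le> 1"
    then have "d (\<sigma> (\<tau> s)) (\<sigma> (\<tau> t)) \<le> \<bar>F (\<tau> t) - F (\<tau> s)\<bar>"
      by (intro d_F \<tau>(1)) auto
    also have "\<dots> = L * \<bar>t - s\<bar>"
      using st L(1) \<tau>(2)[of s] \<tau>(2)[of t] by (simp add: abs_mult left_diff_distrib[symmetric])
    also have "\<dots> \<le> (d p q + e) * \<bar>t - s\<bar>"
      using L(2) by (rule mult_right_mono) simp
    finally show "d (\<sigma> (\<tau> s)) (\<sigma> (\<tau> t)) \<le> (d p q + e) * \<bar>t - s\<bar>" .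
  qed (use \<tau> \<sigma> in auto)
qed

text \<open>The tolerances \<open>1 / real (Suc n)\<close> tend to 0, and the Lipschitz inequality
  for fixed s and t passes to the limit because \<open>d\<close> is continuous.\<close>

theorem geodesic_exists:
  obtains \<gamma> where "\<gamma> 0 = p" "\<gamma> 1 = q"
    "\<And>s t. \<lbrakk>0 \<le> s; s \<le> 1; 0 \<le> t; t \<le> 1\<rbrakk> \<Longrightarrow> d (\<gamma> s) (\<gamma> t) \<le> d p q * \<bar>t - s\<bar>"
proof -
  have "\<exists>\<gamma>. \<gamma> 0 = p \<and> \<gamma> 1 = q \<and> (\<forall>s\<in>{0..1}. \<forall>t\<in>{0..1}. d (\<gamma> s) (\<gamma> t) \<le> (d p q + 1 / real (Suc n)) * \<bar>t - s\<bar>)" for n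
    by (rule approximate_geodesic[of "1 / real (Suc n)" p q]) auto
  then obtain \<Gamma> where \<Gamma>: "\<And>n. \<Gamma> n 0 = p" "\<And>n. \<Gamma> n 1 = q"
    "\<And>n s t. \<lbrakk>s \<in> {0..1}; t \<in> {0..1}\<rbrakk> \<Longrightarrow> d (\<Gamma> n s) (\<Gamma> n t) \<le> (d p q + 1 / real (Suc n)) * \<bar>t - s\<bar>"
    by metis
  \<comment> \<open>A Lipschitz constant common to all n, since the tolerances are at most
    1.\<close>
  define K where "K = d p q + 1"
  have "K > 0" using d_nonneg[of p q] unfolding K_def by linarith
  have lip: "d (\<Gamma> n s) (\<Gamma> n t) \<le> K * \<bar>t - s\<bar>" if "s \<in> {0..1}" "t \<in> {0..1}" for n s t
  proof -
    have "(d p q + 1 / real (Suc n)) * \<bar>t - s\<bar> \<le> K * \<bar>t - s\<bar>"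
      unfolding K_def by (intro mult_right_mono add_left_mono) (auto simp: divide_simps)
    with \<Gamma>(3)[OF that, of n] show ?thesis by linarith
  qed
  have "0 \<le> d p 0 + K" using \<open>K > 0\<close> by simp
  then obtain R where R: "R > 0" "\<And>x. d x 0 \<le> d p 0 + K \<Longrightarrow> norm x \<le> R"
    by (rule d_ball_bounded) blast
  have in_ball: "norm (\<Gamma> n t) \<le> R" if t: "t \<in> {0..1}" for n t
  proof (rule R(2))
    have "d (\<Gamma> n t) 0 \<le> d p (\<Gamma> n t) + d p 0"
      using d_triangle[of "\<Gamma> n t" 0 p] d_sym[of p "\<Gamma> n t"] by simp
    also have "d p (\<Gamma> n t) \<le> K * \<bar>t - 0\<bar>"
      using lip[of 0 t n] t \<Gamma>(1) by simp
    also have "\<dots> \<le> K * 1"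
      using t \<open>K > 0\<close> by (intro mult_left_mono) auto
    finally show "d (\<Gamma> n t) 0 \<le> d p 0 + K" by simp
  qed
  obtain \<kappa> where k: "\<kappa> > 0" "\<And>x y. \<lbrakk>norm x \<le> R; norm y \<le> R\<rbrakk> \<Longrightarrow> \<kappa> * norm (y - x) \<le> d x y"
    by (rule d_ge_lipschitz[OF R(1)]) blast
  obtain \<gamma> r where \<gamma>: "strict_mono (r :: nat \<Rightarrow> nat)"
      "\<And>e. 0 < e \<Longrightarrow> \<exists>N. \<forall>n x. n \<ge> N \<and> x \<in> {0..1::real} \<longrightarrow> norm (\<Gamma> (r n) x - \<gamma> x) < e"
  proof (rule Arzela_Ascoli[of "{0..1::real}" \<Gamma> R])
    fix x e :: real assume x: "x \<in> {0..1}" "0 < e"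
    show "\<exists>\<delta>>0. \<forall>n y. y \<in> {0..1} \<and> norm (x - y) < \<delta> \<longrightarrow> norm (\<Gamma> n x - \<Gamma> n y) < e"
    \<comment> \<open>Equicontinuity: on the ball, \<kappa> times the Euclidean distance is at most
      \<open>d\<close>, and \<open>d\<close> is at most K times the difference of
      parameters.\<close>
    proof (intro exI[of _ "\<kappa> * e / K"] conjI allI impI)
      show "0 < \<kappa> * e / K" using k(1) x \<open>K > 0\<close> by simp
      fix n y assume y: "y \<in> {0..1} \<and> norm (x - y) < \<kappa> * e / K"
      have "\<kappa> * norm (\<Gamma> n x - \<Gamma> n y) \<le> d (\<Gamma> n y) (\<Gamma> n x)"
        by (rule k(2)) (use x y in_ball in auto)
      also have "\<dots> \<le> K * \<bar>x - y\<bar>" by (rule lip) (use x y in auto)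
      also have "\<dots> < K * (\<kappa> * e / K)" using y \<open>K > 0\<close> by (intro mult_strict_left_mono) auto
      finally show "norm (\<Gamma> n x - \<Gamma> n y) < e" using k(1) \<open>K > 0\<close> by simp
    qed
  qed (use in_ball in auto)
  have lim: "(\<lambda>n. \<Gamma> (r n) t) \<longlonglongrightarrow> \<gamma> t" if "t \<in> {0..1}" for t
    unfolding LIMSEQ_iff using \<gamma>(2) that by meson
  show thesis
  proof (rule that[of \<gamma>])
    show "\<gamma> 0 = p" "\<gamma> 1 = q"
      using lim[of 0] lim[of 1] \<Gamma>(1,2) by (auto simp: LIMSEQ_const_iff)
    fix s t :: real assume st: "0 \<le> s" "s \<le> 1" "0 \<le> t" "t \<le> 1"
    have "(\<lambda>n. d (\<Gamma> (r n) s) (\<Gamma> (r n) t)) \<longlonglongrightarrow> d (\<gamma> s) (\<gamma> t)"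
      by (intro tendsto_d lim) (use st in auto)
    moreover have "(\<lambda>n. 1 / real (Suc (r n))) \<longlonglongrightarrow> 0"
      using LIMSEQ_subseq_LIMSEQ[OF LIMSEQ_Suc[OF lim_1_over_n] \<gamma>(1)] by (simp add: o_def)
    then have "(\<lambda>n. (d p q + 1 / real (Suc (r n))) * \<bar>t - s\<bar>) \<longlonglongrightarrow> (d p q + 0) * \<bar>t - s\<bar>"
      by (intro tendsto_intros)
    ultimately show "d (\<gamma> s) (\<gamma> t) \<le> d p q * \<bar>t - s\<bar>"
      using \<Gamma>(3)[of s t] st by (auto intro: LIMSEQ_le)
  qed
qed

end

section \<open>Geodesics and the triangle inequality at the collision\<close>

context subcritical_potential
begin

text \<open>Real version of U, with the default value 0 at the origin.\<close>

definition u :: "'a \<Rightarrow> real" where "u x = enn2real (U x)"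

lemma U_eq: "x \<noteq> 0 \<Longrightarrow> U x = ennreal (u x)"
  using U_finite[of x] by (simp add: u_def less_top)

lemma u_pos: "x \<noteq> 0 \<Longrightarrow> u x > 0"
  using U_pos[of x] U_eq[of x] by (metis ennreal_less_zero_iff)

lemma W_eq: "x \<noteq> 0 \<Longrightarrow> W x = ennreal (sqrt (2 * u x))"
  using u_pos[of x] unfolding W_def U_eq
  by (simp add: ennreal_sqrt_def ennreal_mult_eq_top_iff enn2real_mult)

lemma u_continuous: "continuous_on (- {0}) u"
proof -
  have "continuous_on (- {0}) (\<lambda>x. enn2real (U x))"
    unfolding continuous_on_def
  proof
    fix x :: 'a assume x: "x \<in> - {0}"
    have "(U \<longlongrightarrow> U x) (at x within - {0})"
      using continuous_on_subset[OF U_continuous] x by (auto simp: continuous_on_def)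
    then show "((\<lambda>x. enn2real (U x)) \<longlongrightarrow> enn2real (U x)) (at x within - {0})"
      using U_finite[of x] x by (intro tendsto_enn2real) auto
  qed
  then show ?thesis by (simp add: u_def[abs_def])
qed

lemma minimizing_jm_geodesicI:
  assumes "a < b" "absolutely_continuous_path a b c" "jm.functional a b c \<le> ennreal (d (c a) (c b))"
  shows "minimizing_jm_geodesic V a b c"
  unfolding minimizing_jm_geodesic_def jm_length_eq
proof (intro conjI allI impI assms(1,2))
  show "jm.functional a b c < \<infinity>" using assms(3) by (simp add: le_less_trans)
  fix a' b' \<sigma> assume "a' < b' \<and> absolutely_continuous_path a' b' \<sigma> \<and> \<sigma> a' = c a \<and> \<sigma> b' = c b"
  then have "ennreal (d (c a) (c b)) \<le> jm.functional a' b' \<sigma>"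
    using d_le_functional[of a' b' \<sigma>] by auto
  with assms(3) show "jm.functional a b c \<le> jm.functional a' b' \<sigma>" by simp
qed

lemma geodesic_functional_le:
  assumes "\<And>s t. \<lbrakk>0 \<le> s; s \<le> 1; 0 \<le> t; t \<le> 1\<rbrakk> \<Longrightarrow> d (\<gamma> s) (\<gamma> t) \<le> d p q * \<bar>t - s\<bar>"
  shows "absolutely_continuous_path 0 1 \<gamma>" "jm.functional 0 1 \<gamma> \<le> ennreal (d p q)"
proof -
  have "d (\<gamma> s) (\<gamma> t) \<le> d p q * (t - s)" if "0 \<le> s" "s \<le> t" "t \<le> 1" for s t
    using assms[of s t] that by simp
  from d_lipschitz_path[OF d_nonneg zero_le_one this]
  show "absolutely_continuous_path 0 1 \<gamma>" "jm.functional 0 1 \<gamma> \<le> ennreal (d p q)" by simp_all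
qed

lemma geodesic_avoids_0:
  assumes jm: "jm_marchal_lemma_holds V" and pq: "p \<noteq> 0" "q \<noteq> 0" and \<gamma>: "\<gamma> 0 = p" "\<gamma> 1 = q"
    and lip: "\<And>s t. \<lbrakk>0 \<le> s; s \<le> 1; 0 \<le> t; t \<le> 1\<rbrakk> \<Longrightarrow> d (\<gamma> s) (\<gamma> t) \<le> d p q * \<bar>t - s\<bar>"
    and t: "0 \<le> t" "t \<le> 1"
  shows "\<gamma> t \<noteq> 0"
proof
  assume "\<gamma> t = 0"
  have "minimizing_jm_geodesic V 0 1 \<gamma>"
    using geodesic_functional_le[OF lip] \<gamma> by (intro minimizing_jm_geodesicI) auto
  with jm have "\<not> interior_collision_point V 0 1 \<gamma> 0"
    unfolding jm_marchal_lemma_holds_def by blast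
  moreover have "0 \<in> \<gamma> ` {0..1}" using \<open>\<gamma> t = 0\<close> t by (metis atLeastAtMost_iff imageI)
  ultimately show False
    using pq \<gamma> by (simp add: interior_collision_point_def collision_point_iff)
qed

lemma strict_triangle_at_0:
  assumes jm: "jm_marchal_lemma_holds V" and pq: "p \<noteq> 0" "q \<noteq> 0"
  shows "d p q < d p 0 + d q 0"
proof (rule ccontr)
  assume "\<not> ?thesis"
  then have ge: "d p 0 + d 0 q \<le> d p q" by (simp add: d_sym)
  obtain \<gamma>1 where 1: "\<gamma>1 0 = p" "\<gamma>1 1 = 0"
    "\<And>s t. \<lbrakk>0 \<le> s; s \<le> 1; 0 \<le> t; t \<le> 1\<rbrakk> \<Longrightarrow> d (\<gamma>1 s) (\<gamma>1 t) \<le> d p 0 * \<bar>t - s\<bar>"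
    by (rule geodesic_exists[of p 0]) blast
  obtain \<gamma>2 where 2: "\<gamma>2 0 = 0" "\<gamma>2 1 = q"
    "\<And>s t. \<lbrakk>0 \<le> s; s \<le> 1; 0 \<le> t; t \<le> 1\<rbrakk> \<Longrightarrow> d (\<gamma>2 s) (\<gamma>2 t) \<le> d 0 q * \<bar>t - s\<bar>"
    by (rule geodesic_exists[of 0 q]) blast
  note l1 = geodesic_functional_le[OF 1(3)] and l2 = geodesic_functional_le[OF 2(3)]
  note tr = jm.functional_translate[OF l2(1), of 1, simplified]
  define c where "c = (\<lambda>t. if t \<le> 1 then \<gamma>1 t else \<gamma>2 (t - 1))"
  have c: "absolutely_continuous_path 0 2 c"
    "jm.functional 0 2 c = jm.functional 0 1 \<gamma>1 + jm.functional 1 2 (\<lambda>t. \<gamma>2 (t - 1))"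
    unfolding c_def using jm.functional_join[OF l1(1) tr(1)] 1 2 by auto
  have ends: "c 0 = p" "c 1 = 0" "c 2 = q" using 1 2 by (auto simp: c_def)
  have "jm.functional 0 2 c \<le> ennreal (d p 0) + ennreal (d 0 q)"
    unfolding c(2) tr(2) by (intro add_mono l1(2) l2(2))
  also have "\<dots> = ennreal (d p 0 + d 0 q)" by simp
  also have "\<dots> \<le> ennreal (d p q)" using ge by (rule ennreal_leI)
  finally have "minimizing_jm_geodesic V 0 2 c"
    using c(1) ends by (intro minimizing_jm_geodesicI) auto
  with jm have "\<not> interior_collision_point V 0 2 c 0"
    unfolding jm_marchal_lemma_holds_def by blast
  moreover have "0 \<in> c ` {0..2}" using ends(2) by (intro image_eqI[of _ _ 1]) auto
  ultimately show False
    using pq ends by (simp add: interior_collision_point_def collision_point_iff)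
qed

lemma uniform_gap:
  assumes jm: "jm_marchal_lemma_holds V"
  obtains \<delta> where "\<delta> > 0"
    "\<And>r p q. \<lbrakk>r > 0; norm p = r; norm q = r\<rbrakk> \<Longrightarrow> d p q + \<delta> * r powr \<beta> \<le> d p 0 + d q 0"
proof -
  define f where "f = (\<lambda>z. d (fst z) 0 + d (snd z) 0 - d (fst z) (snd z))"
  let ?S = "sphere (0::'a) 1 \<times> sphere (0::'a) 1"
  have cont: "continuous_on ?S f"
    unfolding f_def
  proof (intro continuous_on_diff continuous_on_add)
    show "continuous_on ?S (\<lambda>z. d (fst z) 0)"
      using continuous_on_compose2[OF d_continuous, of ?S "\<lambda>z. (fst z, 0)"] by (simp add: continuous_intros)
    show "continuous_on ?S (\<lambda>z. d (snd z) 0)"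
      using continuous_on_compose2[OF d_continuous, of ?S "\<lambda>z. (snd z, 0)"] by (simp add: continuous_intros)
    show "continuous_on ?S (\<lambda>z. d (fst z) (snd z))"
      by (rule continuous_on_subset[OF d_continuous]) simp
  qed
  have "?S \<noteq> {}" using sphere_nonempty by simp
  from continuous_attains_inf[OF compact_Times[OF compact_sphere compact_sphere] this cont]
  obtain z where z: "z \<in> ?S" "\<And>y. y \<in> ?S \<Longrightarrow> f z \<le> f y" by blast
  have "f z > 0"
  proof -
    have "fst z \<noteq> 0" "snd z \<noteq> 0" using z(1) by auto
    from strict_triangle_at_0[OF jm this] show ?thesis by (simp add: f_def)
  qed
  show thesis
  proof (rule that[OF \<open>f z > 0\<close>])
    fix r and p q :: 'a assume r: "r > 0" "norm p = r" "norm q = r"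
    define p' q' where "p' = p /\<^sub>R r" "q' = q /\<^sub>R r"
    have "(p', q') \<in> ?S" using r by (simp add: p'_q'_def)
    from z(2)[OF this] have "f z \<le> d p' 0 + d q' 0 - d p' q'" by (simp add: f_def)
    then have "r powr \<beta> * f z \<le> r powr \<beta> * (d p' 0 + d q' 0 - d p' q')"
      by (rule mult_left_mono) simp
    also have "\<dots> = d p 0 + d q 0 - d p q"
      using d_scaleR[OF r(1), of p' 0] d_scaleR[OF r(1), of q' 0] d_scaleR[OF r(1), of p' q'] r(1)
      by (simp add: p'_q'_def algebra_simps)
    finally show "d p q + f z * r powr \<beta> \<le> d p 0 + d q 0" by (simp add: mult.commute)
  qed
qed

section \<open>Zero-energy parametrization and the shortcut\<close>

text \<open>Zero energy means speed \<open>sqrt (2 * u)\<close>, so length is covered at rate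
  \<open>2 * u\<close> per unit of time. The parameter of \<gamma> covers length at rate at most L,
  which suggests the time change T with derivative \<open>L / (2 * u)\<close>. If h inverts it,
  \<open>L * h\<close> has derivative \<open>2 * u\<close>, an upper bound for the Lagrangian, and
  the action is at most \<open>L * h \<tau> - L * h 0 = L\<close>.\<close>

lemma zero_energy_parametrization:
  assumes \<gamma>: "\<gamma> 0 = p" "\<gamma> 1 = q"
    and lip: "\<And>s t. \<lbrakk>0 \<le> s; s \<le> 1; 0 \<le> t; t \<le> 1\<rbrakk> \<Longrightarrow> d (\<gamma> s) (\<gamma> t) \<le> d p q * \<bar>t - s\<bar>"
    and ne: "\<And>t. \<lbrakk>0 \<le> t; t \<le> 1\<rbrakk> \<Longrightarrow> \<gamma> t \<noteq> 0"
  obtains \<tau> \<sigma> where "0 \<le> \<tau>" "absolutely_continuous_path 0 \<tau> \<sigma>" "\<sigma> 0 = p" "\<sigma> \<tau> = q"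
    "lag.functional 0 \<tau> \<sigma> \<le> ennreal (d p q)" "\<And>t. \<lbrakk>0 \<le> t; t \<le> \<tau>\<rbrakk> \<Longrightarrow> \<sigma> t \<in> \<gamma> ` {0..1}"
proof (cases "d p q = 0")
  case True
  \<comment> \<open>At distance zero the lower Lipschitz bound on a ball containing both points
    gives p = q, and a path of duration 0 serves.\<close>
  define R where "R = norm p + norm q + 1"
  have R: "norm p \<le> R" "norm q \<le> R" "R > 0"
    unfolding R_def using norm_ge_zero[of p] norm_ge_zero[of q] by linarith+
  obtain \<kappa> where "\<kappa> > 0" "\<And>x y. \<lbrakk>norm x \<le> R; norm y \<le> R\<rbrakk> \<Longrightarrow> \<kappa> * norm (y - x) \<le> d x y"
    by (rule d_ge_lipschitz[OF R(3)]) blast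
  from this(1) this(2)[OF R(1,2)] True have "p = q"
    by (simp add: mult_le_0_iff)
  show thesis
  proof (rule that[of 0 "\<lambda>_. p"])
    show "absolutely_continuous_path 0 0 (\<lambda>_. p)"
      by (rule absolutely_continuous_path_lipschitz[where K = 0]) simp
    show "lag.functional 0 0 (\<lambda>_. p) \<le> ennreal (d p q)"
      by (simp add: lag.functional_interior)
    show "p \<in> \<gamma> ` {0..1}" if "0 \<le> t" "t \<le> 0" for t :: real
      using \<gamma>(1) by (intro image_eqI[of _ _ 0]) auto
  qed (use \<open>p = q\<close> in auto)
next
  case False
  define L where "L = d p q"
  have "L > 0" using False d_nonneg[of p q] by (simp add: L_def less_le)
  \<comment> \<open>The geodesic is continued by constants over \<open>{-1..2}\<close>, so that 0
    and 1 become interior points and the inverse of the time change has two-sided derivatives at the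
    ends of \<open>{0..\<tau>}\<close>.\<close>
  define cl where "cl = (\<lambda>t::real. max 0 (min 1 t))"
  have cl: "0 \<le> cl t" "cl t \<le> 1" for t by (auto simp: cl_def)
  define g where "g = (\<lambda>t. \<gamma> (cl t))"
  have g_lip: "d (g s) (g t) \<le> L * \<bar>t - s\<bar>" for s t
  proof -
    have "d (g s) (g t) \<le> L * \<bar>cl t - cl s\<bar>"
      unfolding g_def L_def by (rule lip) (use cl in auto)
    also have "\<dots> \<le> L * \<bar>t - s\<bar>"
      using \<open>L > 0\<close> by (intro mult_left_mono) (auto simp: cl_def)
    finally show ?thesis .
  qed
  have g_ne: "g t \<noteq> 0" for t unfolding g_def by (rule ne) (use cl in auto)
  have "absolutely_continuous_path (-1) 2 g"
  proof (rule d_lipschitz_path(1))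
    show "0 \<le> L" using \<open>L > 0\<close> by simp
    show "d (g s) (g t) \<le> L * (t - s)" if "s \<le> t" for s t
      using g_lip[of s t] that by simp
  qed simp
  then have g_cont: "continuous_on {-1..2} g"
    by (rule absolutely_continuous_path_imp_continuous)
  define \<phi> where "\<phi> = (\<lambda>s. L / (2 * u (g s)))"
  have \<phi>_pos: "\<phi> s > 0" for s
    using \<open>L > 0\<close> u_pos[OF g_ne[of s]] by (simp add: \<phi>_def)
  have \<phi>_cont: "continuous_on {-1..2} \<phi>"
  proof -
    have "continuous_on {-1..2} (\<lambda>s. u (g s))"
      by (rule continuous_on_compose2[OF u_continuous g_cont]) (use g_ne in auto)
    then have "continuous_on {-1..2} (\<lambda>s. 2 * u (g s))"
      by (rule continuous_on_mult[OF continuous_on_const])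
    then show ?thesis
      unfolding \<phi>_def
    proof (rule continuous_on_divide[OF continuous_on_const], intro ballI)
      fix s show "2 * u (g s) \<noteq> 0" using u_pos[OF g_ne[of s]] by simp
    qed
  qed
  have "{-1..2::real} \<noteq> {}" by simp
  from continuous_attains_inf[OF compact_Icc this \<phi>_cont]
  obtain s0 where s0: "\<And>s. s \<in> {-1..2} \<Longrightarrow> \<phi> s0 \<le> \<phi> s" by blast
  \<comment> \<open>T grows at least at this positive rate, so it is injective and its inverse is
    Lipschitz with constant 1 / m.\<close>
  define m where "m = \<phi> s0"
  have m: "m > 0" "\<And>s. s \<in> {-1..2} \<Longrightarrow> m \<le> \<phi> s"
    unfolding m_def by (rule \<phi>_pos, rule s0)
  define T where "T = (\<lambda>s. integral {-1..s} \<phi>)"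
  have T_deriv: "(T has_real_derivative \<phi> s) (at s)" if "-1 < s" "s < 2" for s
  proof -
    have "(T has_real_derivative \<phi> s) (at s within {-1..2})"
      unfolding T_def by (rule integral_has_real_derivative[OF \<phi>_cont]) (use that in auto)
    then show ?thesis using that by (simp add: at_within_interior[of s "{-1..2}"])
  qed
  have \<phi>_int: "\<phi> integrable_on {s..t}" if "-1 \<le> s" "t \<le> 2" for s t
    by (rule integrable_continuous_interval) (rule continuous_on_subset[OF \<phi>_cont], use that in auto)
  have T_incr: "m * (t - s) \<le> T t - T s" if "-1 \<le> s" "s \<le> t" "t \<le> 2" for s t
  proof -
    have "T t - T s = integral {s..t} \<phi>"
      using Henstock_Kurzweil_Integration.integral_combine[OF that(1,2) \<phi>_int] that by (simp add: T_def)
    also have "\<dots> \<ge> integral {s..t} (\<lambda>_. m)"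
      by (rule integral_le) (use that \<phi>_int m in auto)
    finally show ?thesis using that by (simp add: mult.commute)
  qed
  have T_cont: "continuous_on {-1..2} T"
    unfolding T_def by (rule indefinite_integral_continuous_1[OF \<phi>_int]) auto
  define \<tau> where "\<tau> = T 1 - T 0"
  have ineqs: "T (-1) < T 0" "T 1 < T 2" "0 < \<tau>"
    using T_incr[of "-1" 0] T_incr[of 1 2] T_incr[of 0 1] m(1) by (auto simp: \<tau>_def)
  let ?J = "{T (-1) - T 0..T 2 - T 0}"
  have "\<exists>s. s \<in> {-1..2} \<and> T s = T 0 + t" if "t \<in> ?J" for t
  proof -
    have "\<exists>s\<ge>-1. s \<le> 2 \<and> T s = T 0 + t"
      by (rule IVT') (use that T_cont in auto)
    then show ?thesis by auto
  qed
  then have "\<forall>t\<in>?J. \<exists>s. s \<in> {-1..2} \<and> T s = T 0 + t"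
    by blast
  from bchoice[OF this] obtain h where "\<forall>t\<in>?J. h t \<in> {-1..2} \<and> T (h t) = T 0 + t" ..
  then have h: "h t \<in> {-1..2}" "T (h t) = T 0 + t" if "t \<in> ?J" for t
    using that by simp_all
  have T_strict: "T s < T t" if "s \<in> {-1..2}" "t \<in> {-1..2}" "s < t" for s t
  proof -
    have "0 < m * (t - s)" using that m(1) by simp
    also have "\<dots> \<le> T t - T s" using that by (intro T_incr) simp_all
    finally show ?thesis by simp
  qed
  have T_inj: "s = t" if "s \<in> {-1..2}" "t \<in> {-1..2}" "T s = T t" for s t
  proof (rule ccontr)
    assume "s \<noteq> t"
    then consider "s < t" | "t < s" by linarith
    then show False
      using T_strict[OF that(1,2)] T_strict[OF that(2,1)] that(3) by cases simp_all
  qed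
  have T_less: "s < t" if "s \<in> {-1..2}" "t \<in> {-1..2}" "T s < T t" for s t
  proof (rule ccontr)
    assume "\<not> s < t"
    then consider "s = t" | "t < s" by linarith
    then show False
      using T_strict[OF that(2,1)] that(3) by cases simp_all
  qed
  have h_lip: "m * \<bar>h t - h s\<bar> \<le> \<bar>t - s\<bar>" if st: "s \<in> ?J" "t \<in> ?J" for s t
  proof -
    have *: "m * (h t - h s) \<le> t - s" if "s \<in> ?J" "t \<in> ?J" "h s \<le> h t" for s t
    proof -
      have "m * (h t - h s) \<le> T (h t) - T (h s)"
        using h(1)[OF that(1)] h(1)[OF that(2)] that(3) by (intro T_incr) simp_all
      then show ?thesis unfolding h(2)[OF that(1)] h(2)[OF that(2)] by simp
    qed
    show ?thesis
    proof (cases "h s \<le> h t")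
      case True
      from *[OF st True] True show ?thesis by simp
    next
      case False
      then have "h t \<le> h s" by simp
      from *[OF st(2,1) this] False show ?thesis by simp
    qed
  qed
  have J: "0 \<in> ?J" "\<tau> \<in> ?J" using ineqs by (auto simp: \<tau>_def)
  have h0: "h 0 = 0" by (rule T_inj) (use h[OF J(1)] in auto)
  have h1: "h \<tau> = 1" by (rule T_inj) (use h[OF J(2)] in \<open>auto simp: \<tau>_def\<close>)
  have h_cont: "continuous_on ?J h"
    unfolding continuous_on_iff
  proof (intro ballI allI impI)
    fix x e assume x: "x \<in> ?J" "(0::real) < e"
    show "\<exists>\<delta>>0. \<forall>y\<in>?J. dist y x < \<delta> \<longrightarrow> dist (h y) (h x) < e"
    proof (intro exI[of _ "m * e"] conjI ballI impI)
      show "0 < m * e" using m x by simp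
      fix y assume y: "y \<in> ?J" "dist y x < m * e"
      have "m * \<bar>h y - h x\<bar> < m * e" using h_lip[OF x(1) y(1)] y(2) by (simp add: dist_real_def)
      then show "dist (h y) (h x) < e" using m(1) by (simp add: dist_real_def)
    qed
  qed
  have h_deriv: "(h has_real_derivative (2 * u (g (h t)) / L)) (at t)"
    if t: "T (-1) - T 0 < t" "t < T 2 - T 0" for t
  proof -
    have tJ: "t \<in> ?J" using t by auto
    have ht: "-1 < h t" "h t < 2"
      using T_less[of "-1" "h t"] T_less[of "h t" 2] h[OF tJ] t by auto
    have "((\<lambda>s. T s - T 0) has_real_derivative \<phi> (h t)) (at (h t))"
      using T_deriv[OF ht] by (auto intro!: derivative_eq_intros)
    then have "(h has_real_derivative inverse (\<phi> (h t))) (at t)"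
    proof (rule DERIV_inverse_function)
      show "\<phi> (h t) \<noteq> 0" using \<phi>_pos[of "h t"] by simp
      show "T (-1) - T 0 < t" "t < T 2 - T 0" by fact+
      show "T (h y) - T 0 = y" if "T (-1) - T 0 < y" "y < T 2 - T 0" for y
        using h(2)[of y] that by simp
      show "isCont h t"
        using h_cont t by (intro continuous_on_interior[OF h_cont]) auto
    qed
    then show ?thesis by (simp add: \<phi>_def)
  qed
  define \<sigma> where "\<sigma> = (\<lambda>t. g (h t))"
  have in_J: "t \<in> ?J" "T (-1) - T 0 < t" "t < T 2 - T 0" if "0 \<le> t" "t \<le> \<tau>" for t
    using that ineqs by (auto simp: \<tau>_def)
  have \<sigma>_le: "d (\<sigma> s) (\<sigma> t) \<le> L * \<bar>h t - h s\<bar>" for s t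
    unfolding \<sigma>_def by (rule g_lip)
  have ac: "absolutely_continuous_path 0 \<tau> \<sigma>"
  proof (rule d_lipschitz_path(1))
    show "0 \<le> L / m" using \<open>L > 0\<close> m by simp
    fix s t assume st: "0 \<le> s" "s \<le> t" "t \<le> \<tau>"
    have "L * \<bar>h t - h s\<bar> \<le> L * ((t - s) / m)"
      using h_lip[of s t] in_J(1)[of s] in_J(1)[of t] st \<open>L > 0\<close> m(1)
      by (intro mult_left_mono) (auto simp: field_simps)
    with \<sigma>_le[of s t] show "d (\<sigma> s) (\<sigma> t) \<le> L / m * (t - s)" by simp
  qed (use ineqs in simp)
  \<comment> \<open>\<open>speed_bound\<close> for the function \<open>L * h\<close> bounds the
    speed by \<open>sqrt (2 * u)\<close>. The kinetic part is then at most u and the Lagrangian at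
    most \<open>2 * u\<close>.\<close>
  have speed: "lagrangian V (\<sigma> t) v \<le> ennreal (2 * u (\<sigma> t))"
    if t: "0 < t" "t < \<tau>" and v: "(\<sigma> has_vector_derivative v) (at t)" for t v
  proof -
    have ne_t: "\<sigma> t \<noteq> 0" by (simp add: \<sigma>_def g_ne)
    have H: "((\<lambda>t. L * h t) has_real_derivative 2 * u (\<sigma> t)) (at t)"
      using h_deriv[OF in_J(2,3)[of t]] t \<open>L > 0\<close> unfolding \<sigma>_def
      by (auto intro!: derivative_eq_intros)
    have "\<forall>\<^sub>F s in at t. d (\<sigma> t) (\<sigma> s) \<le> \<bar>L * h s - L * h t\<bar>"
    proof (rule always_eventually, rule allI)
      fix s
      have "\<bar>L * h s - L * h t\<bar> = L * \<bar>h s - h t\<bar>"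
        using \<open>L > 0\<close> by (simp add: abs_mult flip: right_diff_distrib)
      then show "d (\<sigma> t) (\<sigma> s) \<le> \<bar>L * h s - L * h t\<bar>" using \<sigma>_le[of t s] by simp
    qed
    from speed_bound[OF v H this] have "ennreal (sqrt (2 * u (\<sigma> t)) * norm v) \<le> ennreal (2 * u (\<sigma> t))"
      using u_pos[OF ne_t] by (simp add: W_eq[OF ne_t] ennreal_mult)
    then have "sqrt (2 * u (\<sigma> t)) * norm v \<le> sqrt (2 * u (\<sigma> t)) * sqrt (2 * u (\<sigma> t))"
      using u_pos[OF ne_t] by (simp add: ennreal_le_iff)
    then have "norm v \<le> sqrt (2 * u (\<sigma> t))"
      by (rule mult_left_le_imp_le) (use u_pos[OF ne_t] in simp)
    then have "(norm v)\<^sup>2 \<le> (sqrt (2 * u (\<sigma> t)))\<^sup>2"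
      by (intro power_mono) auto
    then have "(norm v)\<^sup>2 / 2 + u (\<sigma> t) \<le> 2 * u (\<sigma> t)"
      using u_pos[OF ne_t] by simp
    then show ?thesis
      unfolding lagrangian_def U_eq[OF ne_t] using u_pos[OF ne_t]
      by (simp add: ennreal_leI flip: ennreal_plus)
  qed
  have "lag.functional 0 \<tau> \<sigma> \<le> (\<integral>\<^sup>+t. ennreal (2 * u (\<sigma> t)) * indicator {0..\<tau>} t \<partial>lebesgue)"
    unfolding lag.functional_interior
  proof (rule nn_integral_mono_AE)
    show "AE t in lebesgue. lagrangian V (\<sigma> t) (vector_derivative \<sigma> (at t)) * indicator {0<..<\<tau>} t
        \<le> ennreal (2 * u (\<sigma> t)) * indicator {0..\<tau>} t"
      using absolutely_continuous_path_AE_differentiable[OF ac]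
    proof eventually_elim
      case (elim t)
      show ?case
      proof (cases "t \<in> {0<..<\<tau>}")
        case True
        with elim show ?thesis using speed[of t "vector_derivative \<sigma> (at t)"]
          by (simp add: vector_derivative_works)
      next
        case False
        then show ?thesis by (simp only: indicator_simps(2)[OF False]) simp
      qed
    qed
  qed
  also have "\<dots> = (\<integral>\<^sup>+t. ennreal (2 * u (\<sigma> t)) * indicator {0..\<tau>} t \<partial>lborel)"
    by (rule nn_integral_completion)
  also have "\<dots> = ennreal L"
  proof (rule nn_integral_has_integral_lebesgue')
    show "0 \<le> 2 * u (\<sigma> t)" for t by (simp add: u_def)
    have "((\<lambda>t. 2 * u (\<sigma> t)) has_integral (L * h \<tau> - L * h 0)) {0..\<tau>}"
    proof (rule fundamental_theorem_of_calculus)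
      fix t assume "t \<in> {0..\<tau>}"
      then have "(h has_real_derivative (2 * u (g (h t)) / L)) (at t)"
        by (intro h_deriv in_J) auto
      then have "((\<lambda>t. L * h t) has_real_derivative 2 * u (\<sigma> t)) (at t)"
        using \<open>L > 0\<close> unfolding \<sigma>_def by (auto intro!: derivative_eq_intros)
      then show "((\<lambda>t. L * h t) has_vector_derivative 2 * u (\<sigma> t)) (at t within {0..\<tau>})"
        by (simp add: has_real_derivative_iff_has_vector_derivative has_vector_derivative_at_within)
    qed (use ineqs in simp)
    then show "((\<lambda>t. 2 * u (\<sigma> t)) has_integral L) {0..\<tau>}" by (simp add: h0 h1)
  qed
  finally have act: "lag.functional 0 \<tau> \<sigma> \<le> ennreal (d p q)" by (simp add: L_def)
  show thesis
  proof (rule that[OF _ ac _ _ act])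
    show "0 \<le> \<tau>" using ineqs by simp
    show "\<sigma> 0 = p" "\<sigma> \<tau> = q" using \<gamma> by (auto simp: \<sigma>_def h0 h1 g_def cl_def)
    show "\<sigma> t \<in> \<gamma> ` {0..1}" for t
      unfolding \<sigma>_def g_def using cl by auto
  qed
qed

text \<open>Collects what the surgery needs, with constants independent of r, p and q. The shortcut
  stays in a ball of radius proportional to r: its \<open>d\<close>-distance to the origin is at
  most a constant times \<open>r powr \<beta>\<close>, and by \<open>d_to_0_ge\<close> this distance
  dominates the same power of the norm. Hence the potential is large along the shortcut too when r
  is small.\<close>

lemma shortcut:
  assumes jm: "jm_marchal_lemma_holds V"
  obtains \<delta> C \<rho> where "\<delta> > 0" "C > 0" "\<rho> \<ge> 1"
    "\<And>r p q. \<lbrakk>r > 0; norm p = r; norm q = r\<rbrakk> \<Longrightarrow>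
      \<exists>\<tau> \<sigma>. 0 \<le> \<tau> \<and> absolutely_continuous_path 0 \<tau> \<sigma> \<and> \<sigma> 0 = p \<and> \<sigma> \<tau> = q \<and>
        lag.functional 0 \<tau> \<sigma> \<le> ennreal (d p q) \<and> (\<forall>t. 0 \<le> t \<and> t \<le> \<tau> \<longrightarrow> norm (\<sigma> t) \<le> \<rho> * r) \<and>
        d p q \<le> C * r powr \<beta> \<and> d p q + \<delta> * r powr \<beta> \<le> d p 0 + d q 0"
proof -
  obtain \<delta> where \<delta>: "\<delta> > 0"
    "\<And>r p q. \<lbrakk>r > 0; norm p = r; norm q = r\<rbrakk> \<Longrightarrow> d p q + \<delta> * r powr \<beta> \<le> d p 0 + d q 0"
    by (rule uniform_gap[OF jm]) blast
  obtain C where C: "C > 0" "\<And>y. D y 0 \<le> ennreal (C * norm y powr \<beta>)"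
    by (rule D_to_0_le) blast
  have C': "d y 0 \<le> C * norm y powr \<beta>" for y
    using C(2)[of y] C(1) by (simp add: D_eq ennreal_le_iff)
  obtain k where k: "k > 0" "\<And>x. k * norm x powr \<beta> \<le> d x 0"
    by (rule d_to_0_ge) blast
  \<comment> \<open>The 3 counts three terms of size \<open>C * r powr \<beta>\<close>, two from
    \<open>d p q\<close> and one from \<open>d p 0\<close>. The maximum with 1 makes the ball of
    radius \<open>\<rho> * r\<close> contain that of radius r.\<close>
  define \<rho> where "\<rho> = max 1 ((3 * C / k) powr (1 / \<beta>))"
  have \<rho>\<beta>: "3 * C / k \<le> \<rho> powr \<beta>"
  proof -
    have "3 * C / k = ((3 * C / k) powr (1 / \<beta>)) powr \<beta>"
      using C k \<beta>_pos by (simp add: powr_powr)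
    also have "\<dots> \<le> \<rho> powr \<beta>"
      using \<beta>_pos by (intro powr_mono2) (auto simp: \<rho>_def)
    finally show ?thesis .
  qed
  show thesis
  proof (rule that[of \<delta> "2 * C" \<rho>])
    show "\<delta> > 0" "2 * C > 0" "\<rho> \<ge> 1" using \<delta> C by (auto simp: \<rho>_def)
    fix r and p q :: 'a assume r: "r > 0" "norm p = r" "norm q = r"
    then have pq: "p \<noteq> 0" "q \<noteq> 0" by auto
    obtain \<gamma> where \<gamma>: "\<gamma> 0 = p" "\<gamma> 1 = q"
      and lip: "\<And>s t. \<lbrakk>0 \<le> s; s \<le> 1; 0 \<le> t; t \<le> 1\<rbrakk> \<Longrightarrow> d (\<gamma> s) (\<gamma> t) \<le> d p q * \<bar>t - s\<bar>"
      by (rule geodesic_exists[of p q]) blast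
    have avoid: "\<gamma> t \<noteq> 0" if "0 \<le> t" "t \<le> 1" for t
      by (rule geodesic_avoids_0[OF jm pq \<gamma> lip that])
    obtain \<tau> \<sigma> where \<sigma>: "0 \<le> \<tau>" "absolutely_continuous_path 0 \<tau> \<sigma>" "\<sigma> 0 = p" "\<sigma> \<tau> = q"
      "lag.functional 0 \<tau> \<sigma> \<le> ennreal (d p q)" "\<And>t. \<lbrakk>0 \<le> t; t \<le> \<tau>\<rbrakk> \<Longrightarrow> \<sigma> t \<in> \<gamma> ` {0..1}"
      by (rule zero_energy_parametrization[OF \<gamma> lip avoid]) auto
    have dpq: "d p q \<le> 2 * C * r powr \<beta>"
      using d_triangle[of p q 0] C'[of p] C'[of q] r by (simp add: d_sym[of 0])
    have "norm (\<sigma> t) \<le> \<rho> * r" if t: "0 \<le> t" "t \<le> \<tau>" for t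
    proof (rule ccontr)
      assume "\<not> ?thesis"
      then have "(\<rho> * r) powr \<beta> < norm (\<sigma> t) powr \<beta>"
        using r(1) \<beta>_pos by (intro powr_less_mono2) (auto simp: \<rho>_def)
      then have "\<rho> powr \<beta> * r powr \<beta> < norm (\<sigma> t) powr \<beta>"
        using r(1) by (simp add: powr_mult \<rho>_def)
      moreover have "3 * C / k * r powr \<beta> \<le> \<rho> powr \<beta> * r powr \<beta>"
        using \<rho>\<beta> by (rule mult_right_mono) simp
      ultimately have "3 * C / k * r powr \<beta> < norm (\<sigma> t) powr \<beta>" by simp
      then have "3 * C * r powr \<beta> < k * norm (\<sigma> t) powr \<beta>"
        using k(1) by (simp add: field_simps)
      also have "\<dots> \<le> d (\<sigma> t) 0" by (rule k(2))
      also have "\<dots> \<le> d (\<sigma> t) p + d p 0" by (rule d_triangle)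
      also have "d (\<sigma> t) p \<le> d p q"
      proof -
        obtain s where s: "\<sigma> t = \<gamma> s" "0 \<le> s" "s \<le> 1" using \<sigma>(6)[OF t] by auto
        have "d (\<sigma> t) p \<le> d p q * \<bar>0 - s\<bar>"
          using lip[of s 0] s \<gamma> by simp
        also have "\<dots> \<le> d p q * 1" using s by (intro mult_left_mono) auto
        finally show ?thesis by simp
      qed
      finally show False using dpq C'[of p] r by simp
    qed
    note bound = this
    show "\<exists>\<tau> \<sigma>. 0 \<le> \<tau> \<and> absolutely_continuous_path 0 \<tau> \<sigma> \<and> \<sigma> 0 = p \<and> \<sigma> \<tau> = q \<and>
        lag.functional 0 \<tau> \<sigma> \<le> ennreal (d p q) \<and> (\<forall>t. 0 \<le> t \<and> t \<le> \<tau> \<longrightarrow> norm (\<sigma> t) \<le> \<rho> * r) \<and>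
        d p q \<le> 2 * C * r powr \<beta> \<and> d p q + \<delta> * r powr \<beta> \<le> d p 0 + d q 0"
      by (rule exI[of _ \<tau>], rule exI[of _ \<sigma>]) (simp add: \<sigma>(1-5) dpq \<delta>(2)[OF r] bound)
  qed
qed

end

section \<open>Removing collisions from minimizers\<close>

text \<open>The latest crossing of the level r exists by compactness; by the intermediate value
  theorem a larger value after it would produce a later crossing.\<close>

lemma last_time_above:
  fixes f :: "real \<Rightarrow> real"
  assumes cont: "continuous_on {a..b} f" and "a \<le> b" "r \<le> f a" "f b \<le> r"
  obtains t where "a \<le> t" "t \<le> b" "f t = r" "\<And>s. \<lbrakk>t \<le> s; s \<le> b\<rbrakk> \<Longrightarrow> f s \<le> r"
proof -
  define S where "S = {t \<in> {a..b}. f t = r}"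
  have "\<exists>t\<ge>a. t \<le> b \<and> f t = r"
    by (rule IVT2') (use assms in auto)
  then have "S \<noteq> {}" by (auto simp: S_def)
  have "closed S"
    unfolding S_def by (rule continuous_closed_preimage_constant[OF cont]) simp
  moreover have "bounded S"
    by (rule bounded_subset[OF bounded_closed_interval[of a b]]) (auto simp: S_def)
  ultimately have "compact S" by (simp add: compact_eq_bounded_closed)
  from compact_attains_sup[OF this \<open>S \<noteq> {}\<close>] obtain t where t: "t \<in> S" "\<And>s. s \<in> S \<Longrightarrow> s \<le> t"
    by blast
  then have t': "a \<le> t" "t \<le> b" "f t = r" by (auto simp: S_def)
  have "f s \<le> r" if s: "t \<le> s" "s \<le> b" for s
  proof (rule ccontr)
    assume "\<not> f s \<le> r"
    then have gt: "r < f s" by simp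
    have "\<exists>v\<ge>s. v \<le> b \<and> f v = r"
      by (rule IVT2') (use gt assms s t' in \<open>auto intro: continuous_on_subset[OF cont]\<close>)
    then obtain v where v: "s \<le> v" "v \<le> b" "f v = r" by blast
    with s t' have "v \<in> S" by (simp add: S_def)
    with t(2) v s have "v = s" by force
    with v gt show False by simp
  qed
  with t' show thesis by (rule that)
qed

lemma first_time_above:
  fixes f :: "real \<Rightarrow> real"
  assumes cont: "continuous_on {a..b} f" and "a \<le> b" "f a \<le> r" "r \<le> f b"
  obtains t where "a \<le> t" "t \<le> b" "f t = r" "\<And>s. \<lbrakk>a \<le> s; s \<le> t\<rbrakk> \<Longrightarrow> f s \<le> r"
proof -
  have "continuous_on {- b..- a} (\<lambda>t. f (- t))"
    by (rule continuous_on_compose2[OF cont]) (auto intro: continuous_intros)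
  then obtain t where t: "- b \<le> t" "t \<le> - a" "f (- t) = r" "\<And>s. \<lbrakk>t \<le> s; s \<le> - a\<rbrakk> \<Longrightarrow> f (- s) \<le> r"
    by (rule last_time_above[of "- b" "- a" "\<lambda>t. f (- t)" r]) (use assms in auto)
  show thesis
  proof (rule that[of "- t"])
    fix s assume "a \<le> s" "s \<le> - t"
    with t(4)[of "- s"] show "f s \<le> r" by simp
  qed (use t in auto)
qed

section \<open>Durations and changes of time\<close>

context homogeneous_potential
begin

text \<open>Turns a bound on the action into a bound on the time spent where U is at least
  M.\<close>

lemma lag_functional_ge_time:
  assumes "a \<le> b" "M \<ge> 0" "\<And>t. \<lbrakk>a < t; t < b\<rbrakk> \<Longrightarrow> ennreal M \<le> U (c t)"
  shows "ennreal (M * (b - a)) \<le> lag.functional a b c"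
proof -
  have "ennreal (M * (b - a)) = ennreal M * emeasure lebesgue {a<..<b}"
    using assms(1,2) by (simp add: ennreal_mult)
  also have "\<dots> = (\<integral>\<^sup>+t\<in>{a<..<b}. ennreal M \<partial>lebesgue)"
    by (rule nn_integral_cmult_indicator[symmetric]) simp
  also have "\<dots> \<le> lag.functional a b c"
    unfolding lag.functional_interior
  proof (rule nn_integral_mono)
    fix t
    show "ennreal M * indicator {a<..<b} t
      \<le> lagrangian V (c t) (vector_derivative c (at t)) * indicator {a<..<b} t"
      using assms(3)[of t] by (auto simp: indicator_def lagrangian_def intro: add_increasing)
  qed
  finally show ?thesis .
qed

text \<open>The kinetic part is multiplied by \<open>\<kappa>\<^sup>2\<close> and the potential part
  by 1; both factors are at most \<open>\<kappa> * max \<kappa> (1 / \<kappa>)\<close>. The outer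
  factor \<kappa> is kept apart because the substitution of time cancels it.\<close>

lemma lagrangian_scaleR_le:
  assumes "\<kappa> > 0"
  shows "lagrangian V q (\<kappa> *\<^sub>R v) \<le> ennreal \<kappa> * (ennreal (max \<kappa> (1 / \<kappa>)) * lagrangian V q v)"
proof -
  let ?m = "max \<kappa> (1 / \<kappa>)"
  have m: "0 \<le> ?m" "\<kappa> * \<kappa> \<le> \<kappa> * ?m" "1 \<le> \<kappa> * ?m"
  proof -
    show "0 \<le> ?m" using assms by simp
    show "\<kappa> * \<kappa> \<le> \<kappa> * ?m" using assms by (intro mult_left_mono) auto
    have "\<kappa> * (1 / \<kappa>) \<le> \<kappa> * ?m" using assms by (intro mult_left_mono) auto
    then show "1 \<le> \<kappa> * ?m" using assms by simp
  qed
  have "(norm (\<kappa> *\<^sub>R v))\<^sup>2 / 2 = \<kappa> * \<kappa> * ((norm v)\<^sup>2 / 2)"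
    by (simp add: power2_eq_square mult_ac)
  also have "\<dots> \<le> \<kappa> * ?m * ((norm v)\<^sup>2 / 2)"
    using m(2) by (rule mult_right_mono) simp
  finally have "ennreal ((norm (\<kappa> *\<^sub>R v))\<^sup>2 / 2) \<le> ennreal (\<kappa> * ?m) * ennreal ((norm v)\<^sup>2 / 2)"
    using assms m(1) by (simp add: ennreal_leI flip: ennreal_mult)
  moreover have "1 * U q \<le> ennreal (\<kappa> * ?m) * U q"
    using m(3) by (intro mult_right_mono) (simp_all flip: ennreal_1 add: ennreal_leI)
  ultimately have "lagrangian V q (\<kappa> *\<^sub>R v) \<le> ennreal (\<kappa> * ?m) * lagrangian V q v"
    unfolding lagrangian_def distrib_left by (intro add_mono) simp_all
  then show ?thesis
    using assms m(1) by (simp add: ennreal_mult mult.assoc)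
qed

lemma lag_functional_time_change:
  assumes ac: "absolutely_continuous_path a b c" and "a < b" "a' < b'"
  defines "\<kappa> \<equiv> (b - a) / (b' - a')"
  shows "absolutely_continuous_path a' b' (\<lambda>t. c (\<kappa> * t + (a - \<kappa> * a')))"
    "lag.functional a' b' (\<lambda>t. c (\<kappa> * t + (a - \<kappa> * a'))) \<le> ennreal (max \<kappa> (1 / \<kappa>)) * lag.functional a b c"
proof -
  have "\<kappa> > 0" using assms by simp
  have b: "\<kappa> * b' + (a - \<kappa> * a') = b"
  proof -
    have "\<kappa> * (b' - a') = b - a" using assms by simp
    then show ?thesis by (simp add: algebra_simps)
  qed
  have lo: "a < \<kappa> * t + (a - \<kappa> * a') \<longleftrightarrow> a' < t" "a \<le> \<kappa> * t + (a - \<kappa> * a') \<longleftrightarrow> a' \<le> t" for t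
    using \<open>\<kappa> > 0\<close> by simp_all
  have hi: "\<kappa> * t + (a - \<kappa> * a') < b \<longleftrightarrow> t < b'" "\<kappa> * t + (a - \<kappa> * a') \<le> b \<longleftrightarrow> t \<le> b'" for t
    using \<open>\<kappa> > 0\<close> unfolding b[symmetric] by simp_all
  have maps: "t \<in> {a'<..<b'} \<longleftrightarrow> \<kappa> * t + (a - \<kappa> * a') \<in> {a<..<b}"
    "t \<in> {a'..b'} \<Longrightarrow> \<kappa> * t + (a - \<kappa> * a') \<in> {a..b}" for t
    unfolding greaterThanLessThan_iff atLeastAtMost_iff lo hi by auto
  have "\<kappa> \<noteq> 0" using \<open>\<kappa> > 0\<close> by simp
  note aff = lag.functional_affine'[OF ac this maps]
  show "absolutely_continuous_path a' b' (\<lambda>t. c (\<kappa> * t + (a - \<kappa> * a')))"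
    by (rule aff(1))
  let ?F = "lag.functional a' b' (\<lambda>t. c (\<kappa> * t + (a - \<kappa> * a')))"
  let ?m = "max \<kappa> (1 / \<kappa>)"
  have "ennreal \<kappa> * ?F = (\<integral>\<^sup>+t\<in>{a<..<b}. lagrangian V (c t) (\<kappa> *\<^sub>R vector_derivative c (at t)) \<partial>lebesgue)"
    using aff(2) \<open>\<kappa> > 0\<close> by simp
  also have "\<dots> \<le> (\<integral>\<^sup>+t. (ennreal \<kappa> * ennreal ?m) *
      (lagrangian V (c t) (vector_derivative c (at t)) * indicator {a<..<b} t) \<partial>lebesgue)"
    by (rule nn_integral_mono)
      (use lagrangian_scaleR_le[OF \<open>\<kappa> > 0\<close>] in \<open>auto simp: indicator_def mult.assoc\<close>)
  also have "\<dots> = (ennreal \<kappa> * ennreal ?m) * lag.functional a b c"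
    unfolding lag.functional_interior by (rule nn_integral_cmult[OF lag.functional_measurable[OF ac]])
  finally have "ennreal (1 / \<kappa>) * (ennreal \<kappa> * ?F) \<le> ennreal (1 / \<kappa>) * (ennreal \<kappa> * (ennreal ?m * lag.functional a b c))"
    unfolding mult.assoc by (rule mult_left_mono) simp
  moreover have "ennreal (1 / \<kappa>) * ennreal \<kappa> = 1"
    using \<open>\<kappa> > 0\<close> by (simp flip: ennreal_mult)
  ultimately show "?F \<le> ennreal ?m * lag.functional a b c"
    by (simp only: mult.assoc[symmetric] mult_1_left)
qed

lemma supercritical_no_collision:
  assumes "\<beta> \<le> 0" "absolutely_continuous_path 0 T c" "lag.functional 0 T c < \<infinity>" "c 0 \<noteq> 0" "0 \<le> t" "t \<le> T"
  shows "c t \<noteq> 0"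
proof
  assume "c t = 0"
  have "D (c 0) (c t) \<le> jm.functional 0 t c"
    using assms by (intro D_le_subpath[OF assms(2)]) auto
  also have "\<dots> \<le> lag.functional 0 t c" by (rule jm_le_action)
  also have "\<dots> \<le> lag.functional 0 T c"
    using assms by (intro lag.functional_subinterval_le[OF assms(2)]) auto
  also have "\<dots> < \<infinity>" by fact
  finally show False
    using D_to_0_infinite[OF assms(1,4)] \<open>c t = 0\<close> by simp
qed

end

section \<open>The surgery at a collision\<close>

context subcritical_potential
begin

lemma no_interior_collision:
  assumes jm: "jm_marchal_lemma_holds V"
    and ac: "absolutely_continuous_path 0 T c" and fin: "lag.functional 0 T c < \<infinity>"
    and minimal: "\<And>\<sigma>. \<lbrakk>absolutely_continuous_path 0 T \<sigma>; \<sigma> 0 = c 0; \<sigma> T = c T\<rbrakk>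
      \<Longrightarrow> lag.functional 0 T c \<le> lag.functional 0 T \<sigma>"
    and ends: "c 0 \<noteq> 0" "c T \<noteq> 0" and x: "0 \<le> x" "x \<le> T" "c x = 0"
  shows False
proof -
  obtain \<delta> C \<rho> where pos: "\<delta> > 0" "C > 0" "\<rho> \<ge> 1" and short:
    "\<And>r p q. \<lbrakk>r > 0; norm p = r; norm q = r\<rbrakk> \<Longrightarrow>
      \<exists>\<tau> \<sigma>. 0 \<le> \<tau> \<and> absolutely_continuous_path 0 \<tau> \<sigma> \<and> \<sigma> 0 = p \<and> \<sigma> \<tau> = q \<and>
        lag.functional 0 \<tau> \<sigma> \<le> ennreal (d p q) \<and> (\<forall>t. 0 \<le> t \<and> t \<le> \<tau> \<longrightarrow> norm (\<sigma> t) \<le> \<rho> * r) \<and>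
        d p q \<le> C * r powr \<beta> \<and> d p q + \<delta> * r powr \<beta> \<le> d p 0 + d q 0"
    by (rule shortcut[OF jm]) blast
  have cont: "continuous_on {0..T} (\<lambda>t. norm (c t))"
    by (intro continuous_intros absolutely_continuous_path_imp_continuous[OF ac])
  have x': "0 < x" "x < T" using x ends by (auto simp: less_le)
  obtain A where A: "lag.functional 0 T c = ennreal A" "A \<ge> 0"
    using fin by (cases "lag.functional 0 T c") auto
  \<comment> \<open>During the last \<eta> units of time the path stays farther than
    \<open>norm (c T) / 2\<close> from the origin. The tail after the ball of radius r is left
    therefore lasts longer than \<eta>, however small r is.\<close>
  obtain \<eta> where \<eta>: "\<eta> > 0" "\<And>t. \<lbrakk>0 \<le> t; t \<le> T; T - \<eta> \<le> t\<rbrakk> \<Longrightarrow> norm (c T) / 2 < norm (c t)"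
  proof -
    have "\<exists>\<delta>>0. \<forall>t\<in>{0..T}. dist t T < \<delta> \<longrightarrow> dist (norm (c t)) (norm (c T)) < norm (c T) / 2"
      using cont[unfolded continuous_on_iff, rule_format, of T "norm (c T) / 2"] x ends(2) by simp
    then obtain \<delta> where \<delta>: "\<delta> > 0" "\<And>t. \<lbrakk>t \<in> {0..T}; dist t T < \<delta>\<rbrakk> \<Longrightarrow> dist (norm (c t)) (norm (c T)) < norm (c T) / 2"
      by blast
    show thesis
    proof (rule that[of "\<delta> / 2"])
      fix t assume "0 \<le> t" "t \<le> T" "T - \<delta> / 2 \<le> t"
      then have "dist (norm (c t)) (norm (c T)) < norm (c T) / 2"
        using \<delta>(1) by (intro \<delta>(2)) (auto simp: dist_real_def)
      then show "norm (c T) / 2 < norm (c t)" unfolding dist_real_def by linarith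
    qed (use \<delta>(1) in simp)
  qed
  \<comment> \<open>Price of the time correction per unit of changed duration: 2 / \<eta> governs
    the factor by which time is changed, and A bounds the action that is affected.\<close>
  define K where "K = 2 * A / \<eta>"
  \<comment> \<open>In the final estimate the excess g appears with factor \<epsilon> and the length
    L with factor 2 \<epsilon>. The bound 1 / 2 absorbs the former, and
    \<open>\<delta> / (8 * C)\<close> then leaves at most half of the gap for the latter.\<close>
  define \<epsilon> where "\<epsilon> = min (1 / 2) (\<delta> / (8 * C))"
  have \<epsilon>: "\<epsilon> > 0" "\<epsilon> \<le> 1 / 2" "8 * C * \<epsilon> \<le> \<delta>"
  proof -
    show "\<epsilon> > 0" "\<epsilon> \<le> 1 / 2" using pos by (auto simp: \<epsilon>_def)
    have "8 * C * \<epsilon> \<le> 8 * C * (\<delta> / (8 * C))" using pos by (intro mult_left_mono) (auto simp: \<epsilon>_def)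
    then show "8 * C * \<epsilon> \<le> \<delta>" using pos by simp
  qed
  \<comment> \<open>Required strength of the potential: \<open>K / \<epsilon>\<close> makes the
    change of duration cheap compared with the actions, and \<open>2 * C / \<eta>\<close> keeps the
    duration of the shortcut at most \<eta> / 2.\<close>
  define M where "M = max 1 (max (K / \<epsilon>) (2 * C / \<eta>))"
  have "K \<ge> 0" using A \<eta> by (simp add: K_def)
  have M: "M \<ge> 1" "K \<le> \<epsilon> * M" "C \<le> M * (\<eta> / 2)"
  proof -
    show "M \<ge> 1" by (simp add: M_def)
    have "K / \<epsilon> \<le> M" "2 * C / \<eta> \<le> M" by (auto simp: M_def)
    then show "K \<le> \<epsilon> * M" "C \<le> M * (\<eta> / 2)" using \<epsilon>(1) \<eta>(1) by (auto simp: field_simps)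
  qed
  obtain r0 where r0: "r0 > 0" "\<And>q. norm q \<le> r0 \<Longrightarrow> ennreal M \<le> U q"
    by (rule U_large_near_0) blast
  \<comment> \<open>The bound \<open>r0 / \<rho>\<close> keeps the whole shortcut where U is at
    least M, and 1 serves to bound \<open>r powr \<beta>\<close>. The norms of the end points make
    the path cross the sphere before and after the collision; half of the norm at T keeps t2 out of
    the last \<eta> units of time.\<close>
  define r where "r = min (min 1 (r0 / \<rho>)) (min (norm (c 0)) (norm (c T) / 2))"
  have r: "r > 0" "r \<le> 1" "\<rho> * r \<le> r0" "r \<le> r0" "r \<le> norm (c 0)" "r \<le> norm (c T) / 2"
  proof -
    show "r > 0" using r0 pos(3) ends by (auto simp: r_def)
    show "r \<le> 1" "r \<le> norm (c 0)" by (auto simp: r_def)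
    show "r \<le> norm (c T) / 2" unfolding r_def by (rule min.coboundedI2, rule min.cobounded2)
    have "\<rho> * r \<le> \<rho> * (r0 / \<rho>)" using pos(3) by (intro mult_left_mono) (auto simp: r_def)
    then show "\<rho> * r \<le> r0" using pos(3) by simp
    moreover have "1 * r \<le> \<rho> * r" using pos(3) \<open>r > 0\<close> by (intro mult_right_mono) auto
    ultimately show "r \<le> r0" by simp
  qed
  obtain t1 where t1: "0 \<le> t1" "t1 \<le> x" "norm (c t1) = r" "\<And>s. \<lbrakk>t1 \<le> s; s \<le> x\<rbrakk> \<Longrightarrow> norm (c s) \<le> r"
    by (rule last_time_above[of 0 x "\<lambda>t. norm (c t)" r])
      (use x r in \<open>auto intro: continuous_on_subset[OF cont]\<close>)
  have r_T: "r \<le> norm (c T)"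
    using r(6) norm_ge_zero[of "c T"] by linarith
  obtain t2 where t2: "x \<le> t2" "t2 \<le> T" "norm (c t2) = r" "\<And>s. \<lbrakk>x \<le> s; s \<le> t2\<rbrakk> \<Longrightarrow> norm (c s) \<le> r"
    by (rule first_time_above[of x T "\<lambda>t. norm (c t)" r])
      (use x r r_T in \<open>auto intro: continuous_on_subset[OF cont]\<close>)
  have t2_T: "t2 < T - \<eta>"
    using \<eta>(2)[of t2] t2 x r(6) by force
  obtain \<tau> \<sigma> where \<tau>: "0 \<le> \<tau>" "absolutely_continuous_path 0 \<tau> \<sigma>" "\<sigma> 0 = c t1" "\<sigma> \<tau> = c t2"
    "lag.functional 0 \<tau> \<sigma> \<le> ennreal (d (c t1) (c t2))" "\<And>t. \<lbrakk>0 \<le> t; t \<le> \<tau>\<rbrakk> \<Longrightarrow> norm (\<sigma> t) \<le> \<rho> * r"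
    "d (c t1) (c t2) \<le> C * r powr \<beta>" "d (c t1) (c t2) + \<delta> * r powr \<beta> \<le> d (c t1) 0 + d (c t2) 0"
    using short[OF r(1) t1(3) t2(3)] by blast
  define L where "L = d (c t1) (c t2)"
  have "L \<ge> 0" by (simp add: L_def)

  have ac1: "absolutely_continuous_path 0 t1 c" and ac2: "absolutely_continuous_path t1 t2 c"
    and ac3: "absolutely_continuous_path t2 T c" and ac23: "absolutely_continuous_path t1 T c"
    using absolutely_continuous_path_subinterval[OF ac] t1 t2 by auto
  have split: "lag.functional 0 T c = lag.functional 0 t1 c + (lag.functional t1 t2 c + lag.functional t2 T c)"
    using lag.functional_split[OF ac, of t1] lag.functional_split[OF ac23, of t2] t1 t2 by simp
  obtain A1 B A3 where AB: "lag.functional 0 t1 c = ennreal A1" "lag.functional t1 t2 c = ennreal B"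
    "lag.functional t2 T c = ennreal A3" "A1 \<ge> 0" "B \<ge> 0" "A3 \<ge> 0"
    using fin unfolding split
    by (cases "lag.functional 0 t1 c"; cases "lag.functional t1 t2 c"; cases "lag.functional t2 T c") auto
  have A_sum: "A = A1 + (B + A3)"
    using A AB split by (simp flip: ennreal_plus)

  \<comment> \<open>The removed piece passes through the origin at time x, so its length, and hence
    its action, is at least the sum of the distances from its ends to the origin. That sum exceeds L
    by the gap.\<close>
  have B_ge: "L + \<delta> * r powr \<beta> \<le> B"
  proof -
    have "ennreal (d (c t1) (c x)) + ennreal (d (c x) (c t2)) \<le> jm.functional t1 x c + jm.functional x t2 c"
      using d_le_functional[of t1 x c] d_le_functional[of x t2 c] t1 t2
        absolutely_continuous_path_subinterval[OF ac2, of t1 x] absolutely_continuous_path_subinterval[OF ac2, of x t2]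
      by (intro add_mono) auto
    also have "\<dots> = jm.functional t1 t2 c"
      using jm.functional_split[OF ac2] t1 t2 by simp
    also have "\<dots> \<le> ennreal B"
      using jm_le_action[of t1 t2 c] AB by simp
    finally have "d (c t1) 0 + d 0 (c t2) \<le> B"
      using AB x(3) by (simp add: ennreal_le_iff flip: ennreal_plus)
    with \<tau>(8) show ?thesis by (simp add: L_def d_sym[of "c t2"])
  qed
  have time1: "M * (t2 - t1) \<le> B"
  proof -
    have "ennreal (M * (t2 - t1)) \<le> ennreal B"
      unfolding AB(2)[symmetric]
    proof (rule lag_functional_ge_time)
      fix t assume t: "t1 < t" "t < t2"
      then have "norm (c t) \<le> r" using t1(4)[of t] t2(4)[of t] by (cases "t \<le> x") auto
      then show "ennreal M \<le> U (c t)" using r(4) by (intro r0(2)) simp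
    qed (use t1 t2 M in auto)
    then show ?thesis using AB by (simp add: ennreal_le_iff)
  qed
  have time2: "M * \<tau> \<le> L"
  proof -
    have "ennreal (M * (\<tau> - 0)) \<le> lag.functional 0 \<tau> \<sigma>"
    proof (rule lag_functional_ge_time)
      fix t assume "0 < t" "t < \<tau>"
      then show "ennreal M \<le> U (\<sigma> t)" using \<tau>(6)[of t] r(3) by (intro r0(2)) simp
    qed (use \<tau> M in auto)
    from order_trans[OF this \<tau>(5)] show ?thesis
      by (simp add: L_def ennreal_le_iff)
  qed
  \<comment> \<open>The tail loses at most this much of its duration, so at least \<eta> / 2 remains
    for it.\<close>
  have \<tau>_small: "\<tau> \<le> \<eta> / 2"
  proof -
    have "r powr \<beta> \<le> 1" using r(1,2) \<beta>_pos by (intro powr_le1) auto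
    then have "C * r powr \<beta> \<le> C * 1" using pos(2) by (intro mult_left_mono) auto
    then have "M * \<tau> \<le> M * (\<eta> / 2)"
      using time2 \<tau>(7) M(3) unfolding L_def by linarith
    then show ?thesis using M(1) by simp
  qed

  \<comment> \<open>\<open>a\<close> and \<open>b\<close> are the old and the new duration of the
    tail, and \<kappa> is the factor by which its speed is multiplied.\<close>
  define a b \<kappa> where "a = T - t2" "b = T - (t1 + \<tau>)" "\<kappa> = a / b"
  have ab: "a \<ge> \<eta>" "b \<ge> \<eta> / 2" "b > 0" "a > 0"
    using t2_T \<tau>_small t1 t2 \<eta>(1) by (auto simp: a_b_\<kappa>_def)
  have \<kappa>: "\<kappa> = (T - t2) / (T - (t1 + \<tau>))" by (simp add: a_b_\<kappa>_def)
  define c3 where "c3 = (\<lambda>t. c (\<kappa> * t + (t2 - \<kappa> * (t1 + \<tau>))))"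
  have "t2 < T" "t1 + \<tau> < T" using ab by (auto simp: a_b_\<kappa>_def)
  note time_change = lag_functional_time_change[OF ac3 this, folded \<kappa>]
  have tc: "absolutely_continuous_path (t1 + \<tau>) T c3"
    "lag.functional (t1 + \<tau>) T c3 \<le> ennreal (max \<kappa> (1 / \<kappa>)) * lag.functional t2 T c"
    unfolding c3_def by (rule time_change)+
  note tr = lag.functional_translate[OF \<tau>(2), of t1, simplified add_0_left add.commute[of \<tau>]]
  \<comment> \<open>The shortcut, moved so that it starts at time t1, followed by the tail in its
    new time.\<close>
  define c23 where "c23 = (\<lambda>t. if t \<le> t1 + \<tau> then \<sigma> (t - t1) else c3 t)"
  have c3_start: "c3 (t1 + \<tau>) = c t2" by (simp add: c3_def)
  have c3_end: "c3 T = c T"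
  proof -
    have "\<kappa> * T + (t2 - \<kappa> * (t1 + \<tau>)) = \<kappa> * b + t2" by (simp add: a_b_\<kappa>_def(2) algebra_simps)
    also have "\<dots> = T" using ab by (simp add: a_b_\<kappa>_def)
    finally show ?thesis by (simp add: c3_def)
  qed
  have j23: "absolutely_continuous_path t1 T c23"
    "lag.functional t1 T c23 = lag.functional 0 \<tau> \<sigma> + lag.functional (t1 + \<tau>) T c3"
    unfolding c23_def using lag.functional_join[OF tr(1) tc(1)] tr(2) \<tau>(1,4) c3_start \<open>t1 + \<tau> < T\<close> by auto
  define c' where "c' = (\<lambda>t. if t \<le> t1 then c t else c23 t)"
  have "c t1 = c23 t1" using \<tau> by (simp add: c23_def)
  then have j: "absolutely_continuous_path 0 T c'"
    "lag.functional 0 T c' = lag.functional 0 t1 c + lag.functional t1 T c23"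
    unfolding c'_def using lag.functional_join[OF ac1 j23(1)] t1 t2 by auto
  have "c' 0 = c 0" "c' T = c T"
    using t1 \<tau>(1) \<open>t1 + \<tau> < T\<close> c3_end by (auto simp: c'_def c23_def)
  from minimal[OF j(1) this] have "ennreal A \<le> lag.functional 0 T c'" by (simp add: A)
  also have "\<dots> \<le> ennreal A1 + (ennreal L + ennreal (max \<kappa> (1 / \<kappa>)) * ennreal A3)"
    unfolding j(2) j23(2) AB(1)[symmetric] AB(3)[symmetric] L_def
    by (intro add_mono order_refl \<tau>(5) tc(2))
  also have "\<dots> = ennreal (A1 + (L + max \<kappa> (1 / \<kappa>) * A3))"
    using AB(4-6) \<open>L \<ge> 0\<close> ab by (simp add: a_b_\<kappa>_def(3) max_def flip: ennreal_plus ennreal_mult)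
  finally have le': "ennreal A \<le> ennreal (A1 + (L + max \<kappa> (1 / \<kappa>) * A3))" .
  have "0 \<le> max \<kappa> (1 / \<kappa>)" using ab by (simp add: a_b_\<kappa>_def(3) max_def)
  then have "0 \<le> A1 + (L + max \<kappa> (1 / \<kappa>) * A3)"
    using AB(4-6) \<open>L \<ge> 0\<close> by simp
  with le' have "A \<le> A1 + (L + max \<kappa> (1 / \<kappa>) * A3)"
    by (simp only: ennreal_le_iff)
  with A_sum have le: "B + A3 \<le> L + max \<kappa> (1 / \<kappa>) * A3"
    by linarith
  \<comment> \<open>\<open>\<kappa> - 1\<close> and \<open>1 / \<kappa> - 1\<close> are differences
    of the durations of shortcut and removed piece, divided by \<open>b\<close> and by
    \<open>a\<close>. The sum of the durations over \<eta> / 2 bounds both.\<close>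
  define \<omega> where "\<omega> = 2 / \<eta> * (\<tau> + (t2 - t1))"
  have "max \<kappa> (1 / \<kappa>) \<le> 1 + \<omega>"
  proof (rule max.boundedI)
    have "\<kappa> = 1 + (\<tau> - (t2 - t1)) / b"
      using ab by (simp add: a_b_\<kappa>_def field_simps)
    also have "(\<tau> - (t2 - t1)) / b \<le> (\<tau> + (t2 - t1)) / b"
      using ab t1 t2 by (intro divide_right_mono) auto
    also have "\<dots> \<le> (\<tau> + (t2 - t1)) / (\<eta> / 2)"
      using ab t1 t2 \<tau>(1) \<eta>(1) by (intro divide_left_mono) auto
    finally show "\<kappa> \<le> 1 + \<omega>" by (simp add: \<omega>_def mult.commute)
    have "1 / \<kappa> = 1 + ((t2 - t1) - \<tau>) / a"
      using ab by (simp add: a_b_\<kappa>_def field_simps)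
    also have "((t2 - t1) - \<tau>) / a \<le> (\<tau> + (t2 - t1)) / a"
      using ab \<tau>(1) by (intro divide_right_mono) auto
    also have "\<dots> \<le> (\<tau> + (t2 - t1)) / (\<eta> / 2)"
      using ab t1 t2 \<tau>(1) \<eta>(1) by (intro divide_left_mono) auto
    finally show "1 / \<kappa> \<le> 1 + \<omega>" by (simp add: \<omega>_def mult.commute)
  qed
  then have "max \<kappa> (1 / \<kappa>) * A3 \<le> (1 + \<omega>) * A3"
    using AB(6) by (rule mult_right_mono)
  with le have "B \<le> L + \<omega> * A3" by (simp add: distrib_right)
  also have "\<omega> * A3 \<le> \<omega> * A"
    using A_sum AB(4-6) \<eta>(1) t1 t2 \<tau>(1) by (intro mult_left_mono) (auto simp: \<omega>_def)
  also have "\<omega> * A = K * (\<tau> + (t2 - t1))"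
    by (simp add: \<omega>_def K_def)
  also have "\<dots> \<le> \<epsilon> * M * (\<tau> + (t2 - t1))"
    using M(2) t1 t2 \<tau>(1) by (intro mult_right_mono) auto
  also have "\<dots> = \<epsilon> * (M * \<tau> + M * (t2 - t1))"
    by (simp add: algebra_simps)
  also have "\<dots> \<le> \<epsilon> * (L + B)"
    using time1 time2 \<epsilon>(1) by (intro mult_left_mono add_mono) auto
  finally have main: "B \<le> L + \<epsilon> * (L + B)" by simp
  \<comment> \<open>B stands on both sides of the last inequality and has no separate bound in terms
    of r. Writing it as L plus an excess lets the small multiple of the excess be absorbed, and L is
    bounded by \<open>C * r powr \<beta>\<close>.\<close>
  define g where "g = B - L"
  have g: "\<delta> * r powr \<beta> \<le> g" using B_ge by (simp add: g_def)
  have "g \<le> 2 * \<epsilon> * L + \<epsilon> * g"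
    using main by (simp add: g_def algebra_simps)
  also have "\<epsilon> * g \<le> 1 / 2 * g"
    using \<epsilon>(2) g pos(1) by (intro mult_right_mono) (auto intro: order_trans[OF _ g])
  finally have "g \<le> 4 * \<epsilon> * L" by simp
  also have "\<dots> \<le> 4 * \<epsilon> * (C * r powr \<beta>)"
    using \<tau>(7) \<epsilon>(1) by (intro mult_left_mono) (auto simp: L_def)
  also have "\<dots> = (8 * C * \<epsilon>) * r powr \<beta> / 2"
    by simp
  also have "\<dots> \<le> \<delta> * r powr \<beta> / 2"
    using \<epsilon>(3) by (intro divide_right_mono mult_right_mono) auto
  finally have "\<delta> * r powr \<beta> \<le> \<delta> * r powr \<beta> / 2" using g by simp
  moreover have "\<delta> * r powr \<beta> > 0" using pos(1) r(1) by simp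
  ultimately show False by simp
qed

end

theorem (in homogeneous_potential) marchal_if_jm_marchal:
  assumes jm: "jm_marchal_lemma_holds V"
  shows "marchal_lemma_holds V"
  unfolding marchal_lemma_holds_def
proof (intro allI impI notI)
  fix q0 q1 T c
  assume "T > 0 \<and> action_minimizer V q0 q1 T c" and "\<exists>p. interior_collision_point V 0 T c p"
  then have ac: "absolutely_continuous_path 0 T c" and ends: "c 0 = q0" "c T = q1"
    and fin: "lag.functional 0 T c < \<infinity>"
    and minimal: "\<And>\<sigma>. \<lbrakk>absolutely_continuous_path 0 T \<sigma>; \<sigma> 0 = c 0; \<sigma> T = c T\<rbrakk>
      \<Longrightarrow> lag.functional 0 T c \<le> lag.functional 0 T \<sigma>"
    and col: "\<exists>p. interior_collision_point V 0 T c p"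
    by (auto simp: action_minimizer_def joins_in_time_def action_eq)
  from col obtain x where x: "0 \<le> x" "x \<le> T" "c x = 0" and ne: "c 0 \<noteq> 0" "c T \<noteq> 0"
    by (auto simp: interior_collision_point_def collision_point_iff)
  show False
  proof (cases "\<beta> > 0")
    case True
    interpret subcritical_potential V \<alpha> by unfold_locales (rule True)
    show False by (rule no_interior_collision[OF jm ac fin minimal ne x])
  next
    case False
    then show False
      using supercritical_no_collision[OF _ ac fin ne(1) x(1,2)] x(3) by simp
  qed
qed

theorem theorem2:
  fixes V :: "real ^ 'n \<Rightarrow> ereal" and \<alpha> :: real
  assumes "\<alpha> > 0"
    and "potential V"
    and "homogeneous_of_degree (- \<alpha>) V"
    and "smooth_away_from_0 V"
    and "jm_marchal_lemma_holds V"
  shows "marchal_lemma_holds V"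
proof -
  interpret homogeneous_potential V \<alpha> by unfold_locales fact+
  show ?thesis by (rule marchal_if_jm_marchal) fact
qed

end
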